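(* If a closed, orientable $3$-manifold $M$ has an even triangulation with exactly three vertices, then $\pi_1(M)$ has an epimorphism onto $C_2$ or $C_3$.
   Context: A (singular) triangulation of a closed, connected, orientable 3-manifold $M$ is an identification of $M$ with the quotient of a finite disjoint union $\widetilde\Delta$ of oriented Euclidean 3-simplices by orientation-reversing affine isomorphisms pairing all the 2-dimensional faces. Vertices and edges of the triangulation are the images in $M$ of the corners and edges of $\widetilde\Delta$ (faces of one simplex may be identified with each other). The degree of an edge of the triangulation is the number of edges of $\widetilde\Delta$ mapped onto it. The triangulation is even if every edge has even degree. $C_m$ is the cyclic group of order $m$. *)

theory Defs
  imports "HOL-Analysis.Analysis" "HOL-Homology.Homology"
begin

definition closed_3_manifold :: "'a::topological_space set \<Rightarrow> bool" where
  "closed_3_manifold M \<longleftrightarrow>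
     compact M \<and> Hausdorff_space (top_of_set M) \<and> second_countable (top_of_set M) \<and>
     (\<forall>x\<in>M. \<exists>U. openin (top_of_set M) U \<and> x \<in> U \<and> U homeomorphic (UNIV :: (real^3) set))"

text \<open>Existence of a locally consistent choice of generators \<open>\<mu> x\<close> of the local homology
  groups \<open>H\<^sub>n(M, M - {x})\<close>.\<close>

definition orientable :: "nat \<Rightarrow> 'a::topological_space set \<Rightarrow> bool" where
  "orientable n M \<longleftrightarrow>
     (\<exists>\<mu>. (\<forall>x\<in>M.
              \<mu> x \<in> carrier (relative_homology_group (int n) (top_of_set M) (M - {x})) \<and>
              generate (relative_homology_group (int n) (top_of_set M) (M - {x})) {\<mu> x}
                = carrier (relative_homology_group (int n) (top_of_set M) (M - {x}))) \<and>
          (\<forall>x\<in>M. \<exists>U. openin (top_of_set M) U \<and> x \<in> U \<and>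
              (\<exists>\<alpha>\<in>carrier (relative_homology_group (int n) (top_of_set M) (M - U)).
                 \<forall>y\<in>U. hom_induced (int n) (top_of_set M) (M - U) (top_of_set M) (M - {y}) id \<alpha>
                        = \<mu> y)))"

definition loops_at :: "'a::topological_space set \<Rightarrow> 'a \<Rightarrow> (real \<Rightarrow> 'a) set" where
  "loops_at S x = {p. path p \<and> path_image p \<subseteq> S \<and> pathstart p = x \<and> pathfinish p = x}"

definition path_class :: "'a::topological_space set \<Rightarrow> (real \<Rightarrow> 'a) \<Rightarrow> (real \<Rightarrow> 'a) set" where
  "path_class S p = {q. homotopic_paths S p q}"

definition fundamental_group ::
    "'a::topological_space set \<Rightarrow> 'a \<Rightarrow> (real \<Rightarrow> 'a) set monoid" where
  "fundamental_group S x =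
     \<lparr>carrier = path_class S ` loops_at S x,
      monoid.mult = (\<lambda>A B. \<Union>p\<in>A. \<Union>q\<in>B. path_class S (p +++ q)),
      one = path_class S (\<lambda>_. x)\<rparr>"

lemma path_class_eq_iff:
  assumes "p \<in> loops_at S x"
  shows "path_class S p = path_class S q \<longleftrightarrow> homotopic_paths S p q"
proof
  assume "path_class S p = path_class S q"
  moreover have "p \<in> path_class S p"
    using assms by (simp add: path_class_def loops_at_def)
  ultimately show "homotopic_paths S p q"
    by (simp add: path_class_def homotopic_paths_sym_eq)
next
  assume pq: "homotopic_paths S p q"
  have "homotopic_paths S p r \<longleftrightarrow> homotopic_paths S q r" for r
    using homotopic_paths_trans[OF pq] homotopic_paths_trans[OF homotopic_paths_sym[OF pq]] by blast
  then show "path_class S p = path_class S q"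
    by (simp add: path_class_def)
qed

lemma loops_at_join: "p \<in> loops_at S x \<Longrightarrow> q \<in> loops_at S x \<Longrightarrow> p +++ q \<in> loops_at S x"
  by (auto simp: loops_at_def path_image_join)

lemma loops_at_const: "x \<in> S \<Longrightarrow> (\<lambda>_. x) \<in> loops_at S x"
  by (auto simp: loops_at_def path_def path_image_def pathstart_def pathfinish_def)

lemma mult_path_class:
  assumes "p \<in> loops_at S x" "q \<in> loops_at S x"
  shows "path_class S p \<otimes>\<^bsub>fundamental_group S x\<^esub> path_class S q = path_class S (p +++ q)"
proof -
  have eq: "path_class S (p' +++ q') = path_class S (p +++ q)"
    if "homotopic_paths S p p'" "homotopic_paths S q q'" for p' q'
  proof -
    have "homotopic_paths S (p +++ q) (p' +++ q')"
      using assms by (intro homotopic_paths_join that) (simp add: loops_at_def)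
    then show ?thesis
      using path_class_eq_iff[OF loops_at_join[OF assms]] by metis
  qed
  have "homotopic_paths S p p" "homotopic_paths S q q"
    using assms by (auto simp: loops_at_def)
  then have "(\<Union>p'\<in>path_class S p. \<Union>q'\<in>path_class S q. path_class S (p' +++ q'))
      = path_class S (p +++ q)"
    using eq unfolding path_class_def[of S p] path_class_def[of S q] by blast
  then show ?thesis by (simp add: fundamental_group_def)
qed

lemma homotopic_const_join:
  assumes "p \<in> loops_at S x"
  shows "homotopic_paths S ((\<lambda>_. x) +++ p) p"
proof (rule homotopic_paths_sym, rule homotopic_paths_reparametrize[where f = "\<lambda>t. max 0 (2*t - 1)"])
  show "continuous_on {0..1} (\<lambda>t::real. max 0 (2*t - 1))"
    by (intro continuous_intros)
  show "((\<lambda>_. x) +++ p) t = p (max 0 (2*t - 1))" if "t \<in> {0..1}" for t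
  proof (cases "t \<le> 1/2")
    case True
    then have "max 0 (2*t - 1) = 0" by simp
    then show ?thesis
      using assms True by (simp add: loops_at_def joinpaths_def pathstart_def)
  qed (simp add: joinpaths_def max_def)
qed (use assms in \<open>auto simp: loops_at_def max_def\<close>)

lemma homotopic_reverse_join:
  assumes "p \<in> loops_at S x"
  shows "homotopic_paths S (reversepath p +++ p) (\<lambda>_. x)"
proof -
  have p: "path p" "path_image p \<subseteq> S" "p 0 = x" "p 1 = x"
    using assms by (auto simp: loops_at_def pathstart_def pathfinish_def)
  have c: "continuous_on {0..1} p" and im: "p ` {0..1} \<subseteq> S"
    using p by (auto simp: path_def path_image_def)
  define k where "k = (\<lambda>z::real\<times>real. 1 - (1 - fst z) * min (2 * snd z) (2 - 2 * snd z))"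
  have k: "k z \<in> {0..1}" if "z \<in> {0..1} \<times> {0..1}" for z
  proof -
    have "0 \<le> min (2 * snd z) (2 - 2 * snd z)" "min (2 * snd z) (2 - 2 * snd z) \<le> 1"
      "0 \<le> 1 - fst z" "1 - fst z \<le> 1"
      using that by (auto simp: min_def)
    then show ?thesis
      unfolding k_def by (smt (verit) atLeastAtMost_iff mult_nonneg_nonneg mult_left_le_one_le)
  qed
  have "continuous_on ({0..1}\<times>{0..1}) (p \<circ> k)"
  proof (rule continuous_on_compose)
    show "continuous_on ({0..1}\<times>{0..1}) k" unfolding k_def by (intro continuous_intros)
    show "continuous_on (k ` ({0..1}\<times>{0..1})) p"
      using k by (auto intro: continuous_on_subset[OF c])
  qed
  moreover have "p (k z) \<in> S" if "z \<in> {0..1} \<times> {0..1}" for z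
    using k[OF that] im by auto
  moreover have "(p \<circ> k) (0, t) = (reversepath p +++ p) t" if "t \<in> {0..1}" for t
    using that by (auto simp: k_def joinpaths_def reversepath_def min_def algebra_simps)
  moreover have "(p \<circ> k) (1, t) = x" for t
    using p by (auto simp: k_def)
  moreover have "(p \<circ> k) (s, 0) = x" "(p \<circ> k) (s, 1) = x" for s
    using p by (auto simp: k_def)
  ultimately show ?thesis
    unfolding homotopic_paths
    by (intro exI[of _ "p \<circ> k"]) (auto simp: pathstart_def pathfinish_def joinpaths_def reversepath_def p)
qed

lemma group_fundamental_group:
  assumes "x \<in> S"
  shows "group (fundamental_group S x)"
proof (rule groupI)
  let ?G = "fundamental_group S x"
  have carr: "carrier ?G = path_class S ` loops_at S x"
    and one: "\<one>\<^bsub>?G\<^esub> = path_class S (\<lambda>_. x)"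
    by (simp_all add: fundamental_group_def)
  show "A \<otimes>\<^bsub>?G\<^esub> B \<in> carrier ?G" if "A \<in> carrier ?G" "B \<in> carrier ?G" for A B
    using that by (auto simp: carr mult_path_class loops_at_join)
  show "\<one>\<^bsub>?G\<^esub> \<in> carrier ?G"
    using assms by (auto simp: carr one loops_at_const)
  show "A \<otimes>\<^bsub>?G\<^esub> B \<otimes>\<^bsub>?G\<^esub> C = A \<otimes>\<^bsub>?G\<^esub> (B \<otimes>\<^bsub>?G\<^esub> C)"
    if "A \<in> carrier ?G" "B \<in> carrier ?G" "C \<in> carrier ?G" for A B C
  proof -
    obtain p q r where pqr: "p \<in> loops_at S x" "q \<in> loops_at S x" "r \<in> loops_at S x"
      and ABC: "A = path_class S p" "B = path_class S q" "C = path_class S r"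
      using \<open>A \<in> carrier ?G\<close> \<open>B \<in> carrier ?G\<close> \<open>C \<in> carrier ?G\<close> unfolding carr by blast
    have "homotopic_paths S (p +++ (q +++ r)) ((p +++ q) +++ r)"
      using pqr by (intro homotopic_paths_assoc) (auto simp: loops_at_def)
    then have "path_class S (p +++ (q +++ r)) = path_class S ((p +++ q) +++ r)"
      using path_class_eq_iff[OF loops_at_join[OF pqr(1) loops_at_join[OF pqr(2,3)]]] by simp
    then show ?thesis
      using pqr by (simp add: ABC mult_path_class loops_at_join)
  qed
  show "\<one>\<^bsub>?G\<^esub> \<otimes>\<^bsub>?G\<^esub> A = A" if A: "A \<in> carrier ?G" for A
  proof -
    obtain p where p: "p \<in> loops_at S x" "A = path_class S p"
      using A unfolding carr by blast
    have "path_class S ((\<lambda>_. x) +++ p) = path_class S p"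
      using path_class_eq_iff[OF loops_at_join[OF loops_at_const[OF assms] p(1)]]
        homotopic_const_join[OF p(1)] by blast
    then show ?thesis
      using mult_path_class[OF loops_at_const[OF assms] p(1)] by (simp add: one p(2))
  qed
  show "\<exists>B\<in>carrier ?G. B \<otimes>\<^bsub>?G\<^esub> A = \<one>\<^bsub>?G\<^esub>" if A: "A \<in> carrier ?G" for A
  proof -
    obtain p where p: "p \<in> loops_at S x" "A = path_class S p"
      using A unfolding carr by blast
    have r: "reversepath p \<in> loops_at S x"
      using p by (auto simp: loops_at_def)
    have "path_class S (reversepath p) \<otimes>\<^bsub>?G\<^esub> A = \<one>\<^bsub>?G\<^esub>"
      using mult_path_class[OF r p(1)] path_class_eq_iff[OF loops_at_join[OF r p(1)]]
        homotopic_reverse_join[OF p(1)] by (simp add: one p(2))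
    moreover have "path_class S (reversepath p) \<in> carrier ?G"
      using r by (simp add: carr)
    ultimately show ?thesis by (rule bexI)
  qed
qed

text \<open>Gluing data for a family of oriented Euclidean 3-simplices \<open>tet t\<close>, for \<open>t \<in> tets\<close>.
  The sign \<open>ori t\<close> is the orientation of \<open>tet t\<close> relative to the standard orientation of
  \<open>\<real>\<^sup>3\<close>.  A 2-face of the disjoint union is a pair of an index and a facet; \<open>partner\<close> pairs
  up the 2-faces, and \<open>glue f\<close> is the map from the 2-face \<open>f\<close> to its partner.\<close>

record 'i gluing =
  tets :: "'i set"
  tet :: "'i \<Rightarrow> (real^3) set"
  ori :: "'i \<Rightarrow> real"
  partner :: "'i \<times> (real^3) set \<Rightarrow> 'i \<times> (real^3) set"
  glue :: "'i \<times> (real^3) set \<Rightarrow> real^3 \<Rightarrow> real^3"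

definition faces :: "'i gluing \<Rightarrow> ('i \<times> (real^3) set) set" where
  "faces T = {(t, F). t \<in> tets T \<and> F facet_of tet T t}"

definition affine_iso :: "(real^3) set \<Rightarrow> (real^3) set \<Rightarrow> (real^3 \<Rightarrow> real^3) \<Rightarrow> bool" where
  "affine_iso F F' g \<longleftrightarrow>
     bij_betw g F F' \<and> (\<exists>L b. linear L \<and> (\<forall>x\<in>F. g x = L x + b))"

text \<open>Orientation (\<open>1\<close>, \<open>-1\<close>, or \<open>0\<close> if degenerate) of the triangle \<open>u v w\<close> in a face of the
  oriented simplex \<open>tet T t\<close> with respect to the induced boundary orientation, outward vector
  first.  The point \<open>a\<close> is any point of the simplex off the face, so that \<open>u - a\<close> points
  outwards.\<close>

definition boundary_orientation ::
    "'i gluing \<Rightarrow> 'i \<Rightarrow> real^3 \<Rightarrow> real^3 \<Rightarrow> real^3 \<Rightarrow> real^3 \<Rightarrow> real" where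
  "boundary_orientation T t a u v w =
     ori T t * sgn (det (vector [u - a, v - u, w - u] :: real^3^3))"

definition orientation_reversing :: "'i gluing \<Rightarrow> 'i \<times> (real^3) set \<Rightarrow> bool" where
  "orientation_reversing T f \<longleftrightarrow>
     (\<forall>a \<in> tet T (fst f) - snd f. \<forall>a' \<in> tet T (fst (partner T f)) - snd (partner T f).
        \<forall>u\<in>snd f. \<forall>v\<in>snd f. \<forall>w\<in>snd f.
          boundary_orientation T (fst (partner T f)) a' (glue T f u) (glue T f v) (glue T f w)
            = - boundary_orientation T (fst f) a u v w)"

definition valid_gluing :: "'i gluing \<Rightarrow> bool" where
  "valid_gluing T \<longleftrightarrow>
     finite (tets T) \<and>
     (\<forall>t\<in>tets T. 3 simplex tet T t \<and> ori T t \<in> {1, -1}) \<and>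
     (\<forall>f\<in>faces T.
        partner T f \<in> faces T \<and> partner T f \<noteq> f \<and> partner T (partner T f) = f \<and>
        affine_iso (snd f) (snd (partner T f)) (glue T f) \<and>
        (\<forall>x\<in>snd f. glue T (partner T f) (glue T f x) = x) \<and>
        orientation_reversing T f)"

definition tet_space :: "'i gluing \<Rightarrow> ('i \<times> (real^3)) topology" where
  "tet_space T = sum_topology (\<lambda>t. top_of_set (tet T t)) (tets T)"

definition glue_rel :: "'i gluing \<Rightarrow> (('i \<times> (real^3)) \<times> ('i \<times> (real^3))) set" where
  "glue_rel T = {((fst f, x), (fst (partner T f), glue T f x)) | f x. f \<in> faces T \<and> x \<in> snd f}"

text \<open>\<open>q\<close> identifies \<open>M\<close> with the quotient of the disjoint union by the equivalence relation
  that the gluing maps generate.\<close>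

definition triangulation :: "'i gluing \<Rightarrow> ('i \<times> (real^3) \<Rightarrow> 'a) \<Rightarrow> 'a::topological_space set \<Rightarrow> bool" where
  "triangulation T q M \<longleftrightarrow>
     valid_gluing T \<and>
     quotient_map (tet_space T) (top_of_set M) q \<and>
     (\<forall>y\<in>topspace (tet_space T). \<forall>z\<in>topspace (tet_space T).
        q y = q z \<longleftrightarrow> (y, z) \<in> (glue_rel T \<union> (glue_rel T)\<inverse>)\<^sup>*)"

definition triangulation_vertices :: "'i gluing \<Rightarrow> ('i \<times> (real^3) \<Rightarrow> 'a) \<Rightarrow> 'a set" where
  "triangulation_vertices T q = {q (t, v) | t v. t \<in> tets T \<and> v extreme_point_of tet T t}"

definition tet_edges :: "'i gluing \<Rightarrow> ('i \<times> (real^3) set) set" where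
  "tet_edges T = {(t, E). t \<in> tets T \<and> E edge_of tet T t}"

definition edge_image :: "('i \<times> (real^3) \<Rightarrow> 'a) \<Rightarrow> 'i \<times> (real^3) set \<Rightarrow> 'a set" where
  "edge_image q e = q ` ({fst e} \<times> snd e)"

definition triangulation_edges :: "'i gluing \<Rightarrow> ('i \<times> (real^3) \<Rightarrow> 'a) \<Rightarrow> 'a set set" where
  "triangulation_edges T q = edge_image q ` tet_edges T"

definition edge_degree :: "'i gluing \<Rightarrow> ('i \<times> (real^3) \<Rightarrow> 'a) \<Rightarrow> 'a set \<Rightarrow> nat" where
  "edge_degree T q e = card {d \<in> tet_edges T. edge_image q d = e}"

definition even_triangulation ::
    "'i gluing \<Rightarrow> ('i \<times> (real^3) \<Rightarrow> 'a) \<Rightarrow> 'a::topological_space set \<Rightarrow> bool" where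
  "even_triangulation T q M \<longleftrightarrow>
     triangulation T q M \<and> (\<forall>e\<in>triangulation_edges T q. even (edge_degree T q e))"

end

(* Label the corners of each simplex by four labels. Crossing a 2-face and keeping the labels of its
   corners transports labellings, and transport around an edge of even degree is trivial: it respects
   the direction of the edge because face pairings reverse orientation and no face is paired with
   itself, and each crossing reverses the orientation of a labelled simplex, so that an even number
   of crossings cannot end with the two other labels swapped. Around a vertex transport is trivial
   because a punctured ball is simply connected. Hence the labellings form a covering of M and
   transport of labels is a representation of the fundamental group by permutations of four labels.
   It is nontrivial: two of the four corners of some simplex are the same vertex of M, and a loop
   running from one to the other inside this simplex moves labels. Finally every nontrivial group of
   permutations of four letters has a quotient of order 2 or 3. *)

theory Submission
  imports Defs
begin

section \<open>Flat sections and path lifting\<close>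

text \<open>The covering is given by its local sections and not built as a space. A point of it over
  \<open>z\<close> is a frame: the coordinates of \<open>z\<close> in a labelled simplex, with the
  class of that simplex under crossings of faces through \<open>z\<close>. Such a crossing changes
  neither labels nor coordinates. The obstacle is that a simplex may be glued to itself:
  \<open>z\<close> can have several coordinate vectors in one simplex, and going around
  \<open>z\<close> might return to the same point of the same simplex with permuted labels.
  \<open>good w x\<close> excludes the latter; over good points relabellings act freely and
  transitively on frames. Sections are defined over the good points, an open set, so that paths can
  be lifted before all points are known to be good. Hence interior points, faces and edges are
  settled by combinatorics, and vertices afterwards by lifting paths that avoid them. The numbers 2
  and 3 come from the series 1 < V_4 < A_4 < S_4, whose factors are C_2 x C_2, C_3 and C_2.\<close>

lemma openin_square_box:
  fixes N :: "(real \<times> real) set"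
  assumes "openin (top_of_set ({0..1} \<times> {0..1})) N" "(a, b) \<in> N"
  obtains e where "e > 0"
    "\<And>s t. s \<in> {0..1} \<inter> ball a e \<Longrightarrow> t \<in> {0..1} \<inter> ball b e \<Longrightarrow> (s, t) \<in> N"
proof -
  obtain G where G: "open G" "N = ({0..1} \<times> {0..1}) \<inter> G"
    using assms(1) unfolding openin_open by blast
  then have "(a, b) \<in> G" using assms(2) by blast
  then obtain A B where AB: "open A" "open B" "a \<in> A" "b \<in> B" "A \<times> B \<subseteq> G"
    using open_prod_elim[OF G(1)] by (metis mem_Sigma_iff)
  obtain d e where de: "d > 0" "ball a d \<subseteq> A" "e > 0" "ball b e \<subseteq> B"
    using AB open_contains_ball by metis
  show ?thesis
  proof (rule that[of "min d e"])
    show "min d e > 0" using de by simp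
    fix s t assume "s \<in> {0..1} \<inter> ball a (min d e)" "t \<in> {0..1} \<inter> ball b (min d e)"
    then have "s \<in> A" "t \<in> B" "s \<in> {0..1}" "t \<in> {0..1}" using de by auto
    then show "(s, t) \<in> N" using AB G by blast
  qed
qed

lemma connected_unit_ball_Int: "connected ({0..1} \<inter> ball (a::real) e)"
  by (intro convex_connected convex_Int convex_ball) simp

text \<open>A covering of \<open>X\<close> described through its sections alone. That agreement and
  disagreement of two sections are both open conditions replaces the topology of the total space;
  \<open>sec_through\<close> is even covering, a single \<open>U\<close> carrying a section through
  each value that occurs over one of its points.\<close>

locale flat_bundle =
  fixes X :: "'a::topological_space set" and Sec :: "('a set \<times> ('a \<Rightarrow> 'f)) set"
  assumes sec_open: "(U, s) \<in> Sec \<Longrightarrow> openin (top_of_set X) U"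
    and sec_agree: "\<lbrakk>(U, s) \<in> Sec; (V, r) \<in> Sec; y \<in> U; y \<in> V; s y = r y\<rbrakk> \<Longrightarrow>
      \<exists>W. openin (top_of_set X) W \<and> y \<in> W \<and> W \<subseteq> U \<inter> V \<and> (\<forall>z\<in>W. s z = r z)"
    and sec_disagree: "\<lbrakk>(U, s) \<in> Sec; (V, r) \<in> Sec; y \<in> U; y \<in> V; s y \<noteq> r y\<rbrakk> \<Longrightarrow>
      \<exists>W. openin (top_of_set X) W \<and> y \<in> W \<and> W \<subseteq> U \<inter> V \<and> (\<forall>z\<in>W. s z \<noteq> r z)"
    and sec_through: "y \<in> X \<Longrightarrow> \<exists>U. openin (top_of_set X) U \<and> y \<in> U \<and>
      (\<forall>z V r. z \<in> U \<longrightarrow> (V, r) \<in> Sec \<longrightarrow> z \<in> V \<longrightarrow> (\<exists>s. (U, s) \<in> Sec \<and> s z = r z))"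
begin

text \<open>Stands for a continuous lift of \<open>h\<close> to the covering; following a section
  locally takes the place of continuity.\<close>

definition flat_on :: "'k::topological_space set \<Rightarrow> ('k \<Rightarrow> 'a) \<Rightarrow> ('k \<Rightarrow> 'f) \<Rightarrow> bool" where
  "flat_on K h l \<longleftrightarrow> (\<forall>k\<in>K. \<exists>U s N. (U, s) \<in> Sec \<and> openin (top_of_set K) N \<and> k \<in> N \<and>
     h ` N \<subseteq> U \<and> (\<forall>j\<in>N. l j = s (h j)))"

lemma flat_onE:
  assumes "flat_on K h l" "k \<in> K"
  obtains U s N where "(U, s) \<in> Sec" "openin (top_of_set K) N" "k \<in> N" "h ` N \<subseteq> U"
    "\<forall>j\<in>N. l j = s (h j)"
proof -
  have "\<exists>U s N. (U, s) \<in> Sec \<and> openin (top_of_set K) N \<and> k \<in> N \<and> h ` N \<subseteq> U \<and> (\<forall>j\<in>N. l j = s (h j))"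
    using assms unfolding flat_on_def by (rule bspec)
  then show ?thesis by (elim exE conjE) (rule that, simp_all)
qed

lemma flat_on_subset:
  assumes "flat_on K h l" "J \<subseteq> K"
  shows "flat_on J h l"
  unfolding flat_on_def
proof
  fix k assume k: "k \<in> J"
  then have "k \<in> K" using assms(2) by blast
  then obtain U s N where "(U, s) \<in> Sec" "openin (top_of_set K) N" "k \<in> N" "h ` N \<subseteq> U"
    "\<forall>j\<in>N. l j = s (h j)"
    by (rule flat_onE[OF assms(1)])
  moreover have "openin (top_of_set J) (J \<inter> N)"
    using \<open>openin (top_of_set K) N\<close> assms(2) unfolding openin_open by blast
  ultimately show "\<exists>U s N. (U, s) \<in> Sec \<and> openin (top_of_set J) N \<and> k \<in> N \<and>
     h ` N \<subseteq> U \<and> (\<forall>j\<in>N. l j = s (h j))"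
    using k by (intro exI[of _ U] exI[of _ s] exI[of _ "J \<inter> N"]) auto
qed

lemma flat_on_compose:
  assumes "flat_on K h l" "continuous_on J f" "f ` J \<subseteq> K"
  shows "flat_on J (h \<circ> f) (l \<circ> f)"
  unfolding flat_on_def
proof
  fix k assume k: "k \<in> J"
  then have "f k \<in> K" using assms(3) by blast
  then obtain U s N where "(U, s) \<in> Sec" "openin (top_of_set K) N" "f k \<in> N" "h ` N \<subseteq> U"
    "\<forall>j\<in>N. l j = s (h j)"
    by (rule flat_onE[OF assms(1)])
  moreover have "openin (top_of_set J) (J \<inter> f -` N)"
    using continuous_openin_preimage[OF assms(2) _ \<open>openin (top_of_set K) N\<close>] assms(3) by blast
  ultimately show "\<exists>U s N. (U, s) \<in> Sec \<and> openin (top_of_set J) N \<and> k \<in> N \<and>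
     (h \<circ> f) ` N \<subseteq> U \<and> (\<forall>j\<in>N. (l \<circ> f) j = s ((h \<circ> f) j))"
    using k by (intro exI[of _ U] exI[of _ s] exI[of _ "J \<inter> f -` N"]) auto
qed

lemma flat_on_section:
  assumes "(U, s) \<in> Sec" "h ` K \<subseteq> U"
  shows "flat_on K h (\<lambda>k. s (h k))"
  unfolding flat_on_def using assms by (metis openin_subtopology_self)

lemma flat_on_cong:
  assumes "flat_on K h l" "\<And>k. k \<in> K \<Longrightarrow> h k = h' k" "\<And>k. k \<in> K \<Longrightarrow> l k = l' k"
  shows "flat_on K h' l'"
  unfolding flat_on_def
proof
  fix k assume k: "k \<in> K"
  then obtain U s N where N: "(U, s) \<in> Sec" "openin (top_of_set K) N" "k \<in> N" "h ` N \<subseteq> U"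
    "\<forall>j\<in>N. l j = s (h j)"
    by (rule flat_onE[OF assms(1)])
  have "N \<subseteq> K" using N(2) openin_imp_subset by blast
  then have N': "\<And>j. j \<in> N \<Longrightarrow> h j = h' j \<and> l j = l' j" using assms(2,3) by blast
  then have "h' ` N \<subseteq> U" using N(4) by force
  moreover have "\<forall>j\<in>N. l' j = s (h' j)" using N(5) N' by metis
  ultimately show "\<exists>U s N. (U, s) \<in> Sec \<and> openin (top_of_set K) N \<and> k \<in> N \<and>
     h' ` N \<subseteq> U \<and> (\<forall>j\<in>N. l' j = s (h' j))"
    using N(1-3) by metis
qed

text \<open>Each lift follows a section near a given point, and two sections either agree near it or
  differ near it. So agreement is locally constant and spreads over the connected
  \<open>K\<close>.\<close>

lemma flat_on_unique:
  assumes K: "connected K" and h: "continuous_on K h" "h ` K \<subseteq> X"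
    and l: "flat_on K h l" "flat_on K h l'" and k: "k \<in> K" "l k = l' k" "j \<in> K"
  shows "l j = l' j"
proof (rule connected_induction_simple[OF K k(1) k(3), where P = "\<lambda>i. l i = l' i"])
  fix a assume a: "a \<in> K"
  obtain U s N where 1: "(U, s) \<in> Sec" "openin (top_of_set K) N" "a \<in> N" "h ` N \<subseteq> U"
    "\<forall>j\<in>N. l j = s (h j)" by (rule flat_onE[OF l(1) a])
  obtain V r L where 2: "(V, r) \<in> Sec" "openin (top_of_set K) L" "a \<in> L" "h ` L \<subseteq> V"
    "\<forall>j\<in>L. l' j = r (h j)" by (rule flat_onE[OF l(2) a])
  have "h a \<in> U" "h a \<in> V" using 1 2 by auto
  then obtain W where W: "openin (top_of_set X) W" "h a \<in> W" 
    "(\<forall>z\<in>W. s z = r z) \<or> (\<forall>z\<in>W. s z \<noteq> r z)"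
    using sec_agree[OF 1(1) 2(1)] sec_disagree[OF 1(1) 2(1)] by metis
  have "openin (top_of_set K) (K \<inter> h -` W)"
    using continuous_openin_preimage[OF h(1) _ W(1)] h(2) by blast
  then have "openin (top_of_set K) (N \<inter> L \<inter> (K \<inter> h -` W))"
    using 1(2) 2(2) by blast
  moreover have "a \<in> N \<inter> L \<inter> (K \<inter> h -` W)" using 1 2 W a by auto
  moreover have "l x = l' x \<longleftrightarrow> s (h x) = r (h x)" if "x \<in> N \<inter> L \<inter> (K \<inter> h -` W)" for x
    using that 1(5) 2(5) by auto
  ultimately show "\<exists>T. openin (top_of_set K) T \<and> a \<in> T \<and> (\<forall>x\<in>T. \<forall>y\<in>T. l x = l' x \<longrightarrow> l y = l' y)"
    using W(3) by (intro exI[of _ "N \<inter> L \<inter> (K \<inter> h -` W)"]) auto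
qed (use k in auto)

text \<open>At a point of both pieces the two sections have the same value, hence coincide near its
  image, and one of them serves both sides. At a point of one piece only, the other piece is closed
  and can be avoided.\<close>

lemma flat_on_glue:
  assumes h: "continuous_on (A \<union> B) h" "h ` (A \<union> B) \<subseteq> X"
    and cl: "closed A" "closed B" and l: "flat_on A h l" "flat_on B h l"
  shows "flat_on (A \<union> B) h l"
  unfolding flat_on_def
proof
  have single: "\<exists>U s N. (U, s) \<in> Sec \<and> openin (top_of_set (P \<union> Q)) N \<and> k \<in> N \<and>
     h ` N \<subseteq> U \<and> (\<forall>j\<in>N. l j = s (h j))"
    if P: "flat_on P h l" "k \<in> P" and Q: "closed Q" "k \<notin> Q" for P Q k
  proof -
    obtain U s N where 1: "(U, s) \<in> Sec" "openin (top_of_set P) N" "k \<in> N" "h ` N \<subseteq> U"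
      "\<forall>j\<in>N. l j = s (h j)" by (rule flat_onE[OF P])
    obtain G where G: "open G" "N = P \<inter> G" using 1(2) unfolding openin_open by blast
    have "openin (top_of_set (P \<union> Q)) ((P \<union> Q) \<inter> (G \<inter> - Q))"
      using G(1) Q(1) by (intro openin_open_Int) auto
    moreover have "(P \<union> Q) \<inter> (G \<inter> - Q) \<subseteq> N" "k \<in> (P \<union> Q) \<inter> (G \<inter> - Q)"
      using G Q 1(3) by auto
    ultimately show ?thesis using 1 by (meson image_mono subset_iff subset_trans)
  qed
  fix k assume k: "k \<in> A \<union> B"
  consider "k \<in> A" "k \<notin> B" | "k \<in> B" "k \<notin> A" | "k \<in> A" "k \<in> B" using k by blast
  then show "\<exists>U s N. (U, s) \<in> Sec \<and> openin (top_of_set (A \<union> B)) N \<and> k \<in> N \<and>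
     h ` N \<subseteq> U \<and> (\<forall>j\<in>N. l j = s (h j))"
  proof cases
    case 1 then show ?thesis using single[OF l(1) _ cl(2)] by blast
  next
    case 2 then show ?thesis using single[OF l(2) _ cl(1)] by (simp add: Un_commute)
  next
    case 3
    obtain U s N where 1: "(U, s) \<in> Sec" "openin (top_of_set A) N" "k \<in> N" "h ` N \<subseteq> U"
      "\<forall>j\<in>N. l j = s (h j)" by (rule flat_onE[OF l(1) 3(1)])
    obtain V r L where 2: "(V, r) \<in> Sec" "openin (top_of_set B) L" "k \<in> L" "h ` L \<subseteq> V"
      "\<forall>j\<in>L. l j = r (h j)" by (rule flat_onE[OF l(2) 3(2)])
    have "h k \<in> U" "h k \<in> V" using 1 2 by auto
    moreover have "s (h k) = r (h k)" using 1(3,5) 2(3,5) by metis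
    ultimately obtain W where W: "openin (top_of_set X) W" "h k \<in> W" "W \<subseteq> U \<inter> V" "\<forall>z\<in>W. s z = r z"
      using sec_agree[OF 1(1) 2(1)] by metis
    obtain G where G: "open G" "N = A \<inter> G" using 1(2) unfolding openin_open by blast
    obtain F where F: "open F" "L = B \<inter> F" using 2(2) unfolding openin_open by blast
    let ?D = "(A \<union> B) \<inter> (G \<inter> F) \<inter> ((A \<union> B) \<inter> h -` W)"
    have "openin (top_of_set (A \<union> B)) ?D"
      using h(2) G(1) F(1)
      by (intro openin_Int[OF openin_open_Int continuous_openin_preimage[OF h(1) _ W(1)]]) auto
    moreover have "k \<in> ?D" using W 3 G F 1(3) 2(3) by auto
    moreover have "h ` ?D \<subseteq> U" using W by auto
    moreover have "l j = s (h j)" if "j \<in> ?D" for j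
      using that W(4) 1(5) 2(5) G F by auto
    ultimately show ?thesis using 1(1) by blast
  qed
qed

text \<open>Having a lift on an initial interval passes between any two nearby end points
  \<open>x\<close> and \<open>y\<close>, in either order: backwards by restriction, forwards by
  following over \<open>U\<close> the section through the value reached at \<open>x\<close>.
  Connectedness of the unit interval does the rest.\<close>

lemma flat_lift_exists:
  fixes p :: "real \<Rightarrow> 'a"
  assumes p: "path p" "path_image p \<subseteq> X" and V: "(V, r) \<in> Sec" "pathstart p \<in> V"
  obtains l where "flat_on {0..1} p l" "l 0 = r (pathstart p)"
proof -
  have pc: "continuous_on {0..1} p" "p ` {0..1} \<subseteq> X"
    using p by (auto simp: path_def path_image_def)
  have "\<exists>l. flat_on {0..1::real} p l \<and> l 0 = r (p 0)"
  proof (rule connected_induction_simple[where S = "{0..1::real}" and a = 0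
        and P = "\<lambda>\<tau>. \<exists>l. flat_on {0..\<tau>} p l \<and> l 0 = r (p 0)"])
    show "\<exists>l. flat_on {0..0} p l \<and> l 0 = r (p 0)"
      using flat_on_section[OF V(1), of p "{0}"] V(2) by (auto simp: pathstart_def)
  next
    fix a :: real assume a: "a \<in> {0..1}"
    then have "p a \<in> X" using pc by blast
    then obtain U where U: "openin (top_of_set X) U" "p a \<in> U" and
      thr: "\<And>z V r. z \<in> U \<Longrightarrow> (V, r) \<in> Sec \<Longrightarrow> z \<in> V \<Longrightarrow> \<exists>s. (U, s) \<in> Sec \<and> s z = r z"
      using sec_through by metis
    have "openin (top_of_set {0..1}) ({0..1} \<inter> p -` U)"
      using continuous_openin_preimage[OF pc(1) _ U(1)] pc(2) by blast
    then obtain e where e: "e > 0" "ball a e \<inter> {0..1} \<subseteq> {0..1} \<inter> p -` U"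
      using openin_contains_ball[of "{0..1}" "{0..1} \<inter> p -` U"] a U(2) by (metis IntI vimageI)
    have "\<exists>l. flat_on {0..y} p l \<and> l 0 = r (p 0)"
      if x: "x \<in> {0..1} \<inter> ball a e" and y: "y \<in> {0..1} \<inter> ball a e"
        and l: "flat_on {0..x} p l" "l 0 = r (p 0)" for x y l
    proof (cases "y \<le> x")
      case True
      then show ?thesis using flat_on_subset[OF l(1), of "{0..y}"] l(2) by auto
    next
      case False
      have "p x \<in> U" using e x by auto
      moreover obtain V' r' where "(V', r') \<in> Sec" "p x \<in> V'" "l x = r' (p x)"
      proof -
        have "x \<in> {0..x}" using x by simp
        then obtain V' r' N where "(V', r') \<in> Sec" "x \<in> N" "p ` N \<subseteq> V'" "\<forall>j\<in>N. l j = r' (p j)"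
          by (rule flat_onE[OF l(1)])
        then show ?thesis using that by blast
      qed
      ultimately obtain s where s: "(U, s) \<in> Sec" "s (p x) = l x" using thr by metis
      have cv: "closed_segment x y \<subseteq> {0..1} \<inter> ball a e"
        using x y by (intro closed_segment_subset convex_Int convex_ball) auto
      have img: "p ` {x..y} \<subseteq> U"
        using cv e False by (auto simp: closed_segment_eq_real_ivl)
      define l' where "l' = (\<lambda>t. if t \<le> x then l t else s (p t))"
      have "flat_on ({0..x} \<union> {x..y}) p l'"
      proof (rule flat_on_glue)
        have "{0..x} \<union> {x..y} \<subseteq> {0..1}" using x y by auto
        then show "continuous_on ({0..x} \<union> {x..y}) p" "p ` ({0..x} \<union> {x..y}) \<subseteq> X"
          using pc by (auto intro: continuous_on_subset)
        show "flat_on {0..x} p l'"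
          by (rule flat_on_cong[OF l(1)]) (auto simp: l'_def)
        show "flat_on {x..y} p l'"
          by (rule flat_on_cong[OF flat_on_section[OF s(1) img]]) (auto simp: l'_def s(2))
      qed auto
      moreover have "{0..x} \<union> {x..y} = {0..y}" using x False by auto
      moreover have "l' 0 = r (p 0)" using l x by (simp add: l'_def)
      ultimately show ?thesis by auto
    qed
    moreover have "openin (top_of_set {0..1}) ({0..1} \<inter> ball a e)"
      by (intro openin_open_Int) simp
    ultimately show "\<exists>T. openin (top_of_set {0..1}) T \<and> a \<in> T \<and> (\<forall>x\<in>T. \<forall>y\<in>T.
       (\<exists>l. flat_on {0..x} p l \<and> l 0 = r (p 0)) \<longrightarrow> (\<exists>l. flat_on {0..y} p l \<and> l 0 = r (p 0)))"
      using a e(1) by (intro exI[of _ "{0..1} \<inter> ball a e"]) (auto simp del: ball_eq_greaterThanLessThan)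
  qed auto
  then show ?thesis using that by (auto simp: pathstart_def)
qed

text \<open>Along a family of paths with common end points, the lifts of the paths close to a given one
  are cut out by the same finite chain of sections, so the end point of the lift is locally
  constant in the parameter.\<close>

lemma flat_lift_homotopic:
  assumes hom: "homotopic_paths X p p'"
    and l: "flat_on {0..1} p l" "flat_on {0..1} p' l'" "l 0 = l' 0"
  shows "l 1 = l' 1"
proof -
  define I where "I = {0..1::real}"
  obtain h where h: "continuous_on (I \<times> I) h" "h ` (I \<times> I) \<subseteq> X"
    and h0: "\<And>t. t \<in> I \<Longrightarrow> h (0, t) = p t" and h1: "\<And>t. t \<in> I \<Longrightarrow> h (1, t) = p' t"
    and hs: "\<And>s. s \<in> I \<Longrightarrow> h (s, 0) = p 0" and hf: "\<And>s. s \<in> I \<Longrightarrow> h (s, 1) = p 1"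
  proof -
    obtain h where h: "continuous_on ({0..1} \<times> {0..1}) h" "h \<in> {0..1} \<times> {0..1} \<rightarrow> X"
      "\<forall>x\<in>{0..1}. h (0, x) = p x" "\<forall>x\<in>{0..1}. h (1, x) = p' x"
      "\<forall>t\<in>{0..1::real}. pathstart (h \<circ> Pair t) = pathstart p \<and> pathfinish (h \<circ> Pair t) = pathfinish p"
      using hom unfolding homotopic_paths by blast
    show ?thesis
      by (rule that[of h]) (use h in \<open>auto simp: I_def pathstart_def pathfinish_def\<close>)
  qed
  have I01: "0 \<in> I" "1 \<in> I" by (auto simp: I_def)
  have slice: "continuous_on J (\<lambda>t. h (s, t))" "(\<lambda>t. h (s, t)) ` J \<subseteq> X" if "s \<in> I" "J \<subseteq> I" for s J
    using that h by (auto intro!: continuous_on_compose2[OF h(1)] continuous_intros)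
  obtain V r where V: "(V, r) \<in> Sec" "p 0 \<in> V" "r (p 0) = l 0"
  proof -
    have "0 \<in> {0..1::real}" by simp
    then obtain V r N where "(V, r) \<in> Sec" "openin (top_of_set {0..1}) N" "0 \<in> N" "p ` N \<subseteq> V"
        "\<forall>j\<in>N. l j = r (p j)"
      by (rule flat_onE[OF l(1)])
    then show ?thesis using that[of V r] by auto
  qed
  have "\<exists>l'. flat_on I (\<lambda>t. h (s, t)) l' \<and> l' 0 = l 0" if s: "s \<in> I" for s
  proof -
    have "path (\<lambda>t. h (s, t))" "path_image (\<lambda>t. h (s, t)) \<subseteq> X"
      using slice[OF s, of I] by (auto simp: path_def path_image_def I_def)
    then show ?thesis
      using flat_lift_exists[of "\<lambda>t. h (s, t)" V r] V hs[OF s] unfolding I_def pathstart_def by metis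
  qed
  then obtain L where L: "\<And>s. s \<in> I \<Longrightarrow> flat_on I (\<lambda>t. h (s, t)) (L s)" "\<And>s. s \<in> I \<Longrightarrow> L s 0 = l 0"
    by metis
  have uniq: "L s t = \<sigma> (h (s, t))"
    if "(U, \<sigma>) \<in> Sec" "J \<subseteq> I" "connected J" "s \<in> I" "\<And>t. t \<in> J \<Longrightarrow> h (s, t) \<in> U" "u \<in> J"
      "L s u = \<sigma> (h (s, u))" "t \<in> J" for U \<sigma> J s u t
  proof (rule flat_on_unique[where K = J and h = "\<lambda>t. h (s, t)" and k = u and l' = "\<lambda>t. \<sigma> (h (s, t))"])
    show "flat_on J (\<lambda>t. h (s, t)) (L s)" using flat_on_subset[OF L(1)] that by blast
    show "flat_on J (\<lambda>t. h (s, t)) (\<lambda>t. \<sigma> (h (s, t)))"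
      by (rule flat_on_section[OF that(1)]) (use that in auto)
  qed (use that slice in auto)
  have box: "\<exists>e>0. \<forall>s\<in>I \<inter> ball a e. \<forall>t\<in>I \<inter> ball b e. (s, t) \<in> N"
    if "openin (top_of_set (I \<times> I)) N" "(a, b) \<in> N" for a b N
    using openin_square_box[of N a b] that unfolding I_def by metis
  have pre: "openin (top_of_set (I \<times> I)) ((I \<times> I) \<inter> h -` U)" if "openin (top_of_set X) U" for U
    using continuous_openin_preimage[OF h(1) _ that] h(2) by blast
  have conI: "connected (I \<inter> ball a e)" for a e
    unfolding I_def by (rule connected_unit_ball_Int)
  \<comment> \<open>The lifts \<open>L s\<close> are chosen independently of each other.
    \<open>P s0 \<tau>\<close> says that near \<open>(s0, \<tau>)\<close> a single section produces
    them all, which makes them continuous in \<open>s\<close> there.\<close>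
  define P where "P = (\<lambda>s0 \<tau>. \<exists>U \<sigma> e. (U, \<sigma>) \<in> Sec \<and> e > 0 \<and>
    (\<forall>s\<in>I \<inter> ball s0 e. \<forall>t\<in>I \<inter> ball \<tau> e. h (s, t) \<in> U \<and> L s t = \<sigma> (h (s, t))))"
  have P0: "P s0 0" if s0: "s0 \<in> I" for s0
  proof -
    have "(s0, 0) \<in> (I \<times> I) \<inter> h -` V" using s0 V I01 hs by simp
    then obtain e where e: "e > 0" "\<forall>s\<in>I \<inter> ball s0 e. \<forall>t\<in>I \<inter> ball 0 e. h (s, t) \<in> V"
      using box[OF pre[OF sec_open[OF V(1)]]] by (metis IntD2 vimageE)
    have "L s t = r (h (s, t))" if "s \<in> I \<inter> ball s0 e" "t \<in> I \<inter> ball 0 e" for s t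
      using that e I01 V L(2) hs
      by (intro uniq[OF V(1), of "I \<inter> ball 0 e" s 0 t] conI) (auto simp del: ball_eq_greaterThanLessThan)
    then show ?thesis unfolding P_def using V(1) e by blast
  qed
  have step: "\<exists>T. openin (top_of_set I) T \<and> a \<in> T \<and> (\<forall>x\<in>T. \<forall>y\<in>T. P s0 x \<longrightarrow> P s0 y)"
    if s0: "s0 \<in> I" and a: "a \<in> I" for s0 a
  proof -
    have "h (s0, a) \<in> X" using h s0 a by blast
    then obtain U where U: "openin (top_of_set X) U" "h (s0, a) \<in> U" and
      thr: "\<And>z V r. z \<in> U \<Longrightarrow> (V, r) \<in> Sec \<Longrightarrow> z \<in> V \<Longrightarrow> \<exists>s. (U, s) \<in> Sec \<and> s z = r z"
      using sec_through by metis
    have "(s0, a) \<in> (I \<times> I) \<inter> h -` U" using s0 a U by simp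
    then obtain e where e: "e > 0" "\<forall>s\<in>I \<inter> ball s0 e. \<forall>t\<in>I \<inter> ball a e. h (s, t) \<in> U"
      using box[OF pre[OF U(1)]] by (metis IntD2 vimageE)
    have "P s0 y" if x: "x \<in> I \<inter> ball a e" and y: "y \<in> I \<inter> ball a e" and Px: "P s0 x" for x y
    proof -
      obtain V' \<sigma>' d where 1: "(V', \<sigma>') \<in> Sec" "d > 0"
        "\<And>s t. s\<in>I \<inter> ball s0 d \<Longrightarrow> t\<in>I \<inter> ball x d \<Longrightarrow> h (s, t) \<in> V' \<and> L s t = \<sigma>' (h (s, t))"
        using Px unfolding P_def by metis
      have xx: "x \<in> I \<inter> ball x d" "s0 \<in> I \<inter> ball s0 d" "s0 \<in> I \<inter> ball s0 e"
        using x s0 1(2) e(1) by (auto simp del: ball_eq_greaterThanLessThan)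
      then have hV: "h (s0, x) \<in> V'" "h (s0, x) \<in> U" using 1(3) e(2) x by blast+
      obtain \<sigma> where \<sigma>: "(U, \<sigma>) \<in> Sec" "\<sigma> (h (s0, x)) = \<sigma>' (h (s0, x))"
        using thr[OF hV(2) 1(1) hV(1)] by blast
      then obtain W where W: "openin (top_of_set X) W" "h (s0, x) \<in> W" "\<forall>z\<in>W. \<sigma> z = \<sigma>' z"
        using sec_agree[OF \<sigma>(1) 1(1) hV(2) hV(1)] by blast
      have "(s0, x) \<in> (I \<times> I) \<inter> h -` W" using xx W by simp
      then obtain c where c: "c > 0" "\<forall>s\<in>I \<inter> ball s0 c. \<forall>t\<in>I \<inter> ball x c. h (s, t) \<in> W"
        using box[OF pre[OF W(1)]] by (metis IntD2 vimageE)
      obtain b where b: "b > 0" "ball y b \<subseteq> ball a e"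
        using y open_contains_ball[of "ball a e"] by blast
      \<comment> \<open>\<open>b\<close> keeps \<open>t\<close> in the interval around
        \<open>a\<close>, \<open>c\<close> and \<open>d\<close> make \<open>\<sigma>\<close> agree
        with the lifts at the parameter \<open>x\<close>, and \<open>e\<close> keeps
        \<open>h\<close> inside \<open>U\<close>. Uniqueness along the interval carries the
        agreement from \<open>x\<close> to \<open>t\<close>.\<close>
      define k where "k = min (min b c) (min d e)"
      have k: "k > 0" "k \<le> b" "k \<le> c" "k \<le> d" "k \<le> e" using b(1) c(1) 1(2) e(1) by (auto simp: k_def)
      have "h (s, t) \<in> U \<and> L s t = \<sigma> (h (s, t))" if s: "s\<in>I \<inter> ball s0 k" and t: "t\<in>I \<inter> ball y k" for s t
      proof -
        have "t \<in> ball a e" using t subset_ball[OF k(2), of y] b(2) by blast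
        then have sb: "s \<in> I \<inter> ball s0 c" "s \<in> I \<inter> ball s0 d" "s \<in> I \<inter> ball s0 e" and tb: "t \<in> I \<inter> ball a e"
          using s t k by (auto simp del: ball_eq_greaterThanLessThan)
        have "x \<in> I \<inter> ball x c" using xx c(1) by simp
        then have "L s x = \<sigma> (h (s, x))" using 1(3)[OF sb(2) xx(1)] c(2) sb(1) W(3) by metis
        then have "L s t = \<sigma> (h (s, t))"
          using sb x tb e(2) by (intro uniq[OF \<sigma>(1), of "I \<inter> ball a e" s x t] conI) auto
        then show ?thesis using e(2) sb(3) tb by blast
      qed
      then show ?thesis unfolding P_def using \<sigma>(1) k(1) by blast
    qed
    moreover have "openin (top_of_set I) (I \<inter> ball a e)" by (intro openin_open_Int) simp
    moreover have "a \<in> I \<inter> ball a e" using a e(1) by simp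
    ultimately show ?thesis by blast
  qed
  have conn: "connected I" unfolding I_def by simp
  have P1: "P s0 1" if s0: "s0 \<in> I" for s0
    by (rule connected_induction_simple[OF conn I01 P0[OF s0] step[OF s0]])
  have "L 1 1 = l 1"
  proof (rule connected_induction_simple[OF conn I01, where P = "\<lambda>s. L s 1 = l 1"])
    show "L 0 1 = l 1"
    proof (rule flat_on_unique[where K = I and h = p and k = 0])
      show "flat_on I p (L 0)" by (rule flat_on_cong[OF L(1)]) (use I01 h0 in auto)
      show "continuous_on I p" "p ` I \<subseteq> X"
        using homotopic_paths_imp_path[OF hom] homotopic_paths_imp_subset[OF hom]
        by (auto simp: path_def path_image_def I_def)
    qed (use I01 conn l L(2) in \<open>auto simp: I_def\<close>)
  next
    fix a assume a: "a \<in> I"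
    obtain U \<sigma> e where e: "(U, \<sigma>) \<in> Sec" "e > 0"
      "\<And>s t. s\<in>I \<inter> ball a e \<Longrightarrow> t\<in>I \<inter> ball 1 e \<Longrightarrow> L s t = \<sigma> (h (s, t))"
      using P1[OF a] unfolding P_def by metis
    \<comment> \<open>All these paths end in the one point \<open>p 1\<close>, so the value of the
      section there does not depend on \<open>s\<close>.\<close>
    have "L s 1 = \<sigma> (p 1)" if "s \<in> I \<inter> ball a e" for s
      using e(3)[OF that, of 1] hf that I01 e(2) by simp
    then have "\<forall>x\<in>I \<inter> ball a e. \<forall>y\<in>I \<inter> ball a e. L x 1 = l 1 \<longrightarrow> L y 1 = l 1" by metis
    moreover have "openin (top_of_set I) (I \<inter> ball a e)" by (intro openin_open_Int) simp
    moreover have "a \<in> I \<inter> ball a e" using a e(2) by simp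
    ultimately show "\<exists>T. openin (top_of_set I) T \<and> a \<in> T \<and> (\<forall>x\<in>T. \<forall>y\<in>T. L x 1 = l 1 \<longrightarrow> L y 1 = l 1)"
      by blast
  qed
  moreover have "L 1 1 = l' 1"
  proof (rule flat_on_unique[where K = I and h = p' and k = 0 and j = 1 and l = "L 1" and l' = l'])
    show "flat_on I p' (L 1)" by (rule flat_on_cong[OF L(1)]) (use I01 h1 in auto)
    show "continuous_on I p'" "p' ` I \<subseteq> X"
      using homotopic_paths_imp_path[OF hom] homotopic_paths_imp_subset[OF hom]
      by (auto simp: path_def path_image_def I_def)
  qed (use I01 conn l L(2) in \<open>auto simp: I_def\<close>)
  ultimately show ?thesis by simp
qed

section \<open>Transport along paths\<close>

definition lifts_to :: "(real \<Rightarrow> 'a) \<Rightarrow> 'f \<Rightarrow> 'f \<Rightarrow> bool" where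
  "lifts_to p f f' \<longleftrightarrow> (\<exists>l. flat_on {0..1} p l \<and> l 0 = f \<and> l 1 = f')"

lemma lifts_to_exists:
  assumes "path p" "path_image p \<subseteq> X" "(V, r) \<in> Sec" "pathstart p \<in> V"
  shows "\<exists>f'. lifts_to p (r (pathstart p)) f'"
  using flat_lift_exists[OF assms] unfolding lifts_to_def by metis

lemma lifts_to_end:
  assumes "lifts_to p f f'"
  shows "\<exists>V r. (V, r) \<in> Sec \<and> pathfinish p \<in> V \<and> f' = r (pathfinish p)"
proof -
  obtain l where l: "flat_on {0..1} p l" "l 1 = f'" using assms unfolding lifts_to_def by blast
  have "1 \<in> {0..1::real}" by simp
  then obtain U s N where "(U, s) \<in> Sec" "openin (top_of_set {0..1}) N" "1 \<in> N" "p ` N \<subseteq> U"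
      "\<forall>j\<in>N. l j = s (p j)"
    by (rule flat_onE[OF l(1)])
  then show ?thesis using l(2) unfolding pathfinish_def by blast
qed

lemma lifts_to_homotopic:
  assumes "homotopic_paths X p p'" "lifts_to p f f'" "lifts_to p' f f''"
  shows "f' = f''"
  using flat_lift_homotopic[OF assms(1)] assms(2,3) unfolding lifts_to_def by metis

lemma lifts_to_unique:
  assumes "path p" "path_image p \<subseteq> X" "lifts_to p f f'" "lifts_to p f f''"
  shows "f' = f''"
  using lifts_to_homotopic[of p p] assms by simp

lemma lifts_to_join:
  assumes p: "path p" "path_image p \<subseteq> X" and p': "path p'" "path_image p' \<subseteq> X"
    and e: "pathfinish p = pathstart p'" and l: "lifts_to p f f'" "lifts_to p' f' f''"
  shows "lifts_to (p +++ p') f f''"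
proof -
  obtain l where l: "flat_on {0..1} p l" "l 0 = f" "l 1 = f'" using l(1) unfolding lifts_to_def by blast
  obtain l' where l': "flat_on {0..1} p' l'" "l' 0 = f'" "l' 1 = f''" 
    using assms(7) unfolding lifts_to_def by blast
  define k where "k = (\<lambda>t::real. if t \<le> 1/2 then l (2*t) else l' (2*t - 1))"
  have U: "{0..1/2} \<union> {1/2..1} = {0..1::real}" by auto
  have pj: "path (p +++ p')" "path_image (p +++ p') \<subseteq> X"
    using p p' e by (auto simp: path_image_join)
  have "flat_on ({0..1/2} \<union> {1/2..1}) (p +++ p') k"
  proof (rule flat_on_glue)
    show "flat_on {0..1/2} (p +++ p') k"
      by (rule flat_on_cong[OF flat_on_compose[OF l(1), of "{0..1/2}" "\<lambda>t. 2*t"]])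
        (auto simp: k_def joinpaths_def intro!: continuous_intros)
    show "flat_on {1/2..1} (p +++ p') k"
    proof (rule flat_on_cong[OF flat_on_compose[OF l'(1), of "{1/2..1}" "\<lambda>t. 2*t-1"]])
      fix t :: real assume "t \<in> {1/2..1}"
      moreover have "p 1 = p' 0" using e by (simp add: pathfinish_def pathstart_def)
      ultimately have "(p' \<circ> (\<lambda>t. 2 * t - 1)) t = (p +++ p') t \<and> (l' \<circ> (\<lambda>t. 2 * t - 1)) t = k t"
      proof (cases "t = 1/2")
        case True
        then show ?thesis unfolding True using \<open>p 1 = p' 0\<close> l(3) l'(2) by (simp add: k_def joinpaths_def)
      qed (simp add: k_def joinpaths_def)
      then show "(p' \<circ> (\<lambda>t. 2 * t - 1)) t = (p +++ p') t" "(l' \<circ> (\<lambda>t. 2 * t - 1)) t = k t"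
        by auto
    qed (auto intro!: continuous_intros)
    show "continuous_on ({0..1/2} \<union> {1/2..1}) (p +++ p')" "(p +++ p') ` ({0..1/2} \<union> {1/2..1}) \<subseteq> X"
      unfolding U using pj by (auto simp: path_def path_image_def)
  qed auto
  moreover have "k 0 = f" "k 1 = f''" using l l' by (auto simp: k_def)
  ultimately show ?thesis unfolding lifts_to_def U by blast
qed

lemma lifts_to_const:
  assumes "(V, r) \<in> Sec" "a \<in> V"
  shows "lifts_to (\<lambda>_. a) (r a) (r a)"
  using flat_on_section[OF assms(1), of "\<lambda>_. a" "{0..1}"] assms(2) unfolding lifts_to_def by auto

end

section \<open>Labelled complexes and their bundle of frames\<close>

definition bary_simplex :: "(real^'l::finite) set" where
  "bary_simplex = {x. (\<forall>i. 0 \<le> x $ i) \<and> (\<Sum>i\<in>UNIV. x $ i) = 1}"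

text \<open>Relabelling is a right action: if the naming \<open>c\<close> of the corners is replaced
  by \<open>c \<circ> g\<close>, then label \<open>i\<close> names the corner
  \<open>c (g i)\<close>, so the coordinates of a fixed point have to be read off through
  \<open>g\<close>.\<close>

definition relabel :: "real^'l::finite \<Rightarrow> ('l \<Rightarrow> 'l) \<Rightarrow> real^'l" where
  "relabel x g = (\<chi> i. x $ g i)"

definition zeros :: "real^'l::finite \<Rightarrow> 'l set" where
  "zeros x = {i. x $ i = 0}"

text \<open>The prefix syntax for \<open>inv_into UNIV\<close> is taken by inverses in groups.\<close>

abbreviation pinv :: "('b \<Rightarrow> 'c) \<Rightarrow> 'c \<Rightarrow> 'b" where
  "pinv \<equiv> inv_into UNIV"

text \<open>In use \<open>Z\<close> is the set of labels with vanishing coordinate, so that only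
  faces through the point are crossed and the orbit lists the labelled simplices met around
  it.\<close>

inductive_set orb :: "('l \<Rightarrow> 'w \<Rightarrow> 'w) \<Rightarrow> 'l set \<Rightarrow> 'w \<Rightarrow> 'w set" for c Z w where
  orb_base: "w \<in> orb c Z w"
| orb_step: "v \<in> orb c Z w \<Longrightarrow> i \<in> Z \<Longrightarrow> c i v \<in> orb c Z w"

lemma relabel_nth [simp]: "relabel x g $ i = x $ g i"
  by (simp add: relabel_def)

lemma relabel_id [simp]: "relabel x id = x"
  by (simp add: vec_eq_iff)

lemma relabel_relabel: "relabel (relabel x g) h = relabel x (g \<circ> h)"
  by (simp add: vec_eq_iff)

lemma convex_bary_simplex: "convex (bary_simplex :: (real^'l::finite) set)"
  by (rule convexI) (auto simp: bary_simplex_def sum.distrib simp flip: sum_distrib_left)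

lemma relabel_in_bary_simplex: "bij g \<Longrightarrow> x \<in> bary_simplex \<Longrightarrow> relabel x g \<in> bary_simplex"
  using sum.reindex_bij_betw[of g UNIV UNIV "\<lambda>i. x $ i"] by (simp add: bary_simplex_def)

lemma dist_relabel: "bij g \<Longrightarrow> dist (relabel x g) (relabel y g) = dist x y"
  using sum.reindex_bij_betw[of g UNIV UNIV "\<lambda>i. (dist (x $ i) (y $ i))\<^sup>2"]
  by (simp add: dist_vec_def L2_set_def)

lemma continuous_on_relabel: "continuous_on S (\<lambda>x. relabel x g)"
  unfolding relabel_def by (intro continuous_intros)

lemma zeros_relabel: "zeros (relabel x g) = g -` zeros x"
  by (auto simp: zeros_def)

lemma orb_trans: "u \<in> orb c Z v \<Longrightarrow> v \<in> orb c Z w \<Longrightarrow> u \<in> orb c Z w"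
  by (induction rule: orb.induct) (auto intro: orb.intros)

lemma orb_mono: "u \<in> orb c Y w \<Longrightarrow> Y \<subseteq> Z \<Longrightarrow> u \<in> orb c Z w"
  by (induction rule: orb.induct) (auto intro: orb.intros)

lemma orb_empty: "orb c {} w = {w}"
proof -
  have "u = w" if "u \<in> orb c {} w" for u using that by induction auto
  then show ?thesis using orb_base by fast
qed

text \<open>How small a ball around \<open>x\<close> has to be. The bound on coordinates makes the
  faces through a nearby point pass through \<open>x\<close> as well. The factor 2 lets the triangle
  inequality in \<open>isolating_relabel\<close> show that a relabelling that keeps a nearby point
  in the ball fixes \<open>x\<close>.\<close>

definition isolating :: "real^'l::finite \<Rightarrow> real \<Rightarrow> bool" where
  "isolating x e \<longleftrightarrow> e > 0 \<and> (\<forall>i. x $ i \<noteq> 0 \<longrightarrow> e \<le> \<bar>x $ i\<bar>) \<and>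
     (\<forall>g. relabel x g \<noteq> x \<longrightarrow> 2 * e \<le> dist (relabel x g) x)"

lemma isolating_mono: "isolating x e \<Longrightarrow> 0 < d \<Longrightarrow> d \<le> e \<Longrightarrow> isolating x d"
  unfolding isolating_def by (meson mult_left_mono order_trans zero_le_numeral)

lemma isolating_exists: "\<exists>e. isolating x e"
proof -
  \<comment> \<open>The element 1 keeps the set nonempty, so that \<open>Min\<close> is
    meaningful.\<close>
  let ?A = "insert 1 ({\<bar>x $ i\<bar> | i. x $ i \<noteq> 0} \<union> {dist (relabel x g) x / 2 | g. relabel x g \<noteq> x})"
  have "finite {\<bar>x $ i\<bar> | i. x $ i \<noteq> 0}" "finite {dist (relabel x g) x / 2 | g. relabel x g \<noteq> x}"
    by (rule finite_image_set, simp)+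
  then have A: "finite ?A" "?A \<noteq> {}" by auto
  have "\<forall>a\<in>?A. 0 < a"
  proof
    fix a assume "a \<in> ?A"
    then consider "a = 1" | i where "a = \<bar>x $ i\<bar>" "x $ i \<noteq> 0"
      | g where "a = dist (relabel x g) x / 2" "relabel x g \<noteq> x" by blast
    then show "0 < a" by cases (hypsubst, simp)+
  qed
  then have pos: "Min ?A > 0" using A by (subst Min_gr_iff) blast+
  define m where "m = Min ?A"
  have "m \<le> \<bar>x $ i\<bar>" if "x $ i \<noteq> 0" for i
    unfolding m_def using A(1) by (rule Min_le) (use that in blast)
  moreover have "2 * m \<le> dist (relabel x g) x" if "relabel x g \<noteq> x" for g
  proof -
    have "m \<le> dist (relabel x g) x / 2"
      unfolding m_def using A(1) by (rule Min_le) (use that in blast)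
    then show ?thesis by simp
  qed
  ultimately show ?thesis using pos unfolding isolating_def m_def[symmetric] by blast
qed

lemma isolating_zeros:
  assumes "isolating x e" "dist y x < e" shows "zeros y \<subseteq> zeros x"
proof
  fix i assume "i \<in> zeros y"
  then have "\<bar>x $ i\<bar> < e"
    using dist_vec_nth_le[of y i x] assms(2) by (simp add: zeros_def dist_real_def)
  then show "i \<in> zeros x" using assms(1) unfolding isolating_def zeros_def by force
qed

lemma isolating_relabel:
  assumes "isolating x e" "bij g" "dist y x < e" "dist (relabel y g) x < e"
  shows "relabel x g = x"
proof (rule ccontr)
  assume "relabel x g \<noteq> x"
  then have "2 * e \<le> dist (relabel x g) x" using assms(1) by (simp add: isolating_def)
  also have "\<dots> \<le> dist (relabel x g) (relabel y g) + dist (relabel y g) x" by (rule dist_triangle)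
  also have "\<dots> = dist y x + dist (relabel y g) x"
    using dist_relabel[OF assms(2), of x y] by (simp add: dist_commute)
  finally show False using assms by simp
qed

text \<open>Relabelling \<open>relabel x g\<close> by \<open>h\<close> corresponds to relabelling
  \<open>x\<close> by the conjugate \<open>g \<circ> h \<circ> pinv g\<close>, and relabelling by a
  bijection is an isometry.\<close>

lemma isolating_relabelled:
  assumes "bij g" "isolating x e" shows "isolating (relabel x g) e"
  unfolding isolating_def
proof (intro conjI allI impI)
  show "e > 0" "\<And>i. relabel x g $ i \<noteq> 0 \<Longrightarrow> e \<le> \<bar>relabel x g $ i\<bar>"
    using assms by (auto simp: isolating_def)
  fix h assume h: "relabel (relabel x g) h \<noteq> relabel x g"
  have inv: "g \<circ> pinv g = id" "bij (pinv g)" using assms(1)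
    by (simp_all add: bij_imp_bij_inv bij_is_surj flip: surj_iff)
  have undo: "relabel (relabel x g) (pinv g) = x" by (simp add: relabel_relabel inv)
  have "relabel x (g \<circ> h \<circ> pinv g) \<noteq> x"
  proof
    assume "relabel x (g \<circ> h \<circ> pinv g) = x"
    then have "relabel (relabel x (g \<circ> h \<circ> pinv g)) g = relabel x g" by simp
    moreover have "g \<circ> h \<circ> pinv g \<circ> g = g \<circ> h"
      using assms(1) by (simp add: fun_eq_iff bij_is_inj)
    ultimately show False using h by (simp add: relabel_relabel)
  qed
  then have "2 * e \<le> dist (relabel x (g \<circ> h \<circ> pinv g)) x" using assms(2) by (simp add: isolating_def)
  also have "\<dots> = dist (relabel (relabel (relabel x g) h) (pinv g)) (relabel (relabel x g) (pinv g))"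
    by (simp add: relabel_relabel inv comp_assoc)
  also have "\<dots> = dist (relabel (relabel x g) h) (relabel x g)" using dist_relabel[OF inv(2)] .
  finally show "2 * e \<le> dist (relabel (relabel x g) h) (relabel x g)" .
qed

text \<open>\<open>Om\<close> plays the role of the simplices with labelled corners, \<open>Q w\<close> of the characteristic map of
  such a simplex in barycentric coordinates, \<open>cross i\<close> of the passage to the neighbour across the
  face opposite to the corner labelled \<open>i\<close>, and \<open>act\<close> of the change of labels.\<close>

locale labelled_complex =
  fixes M :: "'a::topological_space set" and Om :: "'w set" and cross :: "'l::finite \<Rightarrow> 'w \<Rightarrow> 'w"
    and act :: "'w \<Rightarrow> ('l \<Rightarrow> 'l) \<Rightarrow> 'w" and Q :: "'w \<Rightarrow> real^'l \<Rightarrow> 'a"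
  assumes finite_Om: "finite Om"
    and cross_in: "w \<in> Om \<Longrightarrow> cross i w \<in> Om"
    and cross_cross: "w \<in> Om \<Longrightarrow> cross i (cross i w) = w"
    and act_in: "w \<in> Om \<Longrightarrow> bij g \<Longrightarrow> act w g \<in> Om"
    and act_id: "act w id = w"
    and act_act: "act (act w g) h = act w (g \<circ> h)"
    and act_free: "w \<in> Om \<Longrightarrow> act w g = w \<Longrightarrow> g = id"
    and cross_act: "w \<in> Om \<Longrightarrow> bij g \<Longrightarrow> cross i (act w g) = act (cross (g i) w) g"
    and Q_cont: "w \<in> Om \<Longrightarrow> continuous_on bary_simplex (Q w)"
    and Q_in: "w \<in> Om \<Longrightarrow> x \<in> bary_simplex \<Longrightarrow> Q w x \<in> M"
    and Q_surj: "z \<in> M \<Longrightarrow> \<exists>w\<in>Om. \<exists>x\<in>bary_simplex. z = Q w x"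
    and Q_open: "U \<subseteq> M \<Longrightarrow>
      (\<And>w. w \<in> Om \<Longrightarrow> openin (top_of_set bary_simplex) {x \<in> bary_simplex. Q w x \<in> U}) \<Longrightarrow>
      openin (top_of_set M) U"
    and Q_cross: "w \<in> Om \<Longrightarrow> x \<in> bary_simplex \<Longrightarrow> x $ i = 0 \<Longrightarrow> Q (cross i w) x = Q w x"
    and Q_act: "w \<in> Om \<Longrightarrow> bij g \<Longrightarrow> x \<in> bary_simplex \<Longrightarrow> Q (act w g) (relabel x g) = Q w x"
    and Q_eq: "w \<in> Om \<Longrightarrow> w' \<in> Om \<Longrightarrow> x \<in> bary_simplex \<Longrightarrow> x' \<in> bary_simplex \<Longrightarrow> Q w x = Q w' x' \<Longrightarrow>
      \<exists>g. bij g \<and> act w' g \<in> orb cross (zeros x) w \<and> x = relabel x' g"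
begin

abbreviation orbit :: "real^'l \<Rightarrow> 'w \<Rightarrow> 'w set" where
  "orbit x w \<equiv> orb cross (zeros x) w"

section \<open>Orbits of crossings and good points\<close>

lemma orb_in: "v \<in> orb cross Z w \<Longrightarrow> w \<in> Om \<Longrightarrow> v \<in> Om"
  by (induction rule: orb.induct) (auto intro: cross_in)

lemma orb_sym: "v \<in> orb cross Z w \<Longrightarrow> w \<in> Om \<Longrightarrow> w \<in> orb cross Z v"
proof (induction rule: orb.induct)
  case (orb_step v i)
  then have "v \<in> orb cross Z (cross i v)"
    using orb.orb_step[OF orb_base, of i Z cross "cross i v"] by (simp add: cross_cross orb_in)
  then show ?case using orb_trans orb_step by fast
qed (rule orb_base)

lemma orb_eq:
  assumes v: "v \<in> orb cross Z w" "w \<in> Om"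
  shows "orb cross Z v = orb cross Z w"
proof (intro Set.set_eqI iffI)
  fix u
  show "u \<in> orb cross Z w" if "u \<in> orb cross Z v" by (rule orb_trans[OF that v(1)])
  show "u \<in> orb cross Z v" if "u \<in> orb cross Z w" by (rule orb_trans[OF that orb_sym[OF v]])
qed

lemma orb_act:
  assumes g: "bij g" and w: "w \<in> Om" and v: "v \<in> orb cross Z w"
  shows "act v g \<in> orb cross (g -` Z) (act w g)"
  using v
proof (induction rule: orb.induct)
  case (orb_step v i)
  have gi: "g (pinv g i) = i" using g by (simp add: bij_is_surj surj_f_inv_f)
  have "cross (pinv g i) (act v g) \<in> orb cross (g -` Z) (act w g)"
    by (rule orb.orb_step[OF orb_step.IH]) (simp add: gi orb_step.hyps)
  then show ?case using cross_act[OF orb_in[OF orb_step.hyps(1) w] g, of "pinv g i"] by (simp add: gi)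
qed (rule orb_base)

lemma orbit_act:
  assumes "bij g" "w \<in> Om" "v \<in> orbit x w"
  shows "act v g \<in> orbit (relabel x g) (act w g)"
  using orb_act[OF assms] by (simp add: zeros_relabel)

lemma bij_inv:
  assumes "bij (g :: 'l \<Rightarrow> 'l)"
  shows "bij (pinv g)" "g \<circ> pinv g = id" "pinv g \<circ> g = id"
  using assms by (simp_all add: bij_imp_bij_inv bij_is_surj bij_is_inj flip: surj_iff)

lemma act_inv: "bij g \<Longrightarrow> act (act w g) (pinv g) = w"
  by (simp add: act_act bij_inv act_id)

lemma relabel_inv: "bij (g :: 'l \<Rightarrow> 'l) \<Longrightarrow> relabel (relabel x g) (pinv g) = x"
  by (simp add: relabel_relabel bij_inv)

lemma orbit_act_image:
  assumes "bij g" "w \<in> Om"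
  shows "(\<lambda>v. act v g) ` orbit x w = orbit (relabel x g) (act w g)"
proof
  show "(\<lambda>v. act v g) ` orbit x w \<subseteq> orbit (relabel x g) (act w g)"
    using orbit_act[OF assms] by blast
  show "orbit (relabel x g) (act w g) \<subseteq> (\<lambda>v. act v g) ` orbit x w"
  proof
    fix u assume u: "u \<in> orbit (relabel x g) (act w g)"
    have "act u (pinv g) \<in> orbit x w"
      using orbit_act[OF bij_inv(1)[OF assms(1)] act_in[OF assms(2,1)] u] assms
      by (simp add: relabel_inv act_inv)
    moreover have "u = act (act u (pinv g)) g" using assms by (simp add: act_act bij_inv act_id)
    ultimately show "u \<in> (\<lambda>v. act v g) ` orbit x w" by blast
  qed
qed

text \<open>Going around the point with coordinates \<open>x\<close> does not permute the labels.\<close>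

definition good :: "'w \<Rightarrow> real^'l \<Rightarrow> bool" where
  "good w x \<longleftrightarrow> (\<forall>g. bij g \<longrightarrow> act w g \<in> orbit x w \<longrightarrow> relabel x g = x \<longrightarrow> g = id)"

lemma good_orbit:
  assumes "good w x" "w \<in> Om" "v \<in> orbit x w"
  shows "good v x"
  unfolding good_def
proof (intro allI impI)
  fix g :: "'l \<Rightarrow> 'l" assume g: "bij g" "act v g \<in> orbit x v" "relabel x g = x"
  have "w \<in> orbit x v" using orb_sym assms by blast
  then have "act w g \<in> orbit x (act v g)"
    using orbit_act[OF g(1) orb_in[OF assms(3,2)], of w x] g(3) by simp
  then have "act w g \<in> orbit x w" using orb_trans g(2) assms(3) by metis
  then show "g = id" using assms(1) g unfolding good_def by blast
qed

text \<open>Goodness belongs to the point of \<open>M\<close> and not to its description; for a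
  change of labels this is a conjugation by \<open>h\<close>.\<close>

lemma good_act:
  assumes "good w x" "w \<in> Om" "bij h"
  shows "good (act w h) (relabel x h)"
  unfolding good_def
proof (intro allI impI)
  fix g :: "'l \<Rightarrow> 'l"
  assume g: "bij g" "act (act w h) g \<in> orbit (relabel x h) (act w h)"
    "relabel (relabel x h) g = relabel x h"
  let ?k = "h \<circ> g \<circ> pinv h"
  have b: "bij ?k" using g(1) assms(3) bij_inv(1)[OF assms(3)] by (intro bij_comp)
  have "act w ?k \<in> orbit x w"
    using orbit_act[OF bij_inv(1)[OF assms(3)] act_in[OF assms(2,3)] g(2)] assms(3)
    by (simp add: relabel_inv act_inv) (simp add: act_act)
  moreover have "relabel x ?k = x"
    using arg_cong[OF g(3), of "\<lambda>y. relabel y (pinv h)"] assms(3)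
    by (simp add: relabel_inv) (simp add: relabel_relabel)
  ultimately have "?k = id" using assms(1) b unfolding good_def by blast
  then have "pinv h \<circ> ?k \<circ> h = id" using bij_inv[OF assms(3)] by simp
  moreover have "pinv h \<circ> ?k \<circ> h = (pinv h \<circ> h) \<circ> g \<circ> (pinv h \<circ> h)" by (simp only: comp_assoc)
  ultimately show "g = id" using bij_inv[OF assms(3)] by simp
qed

text \<open>Makes the good points an open set. Near \<open>x\<close> no further coordinates vanish,
  so orbits can only get smaller, and a relabelling that fixes \<open>y\<close> has to fix
  \<open>x\<close>.\<close>

lemma good_near:
  assumes "good w x" "w \<in> Om" "isolating x e" "v \<in> orbit x w" "dist y x < e"
  shows "good v y"
  unfolding good_def
proof (intro allI impI)
  fix g :: "'l \<Rightarrow> 'l" assume g: "bij g" "act v g \<in> orbit y v" "relabel y g = y"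
  have "act v g \<in> orbit x v" using orb_mono[OF g(2) isolating_zeros[OF assms(3,5)]] .
  moreover have "relabel x g = x" using isolating_relabel[OF assms(3) g(1) assms(5)] g(3) assms(5) by simp
  ultimately show "g = id" using good_orbit[OF assms(1,2,4)] g(1) unfolding good_def by blast
qed

text \<open>A point of the covering. Taking the whole orbit gives all labelled simplices around the
  point the same frame; the coordinates, common to all of them, recover the point.\<close>

definition frame :: "'w \<Rightarrow> real^'l \<Rightarrow> 'w set \<times> (real^'l)" where
  "frame w x = (orbit x w, x)"

definition frame_act :: "'w set \<times> (real^'l) \<Rightarrow> ('l \<Rightarrow> 'l) \<Rightarrow> 'w set \<times> (real^'l)" where
  "frame_act f g = ((\<lambda>v. act v g) ` fst f, relabel (snd f) g)"

lemma frame_act_frame: "bij g \<Longrightarrow> w \<in> Om \<Longrightarrow> frame_act (frame w x) g = frame (act w g) (relabel x g)"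
  by (simp add: frame_act_def frame_def orbit_act_image)

lemma frame_eq_iff:
  assumes "w \<in> Om" "v \<in> Om"
  shows "frame w x = frame v y \<longleftrightarrow> x = y \<and> v \<in> orbit x w"
  using orb_eq[of v "zeros x" w] orb_base[of v cross "zeros x"] assms
  by (auto simp: frame_def)

text \<open>Two descriptions of one point differ by a relabelling. As both coordinate vectors are
  close to \<open>x\<close>, it fixes \<open>x\<close>; it also stays in the orbit of
  \<open>w\<close>, so goodness makes it the identity.\<close>

lemma frame_unique_near:
  assumes "good w x" "w \<in> Om" "isolating x e" "v \<in> orbit x w" "v' \<in> orbit x w"
    "y \<in> bary_simplex" "y' \<in> bary_simplex" "dist y x < e" "dist y' x < e" "Q v y = Q v' y'"
  shows "frame v y = frame v' y'"
proof -
  have v: "v \<in> Om" "v' \<in> Om" using orb_in assms by blast+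
  obtain g where g: "bij g" "act v' g \<in> orbit y v" "y = relabel y' g"
    using Q_eq[OF v assms(6,7,10)] by blast
  have "relabel x g = x"
    using isolating_relabel[OF assms(3) g(1) assms(9)] assms(8) g(3) by simp
  moreover have "act v' g \<in> orbit x v'"
    using orb_mono[OF g(2) isolating_zeros[OF assms(3,8)]] orb_eq[OF assms(4,2)]
      orb_eq[OF assms(5,2)] by simp
  ultimately have "g = id" using good_orbit[OF assms(1,2,5)] g(1) unfolding good_def by blast
  then show ?thesis using g v by (simp add: frame_eq_iff act_id)
qed

text \<open>A small star: the neighbourhood is assembled from one piece in each labelled simplex
  around the point.\<close>

definition nb :: "'w \<Rightarrow> real^'l \<Rightarrow> real \<Rightarrow> 'a set" where
  "nb w x e = {Q v y | v y. v \<in> orbit x w \<and> y \<in> bary_simplex \<and> dist y x < e}"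

text \<open>The choice is harmless at a good point: by \<open>frame_unique_near\<close> every
  admissible description of \<open>z\<close> gives the same frame.\<close>

definition sec :: "'w \<Rightarrow> real^'l \<Rightarrow> real \<Rightarrow> 'a \<Rightarrow> 'w set \<times> (real^'l)" where
  "sec w x e z = (SOME f. \<exists>v y. v \<in> orbit x w \<and> y \<in> bary_simplex \<and> dist y x < e \<and>
     z = Q v y \<and> f = frame v y)"

lemma sec_Q:
  assumes "good w x" "w \<in> Om" "isolating x e" "v \<in> orbit x w" "y \<in> bary_simplex" "dist y x < e"
  shows "sec w x e (Q v y) = frame v y"
  unfolding sec_def
proof (rule some_equality)
  show "\<exists>v' y'. v' \<in> orbit x w \<and> y' \<in> bary_simplex \<and> dist y' x < e \<and>
     Q v y = Q v' y' \<and> frame v y = frame v' y'" using assms by blast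
next
  fix f assume "\<exists>v' y'. v' \<in> orbit x w \<and> y' \<in> bary_simplex \<and> dist y' x < e \<and>
     Q v y = Q v' y' \<and> f = frame v' y'"
  then obtain v' y' where "v' \<in> orbit x w" "y' \<in> bary_simplex" "dist y' x < e"
    "Q v y = Q v' y'" "f = frame v' y'" by blast
  then show "f = frame v y" using frame_unique_near[OF assms(1-4)] assms(5,6) by metis
qed

text \<open>Seen in a labelled simplex \<open>u\<close>, the set is a union of relatively open
  balls, one for each relabelling that takes \<open>u\<close> into the orbit.\<close>

lemma nb_open:
  assumes "w \<in> Om" "isolating x e"
  shows "openin (top_of_set M) (nb w x e)"
proof (rule Q_open)
  show "nb w x e \<subseteq> M" unfolding nb_def using Q_in orb_in assms(1) by blast
  fix u assume u: "u \<in> Om"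
  let ?G = "{g. bij g \<and> act u g \<in> orbit x w}"
  have "Q u y \<in> nb w x e \<longleftrightarrow> (\<exists>g\<in>?G. dist (relabel y g) x < e)" if y: "y \<in> bary_simplex" for y
  proof
    assume "Q u y \<in> nb w x e"
    then obtain v y' where v: "v \<in> orbit x w" "y' \<in> bary_simplex" "dist y' x < e" "Q v y' = Q u y"
      unfolding nb_def by force
    then obtain g where g: "bij g" "act u g \<in> orbit y' v" "y' = relabel y g"
      using Q_eq[OF orb_in[OF v(1) assms(1)] u v(2) y v(4)] by blast
    moreover have "act u g \<in> orbit x w"
      using orb_trans[OF orb_mono[OF g(2) isolating_zeros[OF assms(2) v(3)]] v(1)] .
    ultimately show "\<exists>g\<in>?G. dist (relabel y g) x < e" using v(3) by blast
  next
    assume "\<exists>g\<in>?G. dist (relabel y g) x < e"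
    then obtain g where g: "bij g" "act u g \<in> orbit x w" "dist (relabel y g) x < e" by blast
    have "Q u y = Q (act u g) (relabel y g)" using Q_act[OF u g(1) y] by simp
    then show "Q u y \<in> nb w x e"
      unfolding nb_def using g relabel_in_bary_simplex[OF g(1) y] by blast
  qed
  then have "{y \<in> bary_simplex. Q u y \<in> nb w x e} =
      bary_simplex \<inter> (\<Union>g\<in>?G. (\<lambda>y. relabel y g) -` ball x e)"
    by (auto simp: dist_commute)
  moreover have "open ((\<lambda>y. relabel y g) -` ball x e)" for g :: "'l \<Rightarrow> 'l"
    using open_vimage[OF open_ball continuous_on_relabel] by blast
  ultimately show "openin (top_of_set bary_simplex) {y \<in> bary_simplex. Q u y \<in> nb w x e}"
    by (metis (no_types, lifting) open_UN openin_open_Int)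
qed

lemma nb_act:
  assumes "w \<in> Om" "bij g"
  shows "nb (act w g) (relabel x g) e = nb w x e"
proof -
  have sub: "nb w x e \<subseteq> nb (act w g) (relabel x g) e" if "w \<in> Om" "bij g" for w x g
  proof
    fix z assume "z \<in> nb w x e"
    then obtain v y where v: "v \<in> orbit x w" "y \<in> bary_simplex" "dist y x < e" "z = Q v y"
      unfolding nb_def by blast
    have "z = Q (act v g) (relabel y g)" using Q_act[OF orb_in[OF v(1) that(1)] that(2) v(2)] v(4) by simp
    moreover have "act v g \<in> orbit (relabel x g) (act w g)" using orbit_act[OF that(2,1) v(1)] .
    ultimately show "z \<in> nb (act w g) (relabel x g) e"
      unfolding nb_def using relabel_in_bary_simplex[OF that(2) v(2)] dist_relabel[OF that(2), of y x] v(3)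
      by (intro CollectI exI[of _ "act v g"] exI[of _ "relabel y g"]) simp
  qed
  show ?thesis
    using sub[OF assms, of x] sub[OF act_in[OF assms] bij_inv(1)[OF assms(2)], of "relabel x g"] assms
    by (simp add: act_inv relabel_inv)
qed

lemma nb_mono: "v \<in> orbit x w \<Longrightarrow> zeros y \<subseteq> zeros x \<Longrightarrow> dist y x + d \<le> e \<Longrightarrow> nb v y d \<subseteq> nb w x e"
proof
  fix z assume a: "v \<in> orbit x w" "zeros y \<subseteq> zeros x" "dist y x + d \<le> e" "z \<in> nb v y d"
  then obtain u y' where u: "u \<in> orbit y v" "y' \<in> bary_simplex" "dist y' y < d" "z = Q u y'"
    unfolding nb_def by blast
  have "u \<in> orbit x w" using orb_trans[OF orb_mono[OF u(1) a(2)] a(1)] .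
  moreover have "dist y' x < e" using u(3) a(3) dist_triangle[of y' x y] by simp
  ultimately show "z \<in> nb w x e" unfolding nb_def using u by blast
qed

section \<open>Local sections over the good points\<close>

definition good_set :: "'a set" where
  "good_set = {Q w x | w x. w \<in> Om \<and> x \<in> bary_simplex \<and> good w x}"

definition sections :: "('a set \<times> ('a \<Rightarrow> 'w set \<times> (real^'l))) set" where
  "sections = {(nb w x e, sec w x e) | w x e. w \<in> Om \<and> x \<in> bary_simplex \<and> good w x \<and> isolating x e}"

lemma sectionsI:
  "w \<in> Om \<Longrightarrow> x \<in> bary_simplex \<Longrightarrow> good w x \<Longrightarrow> isolating x e \<Longrightarrow> (nb w x e, sec w x e) \<in> sections"
  unfolding sections_def by blast

lemma sectionsE:
  assumes "(U, s) \<in> sections"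
  obtains w x e where "w \<in> Om" "x \<in> bary_simplex" "good w x" "isolating x e" "U = nb w x e" "s = sec w x e"
  using assms unfolding sections_def mem_Collect_eq prod.inject by (elim exE conjE) (rule that)

lemma nb_self: "x \<in> bary_simplex \<Longrightarrow> isolating x e \<Longrightarrow> Q w x \<in> nb w x e"
  unfolding nb_def isolating_def using orb_base[of w cross "zeros x"]
  by (intro CollectI exI[of _ w] exI[of _ x]) simp

lemma nb_good: "w \<in> Om \<Longrightarrow> good w x \<Longrightarrow> isolating x e \<Longrightarrow> nb w x e \<subseteq> good_set"
  unfolding nb_def good_set_def using good_near orb_in by blast

lemma good_set_subset: "good_set \<subseteq> M"
  unfolding good_set_def using Q_in by blast

lemma nb_open_good:
  assumes "w \<in> Om" "good w x" "isolating x e"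
  shows "openin (top_of_set good_set) (nb w x e)"
  using nb_open[OF assms(1,3)] nb_good[OF assms] good_set_subset
  by (metis openin_subset_trans)

text \<open>Recentres a section at another point of its domain, so that two sections can be compared
  over one and the same neighbourhood of a common point.\<close>

lemma sec_shrink:
  assumes s: "w \<in> Om" "good w x" "isolating x e"
    and z: "v \<in> orbit x w" "y \<in> bary_simplex" "dist y x < e"
  obtains d where "d > 0" "\<And>d'. 0 < d' \<Longrightarrow> d' \<le> d \<Longrightarrow> isolating y d'"
    "\<And>d'. 0 < d' \<Longrightarrow> d' \<le> d \<Longrightarrow> nb v y d' \<subseteq> nb w x e"
    "\<And>u y'. u \<in> orbit y v \<Longrightarrow> y' \<in> bary_simplex \<Longrightarrow> dist y' y < d \<Longrightarrow> sec w x e (Q u y') = frame u y'"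
proof -
  obtain d0 where d0: "isolating y d0" using isolating_exists by blast
  define d where "d = min d0 (e - dist y x)"
  have d: "d > 0" "d \<le> d0" "dist y x + d \<le> e" using d0 z(3) by (auto simp: d_def isolating_def)
  have zs: "zeros y \<subseteq> zeros x" using isolating_zeros[OF s(3) z(3)] .
  show ?thesis
  proof (rule that[OF d(1)])
    show "isolating y d'" if "0 < d'" "d' \<le> d" for d'
      using isolating_mono[OF d0 that(1)] that(2) d(2) by linarith
    show "nb v y d' \<subseteq> nb w x e" if "0 < d'" "d' \<le> d" for d'
      using nb_mono[OF z(1) zs] d(3) that by simp
    fix u y' assume u: "u \<in> orbit y v" "y' \<in> bary_simplex" "dist y' y < d"
    have "u \<in> orbit x w" using orb_trans[OF orb_mono[OF u(1) zs] z(1)] .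
    moreover have "dist y' x < e" using u(3) d(3) dist_triangle[of y' x y] by simp
    ultimately show "sec w x e (Q u y') = frame u y'" using sec_Q s u(2) by blast
  qed
qed

lemma nbE:
  assumes "z \<in> nb w x e"
  obtains v y where "v \<in> orbit x w" "y \<in> bary_simplex" "dist y x < e" "z = Q v y"
  using assms unfolding nb_def by blast

text \<open>Around \<open>z\<close> both sections are described over the same small neighbourhood,
  and there they differ by one fixed relabelling \<open>g\<close>. If \<open>g\<close> is the
  identity they agree throughout; otherwise goodness makes them differ at every point.\<close>

lemma sections_eq_or_differ:
  assumes s: "(U, s) \<in> sections" and r: "(V, r) \<in> sections" and z: "z \<in> U" "z \<in> V"
  obtains W where "openin (top_of_set good_set) W" "z \<in> W" "W \<subseteq> U \<inter> V"
    "if s z = r z then \<forall>z'\<in>W. s z' = r z' else \<forall>z'\<in>W. s z' \<noteq> r z'"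
proof -
  obtain w x e where 1: "w \<in> Om" "x \<in> bary_simplex" "good w x" "isolating x e" "U = nb w x e" "s = sec w x e"
    using s by (rule sectionsE)
  obtain w' x' e' where 2: "w' \<in> Om" "x' \<in> bary_simplex" "good w' x'" "isolating x' e'"
    "V = nb w' x' e'" "r = sec w' x' e'"
    using r by (rule sectionsE)
  obtain v y where v: "v \<in> orbit x w" "y \<in> bary_simplex" "dist y x < e" "z = Q v y"
    using z(1) unfolding 1 by (rule nbE)
  obtain v' y' where v': "v' \<in> orbit x' w'" "y' \<in> bary_simplex" "dist y' x' < e'" "z = Q v' y'"
    using z(2) unfolding 2 by (rule nbE)
  have vO: "v \<in> Om" "v' \<in> Om" using v v' 1 2 orb_in by blast+
  have gv: "good v y" using good_near[OF 1(3,1,4) v(1,3)] .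
  obtain g where g: "bij g" "act v' g \<in> orbit y v" "y = relabel y' g"
    using Q_eq[OF vO v(2) v'(2)] v(4) v'(4) by metis
  have g': "bij (pinv g)" "relabel y (pinv g) = y'" "act (act v' g) (pinv g) = v'"
    using g by (auto simp: bij_inv relabel_inv act_inv)
  obtain d where d: "d > 0" "\<And>d'. 0 < d' \<Longrightarrow> d' \<le> d \<Longrightarrow> isolating y d'"
    "\<And>d'. 0 < d' \<Longrightarrow> d' \<le> d \<Longrightarrow> nb v y d' \<subseteq> nb w x e"
    "\<And>u y'. u \<in> orbit y v \<Longrightarrow> y' \<in> bary_simplex \<Longrightarrow> dist y' y < d \<Longrightarrow> sec w x e (Q u y') = frame u y'"
    using sec_shrink[OF 1(1,3,4) v(1-3)] by blast
  obtain d' where d': "d' > 0" "\<And>d''. 0 < d'' \<Longrightarrow> d'' \<le> d' \<Longrightarrow> isolating y' d''"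
    "\<And>d''. 0 < d'' \<Longrightarrow> d'' \<le> d' \<Longrightarrow> nb v' y' d'' \<subseteq> nb w' x' e'"
    "\<And>u y''. u \<in> orbit y' v' \<Longrightarrow> y'' \<in> bary_simplex \<Longrightarrow> dist y'' y' < d' \<Longrightarrow> sec w' x' e' (Q u y'') = frame u y''"
    using sec_shrink[OF 2(1,3,4) v'(1-3)] by blast
  define k where "k = min d d'"
  have k: "k > 0" "k \<le> d" "k \<le> d'" using d(1) d'(1) by (auto simp: k_def)
  have iso: "isolating y k" using d(2) k by blast
  have orbv: "orbit y (act v' g) = orbit y v" using orb_eq[OF g(2) vO(1)] .
  have nbeq: "nb v y k = nb v' y' k"
  proof -
    have "nb v y k = nb (act v' g) y k" unfolding nb_def orbv ..
    also have "\<dots> = nb v' y' k" using nb_act[OF vO(2) g(1), of y' k] g(3) by simp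
    finally show ?thesis .
  qed
  have zv: "s z = frame v y" "r z = frame v' y'"
    using sec_Q[OF 1(3,1,4) v(1-3)] sec_Q[OF 2(3,1,4) v'(1-3)] 1 2 v v' by simp_all
  have both: "s (Q u y1) = frame u y1 \<and> r (Q u y1) = frame (act u (pinv g)) (relabel y1 (pinv g))"
    if u: "u \<in> orbit y v" "y1 \<in> bary_simplex" "dist y1 y < k" for u y1
  proof -
    have uO: "u \<in> Om" using orb_in u(1) vO(1) by blast
    have "act u (pinv g) \<in> orbit y' v'"
      using orbit_act[OF g'(1) act_in[OF vO(2) g(1)], of u y] u(1) orbv g' by simp
    moreover have "relabel y1 (pinv g) \<in> bary_simplex" using relabel_in_bary_simplex g' u by blast
    moreover have "dist (relabel y1 (pinv g)) y' < d'"
      using dist_relabel[OF g'(1), of y1 y] g'(2) u(3) k by simp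
    ultimately have "r (Q (act u (pinv g)) (relabel y1 (pinv g))) = frame (act u (pinv g)) (relabel y1 (pinv g))"
      using d'(4) 2 by blast
    moreover have "Q (act u (pinv g)) (relabel y1 (pinv g)) = Q u y1" using Q_act[OF uO g'(1) u(2)] .
    moreover have "s (Q u y1) = frame u y1" using d(4)[OF u(1,2)] u(3) k 1 by simp
    ultimately show ?thesis by simp
  qed
  have eqid: "g = id" if "frame u y1 = frame (act u (pinv g)) (relabel y1 (pinv g))"
    "u \<in> orbit y v" "dist y1 y < k" for u y1
  proof -
    have uO: "u \<in> Om" using orb_in that(2) vO(1) by blast
    have gu: "good u y1" using good_near[OF gv vO(1) iso that(2,3)] .
    have "y1 = relabel y1 (pinv g)" "act u (pinv g) \<in> orbit y1 u"
      using that(1) frame_eq_iff[OF uO act_in[OF uO g'(1)]] by auto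
    then have "pinv g = id" using gu g'(1) unfolding good_def by metis
    then show ?thesis using bij_inv(2)[OF g(1)] by simp
  qed
  have "if s z = r z then \<forall>z'\<in>nb v y k. s z' = r z' else \<forall>z'\<in>nb v y k. s z' \<noteq> r z'"
  proof (cases "g = id")
    case True
    then have "s (Q u y1) = r (Q u y1)" if "u \<in> orbit y v" "y1 \<in> bary_simplex" "dist y1 y < k" for u y1
      using both[OF that] by (simp add: act_id)
    then have "\<forall>z'\<in>nb v y k. s z' = r z'" unfolding nb_def by blast
    moreover have "z \<in> nb v y k" using nb_self[OF v(2) iso] v(4) by simp
    ultimately show ?thesis by auto
  next
    case False
    then have "s (Q u y1) \<noteq> r (Q u y1)" if "u \<in> orbit y v" "y1 \<in> bary_simplex" "dist y1 y < k" for u y1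
      using both[OF that] eqid[OF _ that(1,3)] by auto
    then have "\<forall>z'\<in>nb v y k. s z' \<noteq> r z'" unfolding nb_def by blast
    moreover have "z \<in> nb v y k" using nb_self[OF v(2) iso] v(4) by simp
    ultimately show ?thesis by auto
  qed
  moreover have "nb v y k \<subseteq> U \<inter> V" using d(3)[OF k(1,2)] d'(3)[OF k(1,3)] nbeq 1 2 by simp
  moreover have "z \<in> nb v y k" using nb_self[OF v(2) iso] v(4) by simp
  ultimately show ?thesis using that nb_open_good[OF vO(1) gv iso] by blast
qed

lemma section_act:
  assumes s: "(U, s) \<in> sections" and g: "bij g"
  obtains r where "(U, r) \<in> sections" "\<And>z. z \<in> U \<Longrightarrow> r z = frame_act (s z) g"
proof -
  obtain w x e where 1: "w \<in> Om" "x \<in> bary_simplex" "good w x" "isolating x e" "U = nb w x e" "s = sec w x e"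
    using s by (rule sectionsE)
  have 2: "act w g \<in> Om" "relabel x g \<in> bary_simplex" "good (act w g) (relabel x g)"
    "isolating (relabel x g) e"
    using 1 g act_in relabel_in_bary_simplex good_act isolating_relabelled by blast+
  have "sec (act w g) (relabel x g) e z = frame_act (sec w x e z) g" if z: "z \<in> U" for z
  proof -
    obtain v y where v: "v \<in> orbit x w" "y \<in> bary_simplex" "dist y x < e" "z = Q v y"
      using z unfolding 1 by (rule nbE)
    have vO: "v \<in> Om" using v 1 orb_in by blast
    have "Q v y = Q (act v g) (relabel y g)" using Q_act[OF vO g v(2)] by simp
    moreover have "sec (act w g) (relabel x g) e (Q (act v g) (relabel y g)) = frame (act v g) (relabel y g)"
      using v(2,3) orbit_act[OF g 1(1) v(1)] relabel_in_bary_simplex[OF g] dist_relabel[OF g, of y x]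
      by (intro sec_Q 2) simp_all
    ultimately show ?thesis
      using sec_Q[OF 1(3,1,4) v(1-3)] v(4) frame_act_frame[OF g vO] by simp
  qed
  moreover have "(U, sec (act w g) (relabel x g) e) \<in> sections"
    using sectionsI[OF 2] nb_act[OF 1(1) g] 1(5) by simp
  ultimately show ?thesis using that 1 by blast
qed

lemma section_value:
  assumes "(U, s) \<in> sections" "z \<in> U"
  obtains w x where "w \<in> Om" "x \<in> bary_simplex" "good w x" "z = Q w x" "s z = frame w x"
proof -
  obtain w x e where 1: "w \<in> Om" "x \<in> bary_simplex" "good w x" "isolating x e" "U = nb w x e" "s = sec w x e"
    using assms(1) by (rule sectionsE)
  obtain v y where v: "v \<in> orbit x w" "y \<in> bary_simplex" "dist y x < e" "z = Q v y"
    using assms(2) unfolding 1 by (rule nbE)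
  have "good v y" using good_near[OF 1(3,1,4) v(1,3)] .
  then show ?thesis using that[of v y] orb_in[OF v(1) 1(1)] v 1 sec_Q[OF 1(3,1,4) v(1-3)] by simp
qed

sublocale flat_bundle good_set sections
proof
  show "openin (top_of_set good_set) U" if "(U, s) \<in> sections" for U s
    using that by (elim sectionsE) (simp add: nb_open_good)
  show "\<exists>W. openin (top_of_set good_set) W \<and> y \<in> W \<and> W \<subseteq> U \<inter> V \<and> (\<forall>z\<in>W. s z = r z)"
    if "(U, s) \<in> sections" "(V, r) \<in> sections" "y \<in> U" "y \<in> V" "s y = r y" for U s V r y
    using sections_eq_or_differ[OF that(1-4)] that(5) by metis
  show "\<exists>W. openin (top_of_set good_set) W \<and> y \<in> W \<and> W \<subseteq> U \<inter> V \<and> (\<forall>z\<in>W. s z \<noteq> r z)"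
    if "(U, s) \<in> sections" "(V, r) \<in> sections" "y \<in> U" "y \<in> V" "s y \<noteq> r y" for U s V r y
    using sections_eq_or_differ[OF that(1-4)] that(5) by metis
  fix y assume "y \<in> good_set"
  then obtain w x where w: "w \<in> Om" "x \<in> bary_simplex" "good w x" "y = Q w x"
    unfolding good_set_def by blast
  obtain e where e: "isolating x e" using isolating_exists by blast
  let ?U = "nb w x e"
  \<comment> \<open>Two frames over the same point differ by a relabelling, so the relabelled copies
    of one section over \<open>?U\<close> reach every value.\<close>
  have "\<exists>s. (?U, s) \<in> sections \<and> s z = r z" if z: "z \<in> ?U" "(V, r) \<in> sections" "z \<in> V" for z V r
  proof -
    obtain v x' where v: "v \<in> Om" "x' \<in> bary_simplex" "z = Q v x'" "r z = frame v x'"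
      using section_value[OF z(2,3)] by metis
    obtain u x'' where u: "u \<in> Om" "x'' \<in> bary_simplex" "z = Q u x''" "sec w x e z = frame u x''"
      using section_value[OF sectionsI[OF w(1-3) e] z(1)] by metis
    obtain g where g: "bij g" "act u g \<in> orbit x' v" "x' = relabel x'' g"
      using Q_eq[OF v(1) u(1) v(2) u(2)] u(3) v(3) by metis
    obtain s where s: "(?U, s) \<in> sections" "\<And>z. z \<in> ?U \<Longrightarrow> s z = frame_act (sec w x e z) g"
      using section_act[OF sectionsI[OF w(1-3) e] g(1)] by metis
    have "s z = frame (act u g) x'" using s(2)[OF z(1)] u g frame_act_frame by simp
    also have "\<dots> = r z" using v(4) frame_eq_iff[OF v(1) act_in[OF u(1) g(1)], of x' x'] g(2) by simp
    finally show ?thesis using s(1) by blast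
  qed
  moreover have "openin (top_of_set good_set) ?U" "y \<in> ?U"
    using nb_open_good[OF w(1,3) e] nb_self[OF w(2) e] w(4) by auto
  ultimately show "\<exists>U. openin (top_of_set good_set) U \<and> y \<in> U \<and>
      (\<forall>z V r. z \<in> U \<longrightarrow> (V, r) \<in> sections \<longrightarrow> z \<in> V \<longrightarrow> (\<exists>s. (U, s) \<in> sections \<and> s z = r z))"
    by (intro exI[of _ ?U]) simp
qed

text \<open>Relabelling takes sections to sections over the same set, hence lifts to lifts. This is
  what relates transport along a product of loops to composition of permutations.\<close>

lemma lifts_to_act:
  assumes "lifts_to p f f'" "bij g"
  shows "lifts_to p (frame_act f g) (frame_act f' g)"
proof -
  obtain l where l: "flat_on {0..1} p l" "l 0 = f" "l 1 = f'" using assms(1) unfolding lifts_to_def by blast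
  have "flat_on {0..1} p (\<lambda>t. frame_act (l t) g)"
    unfolding flat_on_def
  proof
    fix k :: real assume k: "k \<in> {0..1}"
    obtain U s N where N: "(U, s) \<in> sections" "openin (top_of_set {0..1}) N" "k \<in> N" "p ` N \<subseteq> U"
      "\<forall>j\<in>N. l j = s (p j)" by (rule flat_onE[OF l(1) k])
    obtain r where r: "(U, r) \<in> sections" "\<And>z. z \<in> U \<Longrightarrow> r z = frame_act (s z) g"
      using section_act[OF N(1) assms(2)] by metis
    have "\<forall>j\<in>N. frame_act (l j) g = r (p j)" using N(4,5) r(2) by auto
    then show "\<exists>U s N. (U, s) \<in> sections \<and> openin (top_of_set {0..1}) N \<and> k \<in> N \<and>
        p ` N \<subseteq> U \<and> (\<forall>j\<in>N. frame_act (l j) g = s (p j))"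
      using r(1) N(2-4) by blast
  qed
  then show ?thesis using l unfolding lifts_to_def by blast
qed

text \<open>Inside one simplex the labels do not change. The orbit in the frame may grow where the
  segment meets a face, but there too \<open>frame w\<close> is the value of a section, by
  \<open>sec_Q\<close>.\<close>

lemma lifts_to_segment:
  assumes w: "w \<in> Om" and x: "x \<in> bary_simplex" "y \<in> bary_simplex"
    and good: "\<And>z. z \<in> closed_segment x y \<Longrightarrow> good w z"
  shows "lifts_to (Q w \<circ> linepath x y) (frame w x) (frame w y)"
    and "path (Q w \<circ> linepath x y)"
proof -
  have "closed_segment x y \<subseteq> bary_simplex" using closed_segment_subset[OF x convex_bary_simplex] .
  then have im: "linepath x y ` {0..1} \<subseteq> bary_simplex" by (simp add: linepath_image_01)
  have cont: "continuous_on {0..1} (linepath x y)" by (rule continuous_on_linepath)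
  show "path (Q w \<circ> linepath x y)"
    unfolding path_def using continuous_on_compose[OF cont continuous_on_subset[OF Q_cont[OF w] im]] .
  have "flat_on {0..1} (Q w \<circ> linepath x y) (\<lambda>t. frame w (linepath x y t))"
    unfolding flat_on_def
  proof
    fix k :: real assume k: "k \<in> {0..1}"
    let ?x = "linepath x y k"
    have g: "good w ?x" using good k linepath_image_01[of x y] by blast
    obtain e where e: "isolating ?x e" using isolating_exists by blast
    let ?N = "{0..1} \<inter> linepath x y -` ball ?x e"
    have b: "linepath x y j \<in> bary_simplex" if "j \<in> {0..1}" for j using im that by blast
    have "openin (top_of_set {0..1}) ?N"
      using continuous_openin_preimage_gen[OF cont open_ball] .
    moreover have "k \<in> ?N" using k e by (simp add: isolating_def)
    moreover have "(Q w \<circ> linepath x y) ` ?N \<subseteq> nb w ?x e"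
      using b unfolding nb_def by (force simp: dist_commute intro: orb_base)
    moreover have "\<forall>j\<in>?N. frame w (linepath x y j) = sec w ?x e ((Q w \<circ> linepath x y) j)"
      using sec_Q[OF g w e orb_base] b by (simp add: dist_commute)
    moreover have "(nb w ?x e, sec w ?x e) \<in> sections"
      using sectionsI[OF w b[OF k] g e] .
    ultimately show "\<exists>U s N. (U, s) \<in> sections \<and> openin (top_of_set {0..1}) N \<and> k \<in> N \<and>
        (Q w \<circ> linepath x y) ` N \<subseteq> U \<and> (\<forall>j\<in>N. frame w (linepath x y j) = s ((Q w \<circ> linepath x y) j))"
      by blast
  qed
  then show "lifts_to (Q w \<circ> linepath x y) (frame w x) (frame w y)"
    unfolding lifts_to_def by (force simp: linepath_0' linepath_1')
qed

lemma good_set_section: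
  assumes "w \<in> Om" "x \<in> bary_simplex" "good w x"
  obtains U s where "(U, s) \<in> sections" "Q w x \<in> U" "s (Q w x) = frame w x"
proof -
  obtain e where e: "isolating x e" using isolating_exists by blast
  show ?thesis
    using that[OF sectionsI[OF assms e] nb_self[OF assms(2) e]] sec_Q[OF assms(3,1) e orb_base assms(2)] e
    by (simp add: isolating_def)
qed

end

section \<open>Vertices of manifolds and monodromy\<close>

text \<open>The neighbourhood is a coordinate ball too small to contain other points of
  \<open>V\<close>. A loop in its punctured version is moved to \<open>real^3\<close> by the chart,
  contracted in a punctured ball there, and the contraction is mapped back.\<close>

lemma closed_3_manifold_punctured_nbhd:
  fixes M :: "'a::topological_space set"
  assumes M: "closed_3_manifold M" and v: "v \<in> M" and V: "finite V"
  obtains B where "openin (top_of_set M) B" "v \<in> B" "B \<inter> V \<subseteq> {v}"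
    "\<And>p. path p \<Longrightarrow> path_image p \<subseteq> B - {v} \<Longrightarrow> pathfinish p = pathstart p \<Longrightarrow>
       homotopic_paths (B - {v}) p (\<lambda>_. pathstart p)"
proof -
  obtain U where U: "openin (top_of_set M) U" "v \<in> U" "U homeomorphic (UNIV :: (real^3) set)"
    using M v unfolding closed_3_manifold_def by blast
  then obtain f :: "'a \<Rightarrow> real^3" and g where fg: "homeomorphism U UNIV f g"
    unfolding homeomorphic_def by blast
  define U' where "U' = U - ((V \<inter> M) - {v})"
  have "t1_space (top_of_set M)"
    using M Hausdorff_imp_t1_space unfolding closed_3_manifold_def by blast
  then have "\<And>S. finite S \<Longrightarrow> S \<subseteq> M \<Longrightarrow> closedin (top_of_set M) S"
    unfolding t1_space_closedin_finite topspace_euclidean_subtopology by blast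
  moreover have "finite ((V \<inter> M) - {v})" "(V \<inter> M) - {v} \<subseteq> M" using V by auto
  ultimately have "closedin (top_of_set M) ((V \<inter> M) - {v})" by blast
  then have "openin (top_of_set M) U'" unfolding U'_def using U(1) by (rule openin_diff[rotated])
  moreover have "U' \<subseteq> U" "U \<subseteq> M" unfolding U'_def using openin_imp_subset[OF U(1)] by auto
  ultimately have oU': "openin (top_of_set U) U'" by (rule openin_subset_trans)
  have "open (f ` U')" using homeomorphism_imp_open_map[OF fg oU'] by simp
  moreover have "f v \<in> f ` U'" using U(2) by (auto simp: U'_def)
  ultimately obtain r where r: "r > 0" "ball (f v) r \<subseteq> f ` U'" using open_contains_ball by blast
  define B where "B = g ` ball (f v) r"
  have gf: "\<And>x. x \<in> U \<Longrightarrow> g (f x) = x" and fgx: "\<And>y. f (g y) = y"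
    using fg unfolding homeomorphism_def by auto
  have fc: "continuous_on U f" and gc: "continuous_on UNIV g"
    using fg unfolding homeomorphism_def by auto
  have "openin (top_of_set U) B"
    unfolding B_def by (rule homeomorphism_imp_open_map[OF homeomorphism_symD[OF fg]]) simp
  then have oB: "openin (top_of_set M) B" using U(1) openin_trans by blast
  have vB: "v \<in> B" unfolding B_def using gf[OF U(2)] r(1) by (metis centre_in_ball imageI)
  have BU': "B \<subseteq> U'" unfolding B_def using r(2) gf by (force simp: U'_def)
  have BV: "B \<inter> V \<subseteq> {v}"
    using BU' U(1) openin_imp_subset[OF U(1)] unfolding U'_def by blast
  let ?P = "ball (f v) r - {f v}"
  \<comment> \<open>This is where the dimension enters: a ball without its centre is simply
    connected in dimension at least 3.\<close>
  have sc: "simply_connected ?P"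
    by (rule simply_connected_punctured_convex) (use r(1) in \<open>simp_all add: aff_dim_open\<close>)
  have "homotopic_paths (B - {v}) p (\<lambda>_. pathstart p)"
    if p: "path p" "path_image p \<subseteq> B - {v}" "pathfinish p = pathstart p" for p
  proof -
    have pU: "path_image p \<subseteq> U" using p(2) BU' by (auto simp: U'_def)
    have fB: "f x \<in> ?P" if "x \<in> B - {v}" for x
    proof -
      obtain y where "y \<in> ball (f v) r" "x = g y" using \<open>x \<in> B - {v}\<close> by (auto simp: B_def)
      then show ?thesis using that fgx gf[OF U(2)] by (metis Diff_iff singletonD singletonI)
    qed
    have "path (f \<circ> p)" using path_continuous_image[OF p(1)] continuous_on_subset[OF fc pU] by blast
    moreover have "path_image (f \<circ> p) \<subseteq> ?P"
      unfolding path_image_compose by (intro image_subsetI fB subsetD[OF p(2)])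
    moreover have "pathfinish (f \<circ> p) = pathstart (f \<circ> p)"
      using p(3) by (simp add: pathstart_compose pathfinish_compose)
    ultimately have h: "homotopic_paths ?P (f \<circ> p) (linepath (pathstart (f \<circ> p)) (pathstart (f \<circ> p)))"
      using sc unfolding simply_connected_eq_contractible_path by blast
    have gP: "g \<in> ?P \<rightarrow> B - {v}"
    proof
      fix y assume y: "y \<in> ?P"
      then have "g y \<in> B" by (auto simp: B_def)
      moreover have "g y \<noteq> v" using y fgx by force
      ultimately show "g y \<in> B - {v}" by blast
    qed
    have "homotopic_paths (B - {v}) (g \<circ> (f \<circ> p)) (g \<circ> linepath (pathstart (f \<circ> p)) (pathstart (f \<circ> p)))"
      using homotopic_paths_continuous_image[OF h _ gP] continuous_on_subset[OF gc] by blast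
    moreover have "homotopic_paths (B - {v}) p (g \<circ> (f \<circ> p))"
    proof (rule homotopic_paths_eq[OF p(1,2)])
      fix t :: real assume "t \<in> {0..1}"
      then have "p t \<in> U" using pU by (auto simp: path_image_def)
      then show "p t = (g \<circ> (f \<circ> p)) t" using gf by simp
    qed
    moreover have "g \<circ> linepath (pathstart (f \<circ> p)) (pathstart (f \<circ> p)) = (\<lambda>_. pathstart p)"
      using gf pU pathstart_in_path_image[of p] by (auto simp: pathstart_compose linepath_def algebra_simps)
    ultimately show ?thesis using homotopic_paths_trans by metis
  qed
  then show ?thesis using that oB vB BV by blast
qed

lemma axis_in_bary_simplex: "axis i 1 \<in> (bary_simplex :: (real^'l::finite) set)"
  by (simp add: bary_simplex_def axis_def)

lemma norm_bary_simplex: "x \<in> (bary_simplex :: (real^'l::finite) set) \<Longrightarrow> norm x \<le> 1"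
  using norm_le_l1_cart[of x] by (simp add: bary_simplex_def)

lemma relabel_axis: "bij g \<Longrightarrow> relabel (axis i (1::real)) g = axis (pinv g i) 1"
  by (auto simp: vec_eq_iff axis_def bij_is_surj surj_f_inv_f bij_is_inj inv_f_f)

context labelled_complex
begin

lemma Q_orbit:
  assumes "v \<in> orbit x w" "w \<in> Om" "x \<in> bary_simplex"
  shows "Q v x = Q w x"
  using assms(1)
proof (induction rule: orb.induct)
  case (orb_step v i)
  then show ?case using Q_cross[OF orb_in[OF orb_step.hyps(1) assms(2)] assms(3), of i]
    by (simp add: zeros_def)
qed simp

text \<open>The link of a vertex in a manifold need not be analysed: a chain of simplices around the vertex
  is a loop in a punctured ball, hence null-homotopic there.\<close>

lemma vertex_good:
  assumes M: "closed_3_manifold M" and card: "3 \<le> CARD('l)"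
    and nonvertex: "\<And>w x. w \<in> Om \<Longrightarrow> x \<in> bary_simplex \<Longrightarrow> \<forall>k. x \<noteq> axis k 1 \<Longrightarrow> good w x"
    and w: "w \<in> Om"
  shows "good w (axis i 1)"
proof -
  define e where "e = (axis i 1 :: real^'l)"
  define v where "v = Q w e"
  define V where "V = (\<lambda>(u, k). Q u (axis k 1)) ` (Om \<times> (UNIV :: 'l set))"
  have eS: "e \<in> bary_simplex" unfolding e_def by (rule axis_in_bary_simplex)
  have "finite V" unfolding V_def using finite_Om by simp
  then obtain B where B: "openin (top_of_set M) B" "v \<in> B" "B \<inter> V \<subseteq> {v}"
    "\<And>p. path p \<Longrightarrow> path_image p \<subseteq> B - {v} \<Longrightarrow> pathfinish p = pathstart p \<Longrightarrow>
       homotopic_paths (B - {v}) p (\<lambda>_. pathstart p)"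
    using closed_3_manifold_punctured_nbhd[OF M] Q_in[OF w eS] unfolding v_def by metis
  \<comment> \<open>A relabelled corner is a corner again, so a point that is no corner in one
    description is a corner in none.\<close>
  have nonV: "Q u y \<notin> V" if u: "u \<in> Om" "y \<in> bary_simplex" "\<forall>k. y \<noteq> axis k 1" for u y
  proof
    assume "Q u y \<in> V"
    then obtain u' k where "u' \<in> Om" "Q u y = Q u' (axis k 1)" unfolding V_def by auto
    then obtain g where "bij g" "y = relabel (axis k 1) g"
      using Q_eq[OF u(1) _ u(2) axis_in_bary_simplex] by metis
    then show False using u(3) relabel_axis by metis
  qed
  have BX: "B - {v} \<subseteq> good_set"
  proof
    fix z assume z: "z \<in> B - {v}"
    then have "z \<in> M" using openin_imp_subset[OF B(1)] by blast
    then obtain u y where u: "u \<in> Om" "y \<in> bary_simplex" "z = Q u y" using Q_surj by blast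
    have "y \<noteq> axis k 1" for k using z B(3) u unfolding V_def by force
    then show "z \<in> good_set" unfolding good_set_def using u nonvertex by blast
  qed
  have orbOm: "u \<in> Om" if "u \<in> orbit e w" for u using orb_in[OF that w] .
  have vQ: "Q u e = v" if "u \<in> orbit e w" for u using Q_orbit[OF that w eS] by (simp add: v_def)
  have "\<exists>d>0. \<forall>y\<in>bary_simplex. dist y e < d \<longrightarrow> Q u y \<in> B" if u: "u \<in> orbit e w" for u
  proof -
    have "openin (top_of_set bary_simplex) (bary_simplex \<inter> Q u -` B)"
      using continuous_openin_preimage[OF Q_cont[OF orbOm[OF u]] _ B(1)] Q_in[OF orbOm[OF u]] by blast
    moreover have "e \<in> bary_simplex \<inter> Q u -` B" using eS vQ[OF u] B(2) by simp
    ultimately obtain d where "d > 0" "ball e d \<inter> bary_simplex \<subseteq> bary_simplex \<inter> Q u -` B"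
      unfolding openin_contains_ball by blast
    then have "Q u y \<in> B" if "y \<in> bary_simplex" "dist y e < d" for y
      using that by (auto simp: dist_commute)
    then show ?thesis using \<open>d > 0\<close> by blast
  qed
  then obtain D where D: "\<And>u. u \<in> orbit e w \<Longrightarrow> D u > 0"
    "\<And>u y. u \<in> orbit e w \<Longrightarrow> y \<in> bary_simplex \<Longrightarrow> dist y e < D u \<Longrightarrow> Q u y \<in> B" by metis
  have fin: "finite (orbit e w)" using finite_subset[OF _ finite_Om] orbOm by blast
  \<comment> \<open>One radius for all simplices around the vertex; the element 1 gives
    \<open>d \<le> 1\<close>, which the convex combinations below need.\<close>
  define d where "d = Min (insert 1 (D ` orbit e w))"
  have d0: "d > 0" "d \<le> 1" unfolding d_def using fin D(1) by auto
  have dD: "d \<le> D u" if "u \<in> orbit e w" for u unfolding d_def using fin that by auto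
  define P where "P = {y \<in> bary_simplex. dist y e < d \<and> (\<forall>k. y \<noteq> axis k 1)}"
  have P: "good u y" "Q u y \<in> B - {v}" if "u \<in> orbit e w" "y \<in> P" for u y
  proof -
    show "good u y" using nonvertex orbOm that unfolding P_def by blast
    have "Q u y \<in> B" using D(2)[OF that(1), of y] dD[OF that(1)] that(2) by (simp add: P_def)
    moreover have "v \<in> V" unfolding v_def V_def e_def using w by auto
    moreover have "Q u y \<notin> V" using nonV orbOm that unfolding P_def by blast
    ultimately show "Q u y \<in> B - {v}" by blast
  qed
  \<comment> \<open>Shrinks the simplex towards the corner \<open>e\<close>. Its points are at
    distance at most 2 from \<open>e\<close>, so the factor \<open>d / 4\<close> brings them within
    \<open>d\<close>.\<close>
  define c where "c = (\<lambda>y. (1 - d / 4) *\<^sub>R e + (d / 4) *\<^sub>R (y :: real^'l))"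
  have cP: "c y \<in> P" if y: "y \<in> bary_simplex" "k \<noteq> i" "y $ k \<noteq> 0" for y k
  proof -
    have "c y \<in> bary_simplex"
      unfolding c_def using convexD[OF convex_bary_simplex eS y(1)] d0 by simp
    moreover have "dist (c y) e < d"
    proof -
      have "c y - e = (d / 4) *\<^sub>R (y - e)" by (simp add: c_def algebra_simps)
      then have "dist (c y) e = d / 4 * norm (y - e)" using d0 by (simp add: dist_norm)
      also have "\<dots> \<le> d / 4 * 2"
        using norm_triangle_ineq4[of y e] norm_bary_simplex[OF y(1)] norm_bary_simplex[OF eS] d0
        by (intro mult_left_mono) auto
      finally show ?thesis using d0 by simp
    qed
    moreover have "c y \<noteq> axis j 1" for j
    proof
      assume a: "c y = axis j 1"
      have "c y $ k \<noteq> 0" using y d0 by (simp add: c_def e_def axis_def)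
      then have "j = k" using a by (auto simp: axis_def split: if_splits)
      moreover have "c y $ i > 0" using d0 y(1)
        by (simp add: c_def e_def axis_def bary_simplex_def add_pos_nonneg)
      then have "j = i" using a by (auto simp: axis_def split: if_splits)
      ultimately show False using y(2) by simp
    qed
    ultimately show ?thesis unfolding P_def by blast
  qed
  \<comment> \<open>\<open>b\<close> is the barycentre of the simplex and \<open>m j\<close> that of
    the face opposite to \<open>j\<close>. A crossing of that face is realised by the segments
    between \<open>c b\<close> and \<open>c (m j)\<close>.\<close>
  define b where "b = (\<chi> k. 1 / real CARD('l) :: real^'l)"
  define m where "m = (\<lambda>j. (\<chi> k. if k = j then 0 else 1 / (real CARD('l) - 1)) :: real^'l)"
  have bS: "b \<in> bary_simplex" unfolding b_def bary_simplex_def using card by simp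
  have mS: "m j \<in> bary_simplex" for j
  proof -
    have "(\<Sum>k\<in>UNIV. if k = j then 0 else 1 / (real CARD('l) - 1)) =
        (\<Sum>k\<in>UNIV - {j}. 1 / (real CARD('l) - 1))"
      by (rule sum.mono_neutral_cong_right) auto
    also have "\<dots> = 1" using card by (simp add: of_nat_diff)
    finally show ?thesis using card by (simp add: m_def bary_simplex_def)
  qed
  have seg: "closed_segment (c b) (c (m j)) \<subseteq> P" for j
  proof
    fix z assume "z \<in> closed_segment (c b) (c (m j))"
    then obtain t where t: "0 \<le> t" "t \<le> 1" "z = (1 - t) *\<^sub>R c b + t *\<^sub>R c (m j)"
      unfolding in_segment by blast
    let ?y = "(1 - t) *\<^sub>R b + t *\<^sub>R m j"
    have "z = c ?y" unfolding t c_def vec_eq_iff by (simp add: field_simps)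
    moreover have "?y \<in> bary_simplex" using convexD[OF convex_bary_simplex bS mS] t by simp
    \<comment> \<open>With at least three labels, some coordinate other than those of
      \<open>i\<close> and \<open>j\<close> stays positive along the segment, which keeps the
      segment off the corners.\<close>
    moreover have "\<exists>k. k \<noteq> i \<and> k \<noteq> j"
    proof (rule ccontr)
      assume "\<nexists>k. k \<noteq> i \<and> k \<noteq> j"
      then have "(UNIV :: 'l set) \<subseteq> {i, j}" by blast
      then have "CARD('l) \<le> card {i, j}" by (intro card_mono) auto
      also have "\<dots> \<le> 2" by (simp add: card_insert_if)
      finally show False using card by simp
    qed
    then obtain k where k: "k \<noteq> i" "k \<noteq> j" by blast
    have "?y $ k > 0"
    proof (cases "t = 1")
      case True then show ?thesis using k card by (simp add: m_def)
    next
      case False then show ?thesis using k card t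
        by (simp add: m_def b_def add_pos_nonneg)
    qed
    ultimately show "z \<in> P" using cP k(1) by force
  qed
  have walk: "lifts_to (Q u \<circ> linepath x y) (frame u x) (frame u y)"
    "path (Q u \<circ> linepath x y)" "path_image (Q u \<circ> linepath x y) \<subseteq> B - {v}"
    if u: "u \<in> orbit e w" and s: "closed_segment x y \<subseteq> P" for u x y
  proof -
    have xy: "x \<in> bary_simplex" "y \<in> bary_simplex" using s unfolding P_def by auto
    have g: "\<And>z. z \<in> closed_segment x y \<Longrightarrow> good u z" using P(1)[OF u] s by blast
    show "lifts_to (Q u \<circ> linepath x y) (frame u x) (frame u y)" "path (Q u \<circ> linepath x y)"
      using lifts_to_segment[OF orbOm[OF u] xy g] by blast+
    show "path_image (Q u \<circ> linepath x y) \<subseteq> B - {v}"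
      using P(2)[OF u] s by (auto simp: path_image_compose)
  qed
  have cb: "c b \<in> P" using seg by blast
  have chain: "\<exists>p. path p \<and> path_image p \<subseteq> B - {v} \<and> pathstart p = Q w (c b) \<and>
      pathfinish p = Q u (c b) \<and> lifts_to p (frame w (c b)) (frame u (c b))"
    if "u \<in> orbit e w" for u
    using that
  proof (induction rule: orb.induct)
    case orb_base
    have s: "closed_segment (c b) (c b) \<subseteq> P" using cb by simp
    show ?case
      using walk[OF orb.orb_base s] by (intro exI[of _ "Q w \<circ> linepath (c b) (c b)"])
        (simp only: pathstart_compose pathfinish_compose pathstart_linepath pathfinish_linepath simp_thms)
  next
    case (orb_step u j)
    then obtain p where p: "path p" "path_image p \<subseteq> B - {v}" "pathstart p = Q w (c b)"
      "pathfinish p = Q u (c b)" "lifts_to p (frame w (c b)) (frame u (c b))" by blast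
    have uO: "u \<in> Om" using orbOm orb_step by blast
    have cu: "cross j u \<in> orbit e w" using orb.orb_step orb_step by fast
    have j: "j \<noteq> i" using orb_step(2) by (auto simp: e_def zeros_def)
    have zero: "c (m j) $ j = 0" using j by (simp add: c_def m_def e_def axis_def)
    have mP: "c (m j) \<in> bary_simplex" using seg[of j] by (auto simp: P_def)
    have "cross j u \<in> orbit (c (m j)) u"
      by (rule orb.orb_step[OF orb.orb_base]) (simp add: zeros_def zero)
    \<comment> \<open>On the common face both simplices have the same frame, so the lift passes from
      one to the other.\<close>
    then have fr: "frame u (c (m j)) = frame (cross j u) (c (m j))"
      using frame_eq_iff[OF uO cross_in[OF uO]] by blast
    have ends: "Q (cross j u) (c (m j)) = Q u (c (m j))" using Q_cross[OF uO mP zero] .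
    let ?q = "Q u \<circ> linepath (c b) (c (m j))" and ?r = "Q (cross j u) \<circ> linepath (c (m j)) (c b)"
    note q = walk[OF orb_step(1) seg[of j]]
    have seg': "closed_segment (c (m j)) (c b) \<subseteq> P" using seg by (simp add: closed_segment_commute)
    note r = walk[OF cu seg']
    have qr: "path (?q +++ ?r)" "path_image (?q +++ ?r) \<subseteq> B - {v}"
      "lifts_to (?q +++ ?r) (frame u (c b)) (frame (cross j u) (c b))"
      using q r ends fr BX
      by (auto simp: pathstart_compose pathfinish_compose path_image_join intro!: lifts_to_join)
    have "path (p +++ (?q +++ ?r))" "path_image (p +++ (?q +++ ?r)) \<subseteq> B - {v}"
      using p qr by (auto simp: pathstart_compose pathfinish_compose path_image_join)
    moreover have "lifts_to (p +++ (?q +++ ?r)) (frame w (c b)) (frame (cross j u) (c b))"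
      using p qr BX by (intro lifts_to_join[OF _ _ _ _ _ p(5)]) (auto simp: pathstart_compose)
    ultimately show ?case using p
      by (intro exI[of _ "p +++ (?q +++ ?r)"]) (simp add: pathstart_compose pathfinish_compose)
  qed
  show "good w (axis i 1)"
    unfolding good_def e_def[symmetric]
  proof (intro allI impI)
    fix g :: "'l \<Rightarrow> 'l" assume g: "bij g" "act w g \<in> orbit e w" "relabel e g = e"
    obtain p where p: "path p" "path_image p \<subseteq> B - {v}" "pathstart p = Q w (c b)"
      "pathfinish p = Q (act w g) (c b)" "lifts_to p (frame w (c b)) (frame (act w g) (c b))"
      using chain[OF g(2)] by blast
    \<comment> \<open>\<open>g\<close> fixes the label \<open>i\<close>, and all coordinates of
      \<open>b\<close> are equal; hence the chain ends in the point where it began and is a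
      loop.\<close>
    have "relabel (c b) g = c b"
      using g(3) by (simp add: vec_eq_iff c_def b_def)
    moreover have cbS: "c b \<in> bary_simplex" using cb by (simp add: P_def)
    ultimately have "Q (act w g) (c b) = Q w (c b)" using Q_act[OF w g(1) cbS] by simp
    then have "homotopic_paths (B - {v}) p (\<lambda>_. Q w (c b))" using B(4)[OF p(1,2)] p(3,4) by simp
    then have hom: "homotopic_paths good_set p (\<lambda>_. Q w (c b))" using BX homotopic_paths_subset by blast
    obtain U s where "(U, s) \<in> sections" "Q w (c b) \<in> U" "s (Q w (c b)) = frame w (c b)"
      using good_set_section[OF w cbS P(1)[OF orb_base cb]] by blast
    then have "lifts_to (\<lambda>_. Q w (c b)) (frame w (c b)) (frame w (c b))" using lifts_to_const by metis
    then have "frame (act w g) (c b) = frame w (c b)" using lifts_to_homotopic[OF hom p(5)] by blast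
    then have "w \<in> orbit (c b) (act w g)" using frame_eq_iff[OF act_in[OF w g(1)] w] by blast
    \<comment> \<open>\<open>c b\<close> lies in the interior of the simplex, where the orbit is a
      single labelled simplex; equality of frames becomes equality of \<open>act w g\<close> and
      \<open>w\<close>.\<close>
    moreover have "zeros (c b) = {}"
    proof -
      have "c b $ k > 0" for k
        using d0 card by (simp add: c_def b_def e_def axis_def add_nonneg_pos)
      then show ?thesis unfolding zeros_def by (metis (mono_tags, lifting) empty_Collect_eq less_irrefl)
    qed
    ultimately have "act w g = w" by (simp add: orb_empty)
    then show "g = id" using act_free w by blast
  qed
qed

section \<open>Monodromy of the frames\<close>

lemma frame_act_frame_act: "frame_act (frame_act f g) h = frame_act f (g \<circ> h)"
  by (simp add: frame_act_def image_image act_act relabel_relabel)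

text \<open>Freeness of the action over good points; it makes the permutation attached to a loop
  unique.\<close>

lemma frame_act_inj:
  assumes "good w x" "w \<in> Om" "bij g" "bij h" "frame_act (frame w x) g = frame_act (frame w x) h"
  shows "g = h"
proof -
  have b: "bij (h \<circ> pinv g)" using assms(3,4) bij_inv(1) by (intro bij_comp)
  have "frame_act (frame_act (frame w x) g) (pinv g) = frame_act (frame_act (frame w x) h) (pinv g)"
    using assms(5) by simp
  then have "frame_act (frame w x) id = frame_act (frame w x) (h \<circ> pinv g)"
    using assms(3) by (simp add: frame_act_frame_act bij_inv)
  then have "frame w x = frame (act w (h \<circ> pinv g)) (relabel x (h \<circ> pinv g))"
    using frame_act_frame[OF bij_id assms(2)] frame_act_frame[OF b assms(2)] by (simp add: act_id)
  then have "h \<circ> pinv g = id"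
    using frame_eq_iff[OF assms(2) act_in[OF assms(2) b]] assms(1) b unfolding good_def by metis
  then have "h \<circ> (pinv g \<circ> g) = g" by (metis comp_assoc id_comp)
  then show ?thesis using bij_inv(3)[OF assms(3)] by simp
qed

text \<open>The order of composition is reversed since labels are changed on the right.\<close>

lemma monodromy_exists:
  assumes good: "\<And>w x. w \<in> Om \<Longrightarrow> x \<in> bary_simplex \<Longrightarrow> good w x"
    and w: "w \<in> Om" and x: "x \<in> bary_simplex"
  obtains \<rho> :: "(real \<Rightarrow> 'a) \<Rightarrow> 'l \<Rightarrow> 'l" where "\<And>p. p \<in> loops_at M (Q w x) \<Longrightarrow> bij (\<rho> p)"
    "\<And>p q. p \<in> loops_at M (Q w x) \<Longrightarrow> homotopic_paths M p q \<Longrightarrow> \<rho> p = \<rho> q"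
    "\<And>p q. p \<in> loops_at M (Q w x) \<Longrightarrow> q \<in> loops_at M (Q w x) \<Longrightarrow> \<rho> (p +++ q) = \<rho> q \<circ> \<rho> p"
    "\<And>i j. i \<noteq> j \<Longrightarrow> Q w (axis i 1) = Q w (axis j 1) \<Longrightarrow> \<exists>p\<in>loops_at M (Q w x). \<rho> p \<noteq> id"
proof -
  have gM: "good_set = M"
    using good_set_subset Q_surj good unfolding good_set_def by blast
  define f where "f = frame w x"
  \<comment> \<open>Only the transport of the base frame \<open>f\<close> is recorded: every frame
    over the base point is \<open>frame_act f g\<close> for exactly one bijection
    \<open>g\<close>.\<close>
  define \<rho> where "\<rho> = (\<lambda>p. THE g. bij g \<and> lifts_to p f (frame_act f g))"
  have fuse: "g = h" if "bij g" "bij h" "frame_act f g = frame_act f h" for g h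
    using frame_act_inj[OF good[OF w x] w that(1,2)] that(3) unfolding f_def by blast
  have ex: "\<exists>g. bij g \<and> lifts_to p f (frame_act f g)" if p: "p \<in> loops_at M (Q w x)" for p
  proof -
    have p': "path p" "path_image p \<subseteq> good_set" "pathstart p = Q w x" "pathfinish p = Q w x"
      using p unfolding loops_at_def gM by auto
    obtain U s where s: "(U, s) \<in> sections" "Q w x \<in> U" "s (Q w x) = f"
      using good_set_section[OF w x good[OF w x]] unfolding f_def by blast
    then obtain f' where f': "lifts_to p f f'" using lifts_to_exists[OF p'(1,2) s(1)] p'(3) by auto
    then obtain V r where r: "(V, r) \<in> sections" "Q w x \<in> V" "f' = r (Q w x)"
      using lifts_to_end[OF f'] p'(4) by auto
    obtain w' x' where w': "w' \<in> Om" "x' \<in> bary_simplex" "Q w x = Q w' x'" "f' = frame w' x'"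
      using section_value[OF r(1,2)] r(3) by metis
    obtain g where g: "bij g" "act w g \<in> orbit x' w'" "x' = relabel x g"
      using Q_eq[OF w'(1) w w'(2) x] w'(3) by metis
    have "f' = frame_act f g"
      unfolding w'(4) f_def frame_act_frame[OF g(1) w]
      using frame_eq_iff[OF w'(1) act_in[OF w g(1)]] g(2,3) by simp
    then show ?thesis using f' g(1) by blast
  qed
  have the: "\<rho> p = g" if p: "p \<in> loops_at M (Q w x)" and g: "bij g" "lifts_to p f (frame_act f g)" for p g
    unfolding \<rho>_def
  proof (rule the_equality)
    fix h assume h: "bij h \<and> lifts_to p f (frame_act f h)"
    have p': "path p" "path_image p \<subseteq> good_set" using p unfolding loops_at_def gM by auto
    have "frame_act f h = frame_act f g" using lifts_to_unique[OF p'] h g(2) by blast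
    then show "h = g" using fuse h g(1) by blast
  qed (use g in blast)
  have rho: "bij (\<rho> p)" "lifts_to p f (frame_act f (\<rho> p))" if "p \<in> loops_at M (Q w x)" for p
    using ex[OF that] the[OF that] by metis+
  show ?thesis
  proof (rule that[of \<rho>])
    show "bij (\<rho> p)" if "p \<in> loops_at M (Q w x)" for p using rho that by blast
    show "\<rho> p = \<rho> q" if p: "p \<in> loops_at M (Q w x)" and h: "homotopic_paths M p q" for p q
    proof -
      have q: "q \<in> loops_at M (Q w x)"
        using p homotopic_paths_imp_path[OF h] homotopic_paths_imp_subset[OF h]
          homotopic_paths_imp_pathstart[OF h] homotopic_paths_imp_pathfinish[OF h]
        by (simp add: loops_at_def)
      have "frame_act f (\<rho> p) = frame_act f (\<rho> q)"
        using lifts_to_homotopic[of p q] h rho(2)[OF p] rho(2)[OF q] unfolding gM by blast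
      then show ?thesis using fuse rho(1) p q by blast
    qed
    show "\<rho> (p +++ q) = \<rho> q \<circ> \<rho> p"
      if p: "p \<in> loops_at M (Q w x)" and q: "q \<in> loops_at M (Q w x)" for p q
    proof (rule the[OF loops_at_join[OF p q]])
      show "bij (\<rho> q \<circ> \<rho> p)" using rho(1) p q by (intro bij_comp)
      \<comment> \<open>\<open>q\<close> has to be lifted from the frame
        \<open>frame_act f (\<rho> p)\<close> at which the lift of \<open>p\<close> ends, and
        relabelling the lift of \<open>q\<close> puts \<open>\<rho> p\<close> on the right.\<close>
      have "lifts_to q (frame_act f (\<rho> p)) (frame_act f (\<rho> q \<circ> \<rho> p))"
        using lifts_to_act[OF rho(2)[OF q] rho(1)[OF p]] by (simp add: frame_act_frame_act)
      then show "lifts_to (p +++ q) f (frame_act f (\<rho> q \<circ> \<rho> p))"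
        using p q by (intro lifts_to_join[OF _ _ _ _ _ rho(2)[OF p]]) (auto simp: loops_at_def gM)
    qed
    show "\<exists>p\<in>loops_at M (Q w x). \<rho> p \<noteq> id" if ij: "i \<noteq> j" and eq: "Q w (axis i 1) = Q w (axis j 1)" for i j
    proof -
      define e where "e = (axis i 1 :: real^'l)"
      have eS: "e \<in> bary_simplex" unfolding e_def by (rule axis_in_bary_simplex)
      \<comment> \<open>The corner \<open>j\<close> of \<open>w\<close> is also the corner labelled
        \<open>i\<close> of \<open>act w g\<close>, which is met around the corner \<open>i\<close>
        of \<open>w\<close>. The loop runs to the corner inside \<open>w\<close> and returns inside
        \<open>act w g\<close>, the same simplex with other labels.\<close>
      obtain g where g: "bij g" "act w g \<in> orbit e w" "e = relabel (axis j 1) g"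
        using Q_eq[OF w w eS axis_in_bary_simplex] eq unfolding e_def by metis
      have xg: "relabel x g \<in> bary_simplex" using relabel_in_bary_simplex[OF g(1) x] .
      have aw: "act w g \<in> Om" using act_in[OF w g(1)] .
      note p = lifts_to_segment[OF w x eS good[OF w]]
      note q = lifts_to_segment[OF aw eS xg good[OF aw]]
      let ?p = "Q w \<circ> linepath x e" and ?q = "Q (act w g) \<circ> linepath e (relabel x g)"
      have sub: "closed_segment x e \<subseteq> bary_simplex" "closed_segment e (relabel x g) \<subseteq> bary_simplex"
        using closed_segment_subset[OF x eS convex_bary_simplex]
          closed_segment_subset[OF eS xg convex_bary_simplex] by auto
      have P: "path ?p" "path_image ?p \<subseteq> M" "lifts_to ?p f (frame w e)"
        and R: "path ?q" "path_image ?q \<subseteq> M" "lifts_to ?q (frame (act w g) e) (frame_act f g)"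
        using p q sub Q_in[OF w] Q_in[OF aw] frame_act_frame[OF g(1) w]
        by (auto simp: path_image_compose f_def)
      have fe: "frame w e = frame (act w g) e" using frame_eq_iff[OF w aw] g(2) by simp
      have mid: "pathfinish ?p = pathstart ?q"
        using Q_orbit[OF g(2) w eS] by (simp add: pathstart_compose pathfinish_compose)
      have loop: "?p +++ ?q \<in> loops_at M (Q w x)"
        using P R mid Q_act[OF w g(1) x]
        by (auto simp: loops_at_def path_image_join) (auto simp: pathstart_compose pathfinish_compose)
      have "lifts_to (?p +++ ?q) f (frame_act f g)"
        using P R mid fe by (intro lifts_to_join[OF _ _ _ _ _ P(3)]) (auto simp: gM)
      then have "\<rho> (?p +++ ?q) = g" using the[OF loop g(1)] by blast
      moreover have "g \<noteq> id" using g(3) ij unfolding e_def by (auto simp: axis_eq_axis)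
      ultimately show ?thesis using loop by (intro bexI[of _ "?p +++ ?q"]) simp_all
    qed
  qed
qed

end

section \<open>Permutations of four labels and walks around edges\<close>

datatype corner = C0 | C1 | C2 | C3

lemma UNIV_corner: "UNIV = {C0, C1, C2, C3}"
  using corner.exhaust by blast

instance corner :: finite
  by standard (simp add: UNIV_corner)

lemma all_corner: "(\<forall>a. P a) \<longleftrightarrow> P C0 \<and> P C1 \<and> P C2 \<and> P C3"
  by (metis corner.exhaust)

lemma card_corner: "CARD(corner) = 4"
  by (simp add: UNIV_corner)

text \<open>The three ways to split the corners into two pairs; a permutation of the corners acts on them,
  numbered modulo 3, by an affine map.\<close>

fun pairing :: "corner \<Rightarrow> corner \<Rightarrow> int" where
  "pairing C0 C0 = 0" | "pairing C0 C1 = 0" | "pairing C0 C2 = 1" | "pairing C0 C3 = 2"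
| "pairing C1 C0 = 0" | "pairing C1 C1 = 0" | "pairing C1 C2 = 2" | "pairing C1 C3 = 1"
| "pairing C2 C0 = 1" | "pairing C2 C1 = 2" | "pairing C2 C2 = 0" | "pairing C2 C3 = 0"
| "pairing C3 C0 = 2" | "pairing C3 C1 = 1" | "pairing C3 C2 = 0" | "pairing C3 C3 = 0"

definition pairing_shift :: "(corner \<Rightarrow> corner) \<Rightarrow> int" where
  "pairing_shift g = pairing (g C0) (g C1)"

text \<open>The linear part over the field with three elements. It is the sign of the permutation,
  with 2 in place of -1; so slope 1 singles out A_4, and slope 1 with shift 0 the
  four-group.\<close>

definition pairing_slope :: "(corner \<Rightarrow> corner) \<Rightarrow> int" where
  "pairing_slope g = (pairing (g C0) (g C2) - pairing_shift g) mod 3"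

lemma bij_corner_distinct:
  assumes "bij (g :: corner \<Rightarrow> corner)"
  shows "g C0 \<noteq> g C1" "g C0 \<noteq> g C2" "g C0 \<noteq> g C3" "g C1 \<noteq> g C2" "g C1 \<noteq> g C3" "g C2 \<noteq> g C3"
  using assms by (simp_all add: bij_is_inj inj_eq)

lemma bij_corner_cases:
  assumes "bij (g :: corner \<Rightarrow> corner)"
  shows "(g C0, g C1, g C2, g C3) \<in>
    {(C0, C1, C2, C3), (C0, C1, C3, C2), (C0, C2, C1, C3), (C0, C2, C3, C1), (C0, C3, C1, C2),
     (C0, C3, C2, C1), (C1, C0, C2, C3), (C1, C0, C3, C2), (C1, C2, C0, C3), (C1, C2, C3, C0),
     (C1, C3, C0, C2), (C1, C3, C2, C0), (C2, C0, C1, C3), (C2, C0, C3, C1), (C2, C1, C0, C3),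
     (C2, C1, C3, C0), (C2, C3, C0, C1), (C2, C3, C1, C0), (C3, C0, C1, C2), (C3, C0, C2, C1),
     (C3, C1, C0, C2), (C3, C1, C2, C0), (C3, C2, C0, C1), (C3, C2, C1, C0)}"
  using bij_corner_distinct[OF assms]
  by (cases "g C0"; cases "g C1"; simp; cases "g C2"; simp; cases "g C3"; simp)

text \<open>Every permutation of the residues modulo 3 is affine, and the proof computes the 24
  cases. The condition \<open>a \<noteq> b\<close> avoids the diagonal of \<open>pairing\<close>,
  whose zeros are mere fillers.\<close>

lemma pairing_affine_all:
  assumes "bij g"
  shows "\<forall>a b. a \<noteq> b \<longrightarrow> pairing (g a) (g b) = (pairing_slope g * pairing a b + pairing_shift g) mod 3"
  using bij_corner_cases[OF assms] unfolding insert_iff empty_iff prod.inject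
  by (elim disjE conjE; simp add: all_corner pairing_slope_def pairing_shift_def)

lemma pairing_affine:
  "bij g \<Longrightarrow> a \<noteq> b \<Longrightarrow> pairing (g a) (g b) = (pairing_slope g * pairing a b + pairing_shift g) mod 3"
  using pairing_affine_all by blast

lemma pairing_slope_cases: 
  assumes "bij g" shows "pairing_slope g = 1 \<or> pairing_slope g = 2"
  using bij_corner_cases[OF assms] unfolding insert_iff empty_iff prod.inject
  by (elim disjE conjE; simp add: pairing_slope_def pairing_shift_def)

lemma pairing_shift_range: "pairing_shift g \<in> {0, 1, 2}"
  by (cases "g C0"; cases "g C1") (simp_all add: pairing_shift_def)

lemma pairing_shift_comp:
  assumes "bij g" "bij h"
  shows "pairing_shift (g \<circ> h) = (pairing_slope g * pairing_shift h + pairing_shift g) mod 3"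
  using pairing_affine[OF assms(1) bij_corner_distinct(1)[OF assms(2)]]
  by (simp only: pairing_shift_def[of "g \<circ> h"] pairing_shift_def[of h] comp_apply)

lemma pairing_slope_comp:
  assumes "bij g" "bij h"
  shows "pairing_slope (g \<circ> h) = (pairing_slope g * pairing_slope h) mod 3"
proof -
  have "pairing_slope (g \<circ> h) = ((pairing_slope g * pairing (h C0) (h C2) + pairing_shift g) mod 3
      - (pairing_slope g * pairing_shift h + pairing_shift g) mod 3) mod 3"
    using pairing_affine[OF assms(1) bij_corner_distinct(2)[OF assms(2)]] pairing_shift_comp[OF assms]
    by (simp only: pairing_slope_def[of "g \<circ> h"] comp_apply)
  also have "\<dots> = (pairing_slope g * (pairing (h C0) (h C2) - pairing_shift h)) mod 3"
    by (simp add: mod_diff_eq algebra_simps)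
  finally show ?thesis by (simp add: pairing_slope_def[of h] mod_mult_right_eq)
qed

text \<open>The four-group acts by translations: with \<open>C0\<close>, \<open>C1\<close>,
  \<open>C2\<close>, \<open>C3\<close> read as the binary numerals 00, 01, 10, 11, the two sets test
  one digit each, and \<open>g\<close> adds the digits of \<open>g C0\<close> modulo 2.\<close>

lemma four_group_all:
  assumes "bij g" "pairing_slope g = 1" "pairing_shift g = 0"
  shows "(g = id \<or> g C0 \<noteq> C0) \<and>
    (\<forall>a. g a \<in> {C2, C3} \<longleftrightarrow> (g C0 \<in> {C2, C3}) \<noteq> (a \<in> {C2, C3})) \<and>
    (\<forall>a. g a \<in> {C1, C3} \<longleftrightarrow> (g C0 \<in> {C1, C3}) \<noteq> (a \<in> {C1, C3}))"
  using bij_corner_cases[OF assms(1)] assms(2,3)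
  unfolding insert_iff[of "(g C0, g C1, g C2, g C3)"] empty_iff prod.inject
  by (elim disjE conjE; simp add: pairing_slope_def pairing_shift_def fun_eq_iff all_corner)

lemma four_group:
  assumes "bij g" "pairing_slope g = 1" "pairing_shift g = 0"
  shows "g = id \<or> g C0 \<noteq> C0"
    and "g a \<in> {C2, C3} \<longleftrightarrow> (g C0 \<in> {C2, C3}) \<noteq> (a \<in> {C2, C3})"
    and "g a \<in> {C1, C3} \<longleftrightarrow> (g C0 \<in> {C1, C3}) \<noteq> (a \<in> {C1, C3})"
  using four_group_all[OF assms] by blast+

text \<open>An odd element makes the sign onto. If all elements are even but not all lie in the
  four-group, the shift is additive and onto the residues modulo 3. Inside the four-group a binary
  digit of the image of \<open>C0\<close> is a character, and one of the two is nonzero at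
  \<open>k\<close>.\<close>

lemma corner_group_quotient:
  assumes bij: "\<And>g. g \<in> K \<Longrightarrow> bij g" and comp: "\<And>g h. g \<in> K \<Longrightarrow> h \<in> K \<Longrightarrow> g \<circ> h \<in> K"
    and k: "k \<in> K" "k \<noteq> id"
  obtains n :: nat and \<theta> :: "(corner \<Rightarrow> corner) \<Rightarrow> int" where "n = 2 \<or> n = 3"
    "\<And>g h. g \<in> K \<Longrightarrow> h \<in> K \<Longrightarrow> \<theta> (g \<circ> h) = (\<theta> g + \<theta> h) mod int n" "\<theta> ` K = {0..<int n}"
proof -
  note result = that
  have two: thesis
    if hom: "\<And>g h. g \<in> K \<Longrightarrow> h \<in> K \<Longrightarrow> (P (g \<circ> h) \<longleftrightarrow> P g \<noteq> P h)" and g: "g \<in> K" "P g" for P g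
  proof (rule result[of 2 "\<lambda>g. if P g then 1 else 0"])
    show "(if P (g \<circ> h) then 1 else 0) = ((if P g then 1 else 0) + (if P h then 1 else 0)) mod int 2"
      if "g \<in> K" "h \<in> K" for g h using hom[OF that] by auto
    have "\<not> P (g \<circ> g)" "g \<circ> g \<in> K" using hom[OF g(1) g(1)] comp g(1) by auto
    then have "{0, 1} \<subseteq> (\<lambda>g. if P g then 1 else 0) ` K" using g by force
    moreover have "{0..<int 2} = {0, 1}" by auto
    ultimately show "(\<lambda>g. if P g then 1 else 0) ` K = {0..<int 2}" by auto
  qed simp
  consider (odd) g where "g \<in> K" "pairing_slope g = 2"
    | (rot) g where "\<And>g. g \<in> K \<Longrightarrow> pairing_slope g = 1" "g \<in> K" "pairing_shift g \<noteq> 0"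
    | (four) "\<And>g. g \<in> K \<Longrightarrow> pairing_slope g = 1 \<and> pairing_shift g = 0"
    using pairing_slope_cases bij by blast
  then show thesis
  proof cases
    case odd
    show thesis
    proof (rule two[where P = "\<lambda>g. pairing_slope g = 2", OF _ odd])
      fix g h assume "g \<in> K" "h \<in> K"
      then show "pairing_slope (g \<circ> h) = 2 \<longleftrightarrow> (pairing_slope g = 2) \<noteq> (pairing_slope h = 2)"
        using pairing_slope_cases[of g] pairing_slope_cases[of h] pairing_slope_comp[of g h] bij by auto
    qed
  next
    case rot
    have hom: "pairing_shift (g \<circ> h) = (pairing_shift g + pairing_shift h) mod 3"
      if "g \<in> K" "h \<in> K" for g h
      using pairing_shift_comp[of g h] bij that rot(1) by (simp add: add.commute)
    show thesis
    proof (rule result[of 3 pairing_shift])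
      show "pairing_shift (g \<circ> h) = (pairing_shift g + pairing_shift h) mod int 3"
        if "g \<in> K" "h \<in> K" for g h using hom[OF that] by simp
      have K: "g \<circ> g \<in> K" "g \<circ> (g \<circ> g) \<in> K" using comp rot(2) by auto
      have gg: "pairing_shift (g \<circ> g) = (2 * pairing_shift g) mod 3"
        and ggg: "pairing_shift (g \<circ> (g \<circ> g)) = 0"
        using hom[OF rot(2,2)] hom[OF rot(2) K(1)] by (simp_all add: mod_add_right_eq)
      \<comment> \<open>A nonzero residue, its double and its triple are all the residues modulo
        3.\<close>
      have "{0, 1, 2} \<subseteq> {pairing_shift g, pairing_shift (g \<circ> g), pairing_shift (g \<circ> (g \<circ> g))}"
        using pairing_shift_range[of g] rot(3) unfolding gg ggg by auto
      also have "\<dots> \<subseteq> pairing_shift ` K" using K rot(2) by blast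
      finally have "{0, 1, 2} \<subseteq> pairing_shift ` K" .
      moreover have "pairing_shift ` K \<subseteq> {0, 1, 2}" using pairing_shift_range by (intro image_subsetI)
      ultimately have "pairing_shift ` K = {0, 1, 2}" by (rule equalityI[rotated])
      moreover have "{0..<int 3} = {0, 1, 2}" by auto
      ultimately show "pairing_shift ` K = {0..<int 3}" by (rule trans[OF _ sym])
    qed simp
  next
    case four
    have "k C0 \<noteq> C0" using four_group(1)[of k] four[OF k(1)] bij[OF k(1)] k(2) by blast
    then consider "k C0 \<in> {C2, C3}" | "k C0 \<in> {C1, C3}" by (cases "k C0") auto
    then show thesis
    proof cases
      case 1
      show thesis
      proof (rule two[where P = "\<lambda>g. g C0 \<in> {C2, C3}", OF _ k(1) 1])
        fix g h assume "g \<in> K" "h \<in> K"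
        then show "(g \<circ> h) C0 \<in> {C2, C3} \<longleftrightarrow> (g C0 \<in> {C2, C3}) \<noteq> (h C0 \<in> {C2, C3})"
          using four_group(2)[of g "h C0"] four bij by simp
      qed
    next
      case 2
      show thesis
      proof (rule two[where P = "\<lambda>g. g C0 \<in> {C1, C3}", OF _ k(1) 2])
        fix g h assume "g \<in> K" "h \<in> K"
        then show "(g \<circ> h) C0 \<in> {C1, C3} \<longleftrightarrow> (g C0 \<in> {C1, C3}) \<noteq> (h C0 \<in> {C1, C3})"
          using four_group(3)[of g "h C0"] four bij by simp
      qed
    qed
  qed
qed

text \<open>The walk \<open>W\<close> crosses alternately the two faces at an edge.\<close>

definition alternating :: "'w set \<Rightarrow> ('w \<Rightarrow> 'w) \<Rightarrow> ('w \<Rightarrow> 'w) \<Rightarrow> (int \<Rightarrow> 'w) \<Rightarrow> bool" where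
  "alternating Om a b W \<longleftrightarrow> (\<forall>j. W j \<in> Om \<and> W (j + 1) = (if even j then a else b) (W j))"

lemma alternatingD:
  assumes "alternating Om a b W"
  shows "W j \<in> Om" "W (j + 1) = (if even j then a else b) (W j)"
  using assms unfolding alternating_def by blast+

lemma alternating_shift_even:
  assumes "alternating Om a b W" "even d"
  shows "alternating Om a b (\<lambda>j. W (j + d))"
  unfolding alternating_def
proof (intro allI conjI)
  fix j
  show "W (j + d) \<in> Om" using alternatingD(1)[OF assms(1)] .
  show "W (j + 1 + d) = (if even j then a else b) (W (j + d))"
    using alternatingD(2)[OF assms(1), of "j + d"] assms(2) by (simp add: ac_simps)
qed

lemma alternating_shift_odd:
  assumes "alternating Om a b W" "odd d"
  shows "alternating Om b a (\<lambda>j. W (j + d))"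
  unfolding alternating_def
proof (intro allI conjI)
  fix j
  show "W (j + d) \<in> Om" using alternatingD(1)[OF assms(1)] .
  show "W (j + 1 + d) = (if even j then b else a) (W (j + d))"
    using alternatingD(2)[OF assms(1), of "j + d"] assms(2) by (simp add: ac_simps)
qed

lemma alternating_prev:
  assumes "alternating Om a b W" "\<And>w. w \<in> Om \<Longrightarrow> a (a w) = w" "\<And>w. w \<in> Om \<Longrightarrow> b (b w) = w"
  shows "W (j - 1) = (if even j then b else a) (W j)"
proof -
  have "W (j - 1) \<in> Om" "W (j - 1 + 1) = (if even (j - 1) then a else b) (W (j - 1))"
    using assms(1) unfolding alternating_def by blast+
  then show ?thesis using assms(2,3) by (simp split: if_splits)
qed

text \<open>Crossings are involutions, so a walk can be run backwards; the crossing that leaves step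
  0 is then the other one, hence the exchange of \<open>a\<close> and \<open>b\<close>.\<close>

lemma alternating_reflect:
  assumes "alternating Om a b W" "\<And>w. w \<in> Om \<Longrightarrow> a (a w) = w" "\<And>w. w \<in> Om \<Longrightarrow> b (b w) = w"
  shows "alternating Om b a (\<lambda>j. W (- j))"
  unfolding alternating_def
proof (intro allI conjI)
  fix j
  show "W (- j) \<in> Om" using assms(1) unfolding alternating_def by blast
  show "W (- (j + 1)) = (if even j then b else a) (W (- j))"
    using alternating_prev[OF assms, of "- j"] by simp
qed

text \<open>Lets a symmetry of a walk be verified at a single step.\<close>

lemma alternating_unique:
  assumes "alternating Om a b W" "alternating Om a b V"
    and inv: "\<And>w. w \<in> Om \<Longrightarrow> a (a w) = w" "\<And>w. w \<in> Om \<Longrightarrow> b (b w) = w"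
    and k: "W k = V k"
  shows "W j = V j"
proof (induction j rule: int_induct[where k = k])
  case (step1 i)
  then show ?case using assms(1,2) unfolding alternating_def by metis
next
  case (step2 i)
  then show ?case using alternating_prev[OF assms(1) inv, of i] alternating_prev[OF assms(2) inv, of i] by simp
qed (rule k)

lemma alternating_exists:
  assumes "w \<in> Om" "\<And>w. w \<in> Om \<Longrightarrow> a w \<in> Om" "\<And>w. w \<in> Om \<Longrightarrow> b w \<in> Om"
    and inv: "\<And>w. w \<in> Om \<Longrightarrow> a (a w) = w" "\<And>w. w \<in> Om \<Longrightarrow> b (b w) = w"
  obtains W where "alternating Om a b W" "W 0 = w"
proof -
  \<comment> \<open>The walk is infinite in both directions: \<open>u\<close> is the forward half,
    and \<open>d\<close> the backward half, which begins with the other crossing.\<close>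
  define u where "u = rec_nat w (\<lambda>n. if even n then a else b)"
  define d where "d = rec_nat w (\<lambda>n. if even n then b else a)"
  have u: "u 0 = w" "\<And>n. u (Suc n) = (if even n then a else b) (u n)" by (auto simp: u_def)
  have d: "d 0 = w" "\<And>n. d (Suc n) = (if even n then b else a) (d n)" by (auto simp: d_def)
  have uO: "u n \<in> Om" for n by (induction n) (use u assms in auto)
  have dO: "d n \<in> Om" for n by (induction n) (use d assms in auto)
  define W where "W = (\<lambda>j. if j \<ge> 0 then u (nat j) else d (nat (- j)))"
  have "W j \<in> Om \<and> W (j + 1) = (if even j then a else b) (W j)" for j
  proof (cases "j \<ge> 0")
    case True
    then have "nat (j + 1) = Suc (nat j)" by simp
    then show ?thesis using True uO u(2)[of "nat j"] by (simp add: W_def even_nat_iff)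
  next
    case False
    define n where "n = nat (- j - 1)"
    have n: "j = - int n - 1" using False by (simp add: n_def)
    have even_j: "even j \<longleftrightarrow> odd n" unfolding n by simp
    have Wj: "W j = d (Suc n)" using False by (simp add: W_def n nat_add_distrib)
    have Wj1: "W (j + 1) = d n"
    proof (cases "n = 0")
      case False
      then show ?thesis using n by (simp add: W_def)
    qed (use u(1) d(1) n in \<open>simp add: W_def\<close>)
    show ?thesis
      using dO[of n] dO[of "Suc n"] inv d(2)[of n] unfolding Wj Wj1 even_j by auto
  qed
  then have "alternating Om a b W" unfolding alternating_def by blast
  moreover have "W 0 = w" by (simp add: W_def u)
  ultimately show ?thesis by (rule that)
qed

text \<open>\<open>s\<close> swaps the two corners off the edge, \<open>r\<close> reverses the edge, \<open>ed\<close> is the underlying edge and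
  \<open>sg\<close> the orientation.  A walk around the edge that returned with a swap would have passed every
  simplex edge after the same odd number of steps.\<close>

lemma even_walk_no_return:
  assumes W: "alternating Om a b W"
    and inv: "\<And>w. w \<in> Om \<Longrightarrow> a (a w) = w" "\<And>w. w \<in> Om \<Longrightarrow> b (b w) = w"
    and sr_in: "\<And>w. w \<in> Om \<Longrightarrow> s w \<in> Om" "\<And>w. w \<in> Om \<Longrightarrow> r w \<in> Om"
    and ss: "\<And>w. w \<in> Om \<Longrightarrow> s (s w) = w"
    and comm: "\<And>w. w \<in> Om \<Longrightarrow> s (a w) = b (s w)" "\<And>w. w \<in> Om \<Longrightarrow> s (b w) = a (s w)"
      "\<And>w. w \<in> Om \<Longrightarrow> r (a w) = a (r w)" "\<And>w. w \<in> Om \<Longrightarrow> r (b w) = b (r w)"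
    and sg: "\<And>w. w \<in> Om \<Longrightarrow> sg (a w) \<noteq> sg w" "\<And>w. w \<in> Om \<Longrightarrow> sg (b w) \<noteq> sg w"
      "\<And>w. w \<in> Om \<Longrightarrow> sg (s w) \<noteq> sg w" "\<And>w. w \<in> Om \<Longrightarrow> sg (r w) \<noteq> (sg w :: bool)"
    and ne: "\<And>w. w \<in> Om \<Longrightarrow> s (r w) \<noteq> w" "\<And>w. w \<in> Om \<Longrightarrow> a w \<noteq> r w" "\<And>w. w \<in> Om \<Longrightarrow> b w \<noteq> r w"
    and ed: "\<And>w w'. w \<in> Om \<Longrightarrow> w' \<in> Om \<Longrightarrow> ed w = ed w' \<longleftrightarrow> w' \<in> {w, s w, r w, s (r w)}"
    and even: "even (card (ed ` range W))"
  shows "s (W j) \<noteq> W k" "r (W j) \<noteq> W k" "s (r (W j)) \<noteq> W k"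
proof -
  have WO: "W j \<in> Om" for j using W unfolding alternating_def by blast
  have W1: "W (j + 1) = (if even j then a else b) (W j)" for j using W unfolding alternating_def by blast
  \<comment> \<open>Each crossing flips the orientation, so the orientation of \<open>W j\<close>
    tells the parity of \<open>j\<close>.\<close>
  have sgW: "sg (W j) = (if even j then sg (W 0) else \<not> sg (W 0))" for j
  proof (induction j rule: int_induct[where k = 0])
    case (step1 i) then show ?case using sg(1,2)[OF WO, of i] W1[of i] by (auto split: if_splits)
  next
    case (step2 i) then show ?case
      using sg(1,2)[OF WO, of "i - 1"] W1[of "i - 1"] by (auto split: if_splits)
  qed simp
  have par: "even j = even k" if "sg (W j) = sg (W k)" for j k
    using that sgW[of j] sgW[of k] by (auto split: if_splits)
  have npar: "even j \<noteq> even k" if "sg (W j) \<noteq> sg (W k)" for j k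
    using that sgW[of j] sgW[of k] by (auto split: if_splits)
  have as: "alternating Om b a (\<lambda>j. s (W j))" and ar: "alternating Om a b (\<lambda>j. r (W j))"
    and asr: "alternating Om b a (\<lambda>j. s (r (W j)))"
    unfolding alternating_def using WO W1 sr_in comm by auto
  \<comment> \<open>\<open>r\<close> would reflect the walk about the midpoint between two steps. It
    would exchange these two steps, so that a crossing would equal \<open>r\<close>, contrary to
    \<open>ne\<close>.\<close>
  show R: "r (W j) \<noteq> W k" for j k
  proof
    assume e: "r (W j) = W k"
    have "even j \<noteq> even k" using npar[of j k] sg(4)[OF WO, of j] e by auto
    then have odd: "odd (- (j + k))" by auto
    have "alternating Om a b (\<lambda>i. W (- (i + - (j + k))))"
      using alternating_shift_odd[OF alternating_reflect[OF W inv] odd] .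
    then have V: "r (W i) = W (j + k - i)" for i
      using alternating_unique[OF ar _ inv, of _ j i] e by (simp add: algebra_simps)
    obtain i where "j + k = 2 * i + 1" using odd by (metis even_minus oddE)
    then have "r (W i) = W (i + 1)" using V[of i] by simp
    then show False using W1[of i] ne(2,3)[OF WO, of i] by (auto split: if_splits)
  qed
  \<comment> \<open>This reflection is about a step of the walk, and that step would be a labelled
    simplex fixed by \<open>s \<circ> r\<close>.\<close>
  show SR: "s (r (W j)) \<noteq> W k" for j k
  proof
    assume e: "s (r (W j)) = W k"
    have "even j = even k" using par[of j k] sg(4)[OF WO, of j] sg(3)[OF sr_in(2)[OF WO], of j] e by auto
    then have ev: "even (- (j + k))" by auto
    have "alternating Om b a (\<lambda>i. W (- (i + - (j + k))))"
      using alternating_shift_even[OF alternating_reflect[OF W inv] ev] .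
    then have V: "s (r (W i)) = W (j + k - i)" for i
      using alternating_unique[OF asr _ inv(2,1), of _ j i] e by (simp add: algebra_simps)
    obtain i where "j + k = 2 * i" using ev by (metis even_minus evenE)
    then have "s (r (W i)) = W i" using V[of i] by simp
    then show False using ne(1)[OF WO] by blast
  qed
  show "s (W j) \<noteq> W k"
  proof
    assume e: "s (W j) = W k"
    \<comment> \<open>In this case \<open>s\<close> would translate the walk by \<open>p\<close>,
      which is odd because \<open>s\<close> flips the orientation.\<close>
    define p where "p = k - j"
    have "even j \<noteq> even k" using npar[of j k] sg(3)[OF WO, of j] e by auto
    then have odd: "odd p" by (auto simp: p_def)
    have "alternating Om b a (\<lambda>i. W (i + p))" using alternating_shift_odd[OF W odd] .
    then have S: "s (W i) = W (i + p)" for i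
      using alternating_unique[OF as _ inv(2,1), of _ j i] e by (simp add: p_def)
    define per where "per = (\<lambda>d. \<forall>i. W (i + d) = W i)"
    have per_iff: "W i = W i' \<longleftrightarrow> per (i' - i)" for i i'
    proof
      assume eq: "W i = W i'"
      then have "even (i' - i)" using par[of i i'] by auto
      then have "alternating Om a b (\<lambda>x. W (x + (i' - i)))" using alternating_shift_even[OF W] by blast
      then show "per (i' - i)" unfolding per_def
        using alternating_unique[OF W _ inv, of _ i] eq by (metis add.commute diff_add_cancel)
    next
      assume "per (i' - i)"
      then have "W (i + (i' - i)) = W i" unfolding per_def by blast
      then show "W i = W i'" by simp
    qed
    have per0: "per 0" by (simp add: per_def)
    have per_add: "per (x + y)" if "per x" "per y" for x y
      using that unfolding per_def by (metis add.assoc)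
    have per_neg: "per (- x)" if "per x" for x
      using that unfolding per_def by (metis diff_add_cancel uminus_add_conv_diff add.commute)
    have per2p: "per (2 * p)"
    proof -
      have "W (0 + p + p) = W 0" using S[of 0] S[of "0 + p"] ss[OF WO, of 0] by simp
      then show ?thesis using per_iff[of 0 "2 * p"] by simp
    qed
    \<comment> \<open>The shifts that return to the same simplex edge. With reversals excluded, this
      means the same labelled simplex or its swap, and the swap is the shift by
      \<open>p\<close>.\<close>
    define H where "H = (\<lambda>d. per d \<or> per (d - p))"
    have edH: "ed (W i) = ed (W i') \<longleftrightarrow> H (i' - i)" for i i'
    proof -
      have "ed (W i) = ed (W i') \<longleftrightarrow> W i' = W i \<or> W i' = W (i + p)"
        using ed[OF WO WO, of i i'] R[of i i'] SR[of i i'] S[of i] by auto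
      also have "\<dots> \<longleftrightarrow> per (i' - i) \<or> per (i' - (i + p))"
        using per_iff[of i i'] per_iff[of "i + p" i'] by auto
      finally show ?thesis by (simp add: H_def algebra_simps)
    qed
    have H_add: "H (x + y)" if "H x" "H y" for x y
    proof -
      have eqs: "x - p + y = x + y - p" "x + (y - p) = x + y - p" "x - p + (y - p) + 2 * p = x + y" by auto
      from that show ?thesis unfolding H_def using per_add per2p eqs by metis
    qed
    have H_neg: "H (- x)" if "H x" for x
    proof -
      have "- (x - p) + - (2 * p) = - x - p" by simp
      then show ?thesis using that per_neg per_add per2p unfolding H_def by metis
    qed
    have Hp: "H p" using per0 by (simp add: H_def)
    have p0: "p \<noteq> 0" using odd by auto
    \<comment> \<open>\<open>H\<close> describes a subgroup of the integers that contains
      \<open>p\<close>. Its generator \<open>m\<close> divides \<open>p\<close> and is therefore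
      odd, while \<open>m\<close> is also the number of simplex edges that the walk passes.\<close>
    define m where "m = (LEAST n::nat. n > 0 \<and> H (int n))"
    have "nat \<bar>p\<bar> > 0 \<and> H (int (nat \<bar>p\<bar>))" using p0 Hp H_neg[OF Hp] by (auto simp: abs_if)
    then have m: "m > 0" "H (int m)" and least: "\<And>n. n > 0 \<Longrightarrow> H (int n) \<Longrightarrow> m \<le> n"
      unfolding m_def by (metis (mono_tags, lifting) LeastI, metis (mono_tags, lifting) LeastI, simp add: Least_le)
    have mult_nat: "H (int m * int n)" for n
    proof (induction n)
      case 0 then show ?case using per0 by (simp add: H_def)
    next
      case (Suc n) then show ?case using H_add[OF Suc.IH m(2)] by (simp add: algebra_simps)
    qed
    have mult: "H (int m * x)" for x
      using mult_nat[of "nat x"] H_neg[OF mult_nat[of "nat (- x)"]] by (cases "x \<ge> 0") auto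
    have H_iff: "H x \<longleftrightarrow> int m dvd x" for x
    proof
      assume Hx: "H x"
      have "x mod int m = x + int m * (- (x div int m))" by (simp add: minus_mult_div_eq_mod[symmetric])
      then have Hm: "H (x mod int m)" using H_add[OF Hx mult] by metis
      have range: "0 \<le> x mod int m" "x mod int m < int m" using m(1) by auto
      show "int m dvd x"
      proof (rule ccontr)
        assume "\<not> int m dvd x"
        then have "nat (x mod int m) > 0" using range by (simp add: dvd_eq_mod_eq_0)
        then have "m \<le> nat (x mod int m)" using least Hm range by simp
        then show False using range by simp
      qed
    qed (use mult in \<open>auto elim!: dvdE\<close>)
    have "odd m" using Hp H_iff odd by (metis dvd_trans even_of_nat_iff)
    have "ed ` range W = (\<lambda>i. ed (W i)) ` {0..<int m}"
    proof
      show "ed ` range W \<subseteq> (\<lambda>i. ed (W i)) ` {0..<int m}"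
      proof clarsimp
        fix x
        have "H (x mod int m - x)" unfolding H_iff by (simp add: minus_mod_eq_mult_div[symmetric] mod_eq_dvd_iff[symmetric])
        then have "ed (W x) = ed (W (x mod int m))" using edH by blast
        moreover have "x mod int m \<in> {0..<int m}" using m(1) by simp
        ultimately show "ed (W x) \<in> (\<lambda>i. ed (W i)) ` {0..<int m}" by blast
      qed
    qed auto
    moreover have "inj_on (\<lambda>i. ed (W i)) {0..<int m}"
    proof (rule inj_onI)
      fix x y assume "x \<in> {0..<int m}" "y \<in> {0..<int m}" "ed (W x) = ed (W y)"
      then show "x = y" using edH[of x y] H_iff[of "y - x"]
        by (metis atLeastLessThan_iff mod_eq_dvd_iff mod_pos_pos_trivial)
    qed
    ultimately have "card (ed ` range W) = m" by (simp add: card_image)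
    then show False using even \<open>odd m\<close> by simp
  qed
qed

section \<open>Labelled simplices of a gluing\<close>

definition bpoint :: "('l::finite \<Rightarrow> real^3) \<Rightarrow> real^'l \<Rightarrow> real^3" where
  "bpoint c x = (\<Sum>i\<in>UNIV. x $ i *\<^sub>R c i)"

lemma bpoint_inj:
  assumes c: "inj c" "\<not> affine_dependent (range c)" and x: "x \<in> bary_simplex" "y \<in> bary_simplex"
    and eq: "bpoint c x = bpoint c y"
  shows "x = y"
proof (rule ccontr)
  assume "x \<noteq> y"
  then obtain i where i: "x $ i \<noteq> y $ i" by (auto simp: vec_eq_iff)
  define u where "u = (\<lambda>v. x $ pinv c v - y $ pinv c v)"
  have uc: "u (c i) = x $ i - y $ i" for i using c(1) by (simp add: u_def)
  have "sum u (range c) = 0"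
    using sum.reindex[OF c(1), of u] x by (simp add: uc sum_subtractf bary_simplex_def)
  moreover have "(\<Sum>v\<in>range c. u v *\<^sub>R v) = 0"
    using sum.reindex[OF c(1), of "\<lambda>v. u v *\<^sub>R v"] eq
    by (simp add: uc scaleR_diff_left sum_subtractf bpoint_def)
  moreover have "u (c i) \<noteq> 0" using i uc by simp
  ultimately have "\<exists>U. sum U (range c) = 0 \<and> (\<exists>v\<in>range c. U v \<noteq> 0) \<and> (\<Sum>v\<in>range c. U v *\<^sub>R v) = 0"
    by (intro exI[of _ u]) blast
  then have "affine_dependent (range c)"
    by (subst affine_dependent_explicit_finite) simp_all
  then show False using c(2) by blast
qed

lemma convex_hull_bpoint:
  assumes c: "inj c"
  shows "convex hull (c ` S) = bpoint c ` {x \<in> bary_simplex. - S \<subseteq> zeros x}"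
proof
  show "convex hull (c ` S) \<subseteq> bpoint c ` {x \<in> bary_simplex. - S \<subseteq> zeros x}"
  proof
    fix y assume "y \<in> convex hull (c ` S)"
    then obtain u where u: "\<forall>v\<in>c ` S. 0 \<le> u v" "sum u (c ` S) = 1" "(\<Sum>v\<in>c ` S. u v *\<^sub>R v) = y"
      using convex_hull_finite[of "c ` S"] by auto
    define x where "x = (\<chi> i. if i \<in> S then u (c i) else 0)"
    have inj: "inj_on c S" using c by (rule inj_on_subset) simp
    have "(\<Sum>i\<in>UNIV. x $ i) = (\<Sum>i\<in>S. u (c i))"
      unfolding x_def by (simp add: sum.If_cases)
    also have "\<dots> = 1" using u(2) sum.reindex[OF inj, of u] by simp
    finally have "x \<in> bary_simplex" using u(1) by (simp add: bary_simplex_def x_def)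
    moreover have "- S \<subseteq> zeros x" by (auto simp: zeros_def x_def)
    moreover have "bpoint c x = y"
    proof -
      have "bpoint c x = (\<Sum>i\<in>UNIV. if i \<in> S then u (c i) *\<^sub>R c i else 0)"
        unfolding bpoint_def x_def by (intro sum.cong) auto
      also have "\<dots> = (\<Sum>i\<in>S. u (c i) *\<^sub>R c i)" by (simp add: sum.If_cases)
      also have "\<dots> = y" using u(3) sum.reindex[OF inj, of "\<lambda>v. u v *\<^sub>R v"] by simp
      finally show ?thesis .
    qed
    ultimately show "y \<in> bpoint c ` {x \<in> bary_simplex. - S \<subseteq> zeros x}" by blast
  qed
  show "bpoint c ` {x \<in> bary_simplex. - S \<subseteq> zeros x} \<subseteq> convex hull (c ` S)"
  proof clarify
    fix x assume x: "x \<in> bary_simplex" "- S \<subseteq> zeros x"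
    have out: "x $ i = 0" if "i \<notin> S" for i using x(2) that by (auto simp: zeros_def)
    have "(\<Sum>i\<in>S. x $ i) = 1"
      using sum.mono_neutral_left[of UNIV S "\<lambda>i. x $ i"] out x(1) by (simp add: bary_simplex_def)
    moreover have "bpoint c x = (\<Sum>i\<in>S. x $ i *\<^sub>R c i)"
      unfolding bpoint_def by (rule sum.mono_neutral_right) (use out in auto)
    moreover have "(\<Sum>i\<in>S. x $ i *\<^sub>R c i) \<in> convex hull (c ` S)" if "(\<Sum>i\<in>S. x $ i) = 1"
      by (rule convex_sum[OF _ convex_convex_hull that])
        (use x(1) in \<open>auto simp: bary_simplex_def intro: hull_inc\<close>)
    ultimately show "bpoint c x \<in> convex hull (c ` S)" by simp
  qed
qed

lemma bpoint_in_convex_hull_iff: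
  assumes "inj c" "\<not> affine_dependent (range c)" "x \<in> bary_simplex"
  shows "bpoint c x \<in> convex hull (c ` S) \<longleftrightarrow> - S \<subseteq> zeros x"
  using convex_hull_bpoint[OF assms(1), of S] bpoint_inj[OF assms(1,2,3)] assms(3) by auto

lemma bpoint_axis: "bpoint c (axis i 1) = c i"
proof -
  have "bpoint c (axis i 1) = (\<Sum>k\<in>UNIV. if k = i then c i else 0)"
    unfolding bpoint_def by (intro sum.cong) (auto simp: axis_def)
  then show ?thesis by simp
qed

lemma bpoint_comp:
  assumes "bij g" shows "bpoint (c \<circ> g) (relabel x g) = bpoint c x"
  using sum.reindex_bij_betw[of g UNIV UNIV "\<lambda>i. x $ i *\<^sub>R c i"] assms by (simp add: bpoint_def)

lemma continuous_on_bpoint: "continuous_on S (bpoint c)"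
  unfolding bpoint_def by (intro continuous_intros)

lemma compact_bary_simplex: "compact (bary_simplex :: (real^'l::finite) set)"
proof -
  have "bounded (bary_simplex :: (real^'l) set)"
    using norm_bary_simplex unfolding bounded_iff by blast
  moreover have "closed (bary_simplex :: (real^'l) set)"
    unfolding bary_simplex_def
    by (intro closed_Collect_conj closed_Collect_all closed_Collect_le closed_Collect_eq continuous_intros)
  ultimately show ?thesis by (simp add: compact_eq_bounded_closed)
qed

section \<open>Labelled simplices and crossings\<close>

definition simplex_corners :: "'i gluing \<Rightarrow> 'i \<Rightarrow> (real^3) set" where
  "simplex_corners T t = {v. v extreme_point_of tet T t}"

definition labelled :: "'i gluing \<Rightarrow> ('i \<times> (corner \<Rightarrow> real^3)) set" where
  "labelled T = {(t, c). t \<in> tets T \<and> bij_betw c UNIV (simplex_corners T t)}"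

definition opposite_face :: "'i \<times> (corner \<Rightarrow> real^3) \<Rightarrow> corner \<Rightarrow> 'i \<times> (real^3) set" where
  "opposite_face w i = (fst w, convex hull (snd w ` (- {i})))"

text \<open>\<open>glue\<close> says nothing about the corner off the face. Its label is forced all
  the same, \<open>i\<close> being the only one left; this makes the neighbour unique.\<close>

definition adjacent :: "'i gluing \<Rightarrow> corner \<Rightarrow> 'i \<times> (corner \<Rightarrow> real^3) \<Rightarrow> 'i \<times> (corner \<Rightarrow> real^3) \<Rightarrow> bool" where
  "adjacent T i w w' \<longleftrightarrow> w' \<in> labelled T \<and> partner T (opposite_face w i) = opposite_face w' i \<and>
     (\<forall>j. j \<noteq> i \<longrightarrow> snd w' j = glue T (opposite_face w i) (snd w j))"

definition cross :: "'i gluing \<Rightarrow> corner \<Rightarrow> 'i \<times> (corner \<Rightarrow> real^3) \<Rightarrow> 'i \<times> (corner \<Rightarrow> real^3)" where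
  "cross T i w = (THE w'. adjacent T i w w')"

definition change_labels :: "'i \<times> (corner \<Rightarrow> real^3) \<Rightarrow> (corner \<Rightarrow> corner) \<Rightarrow> 'i \<times> (corner \<Rightarrow> real^3)" where
  "change_labels w g = (fst w, snd w \<circ> g)"

definition char_map :: "('i \<times> (real^3) \<Rightarrow> 'a) \<Rightarrow> 'i \<times> (corner \<Rightarrow> real^3) \<Rightarrow> real ^ corner \<Rightarrow> 'a" where
  "char_map q w x = q (fst w, bpoint (snd w) x)"

locale gluing_data =
  fixes T :: "'i gluing"
  assumes valid: "valid_gluing T"
begin

lemma simplex_corners:
  assumes "t \<in> tets T"
  shows "\<not> affine_dependent (simplex_corners T t)" "card (simplex_corners T t) = 4"
    "tet T t = convex hull (simplex_corners T t)" "finite (simplex_corners T t)"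
proof -
  have "3 simplex tet T t" using valid assms unfolding valid_gluing_def by blast
  then obtain C where C: "\<not> affine_dependent C" "int (card C) = 3 + 1" "tet T t = convex hull C"
    unfolding simplex_def by blast
  have "simplex_corners T t = C"
    unfolding simplex_corners_def C(3) using extreme_point_of_convex_hull_affine_independent[OF C(1)] by blast
  then show "\<not> affine_dependent (simplex_corners T t)" "card (simplex_corners T t) = 4"
    "tet T t = convex hull (simplex_corners T t)" "finite (simplex_corners T t)"
    using C aff_independent_finite by auto
qed

lemma labelledD:
  assumes "w \<in> labelled T"
  shows "fst w \<in> tets T" "inj (snd w)" "range (snd w) = simplex_corners T (fst w)"
    "\<not> affine_dependent (range (snd w))" "tet T (fst w) = convex hull (range (snd w))"
  using assms simplex_corners[of "fst w"] unfolding labelled_def by (auto simp: bij_betw_def)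

lemma labelledI: "t \<in> tets T \<Longrightarrow> bij_betw c UNIV (simplex_corners T t) \<Longrightarrow> (t, c) \<in> labelled T"
  by (simp add: labelled_def)

lemma labelled_exists:
  assumes "t \<in> tets T" obtains c where "(t, c) \<in> labelled T"
proof -
  obtain c where "bij_betw c (UNIV :: corner set) (simplex_corners T t)"
    using finite_same_card_bij[of "UNIV :: corner set" "simplex_corners T t"] simplex_corners[OF assms]
    by (auto simp: card_corner)
  then show ?thesis using that labelledI[OF assms] by blast
qed

lemma finite_labelled: "finite (labelled T)"
proof -
  have "finite {c. bij_betw c (UNIV :: corner set) (simplex_corners T t)}" if "t \<in> tets T" for t
  proof (rule finite_subset)
    show "{c. bij_betw c (UNIV :: corner set) (simplex_corners T t)} \<subseteq> (UNIV \<rightarrow>\<^sub>E simplex_corners T t)"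
      by (auto simp: bij_betw_def)
    show "finite ((UNIV :: corner set) \<rightarrow>\<^sub>E simplex_corners T t)"
      using simplex_corners(4)[OF that] by (intro finite_PiE) auto
  qed
  moreover have "finite (tets T)" using valid unfolding valid_gluing_def by blast
  moreover have "labelled T = (SIGMA t:tets T. {c. bij_betw c UNIV (simplex_corners T t)})"
    by (auto simp: labelled_def)
  ultimately show ?thesis by (simp add: finite_SigmaI)
qed

lemma change_labels_in: "w \<in> labelled T \<Longrightarrow> bij g \<Longrightarrow> change_labels w g \<in> labelled T"
  using bij_betw_trans[of g UNIV UNIV "snd w" "simplex_corners T (fst w)"]
  by (auto simp: labelled_def change_labels_def)

lemma same_simplex_change_labels:
  assumes "w \<in> labelled T" "w' \<in> labelled T" "fst w = fst w'"
  obtains g where "bij g" "w' = change_labels w g"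
proof -
  define g where "g = pinv (snd w) \<circ> snd w'"
  have b: "bij_betw (snd w) UNIV (simplex_corners T (fst w))" "bij_betw (snd w') UNIV (simplex_corners T (fst w))"
    using assms by (auto simp: labelled_def)
  have "bij g" unfolding g_def using bij_betw_trans[OF b(2) bij_betw_inv_into[OF b(1)]] .
  moreover have "snd w \<circ> g = snd w'"
  proof
    fix i
    have "snd w' i \<in> range (snd w)" using b by (auto simp: bij_betw_def)
    then show "(snd w \<circ> g) i = snd w' i" by (simp add: g_def f_inv_into_f)
  qed
  ultimately show ?thesis using that[of g] assms(3) by (simp add: change_labels_def prod_eq_iff)
qed

lemma opposite_face_in: "w \<in> labelled T \<Longrightarrow> opposite_face w i \<in> faces T"
proof -
  assume w: "w \<in> labelled T"
  have "snd w ` (- {i}) = range (snd w) - {snd w i}" using labelledD(2)[OF w] by (auto dest: injD)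
  moreover have "- {i} \<noteq> {}" by (cases i) auto
  then have "snd w ` (- {i}) \<noteq> {}" by blast
  ultimately have "(convex hull (snd w ` (- {i}))) facet_of (tet T (fst w))"
    unfolding labelledD(5)[OF w] facet_of_convex_hull_affine_independent[OF labelledD(4)[OF w]] by auto
  then show ?thesis using labelledD(1)[OF w] by (simp add: faces_def opposite_face_def)
qed

lemma faces_opposite:
  assumes "f \<in> faces T" "w \<in> labelled T" "fst w = fst f"
  obtains i where "f = opposite_face w i"
proof -
  obtain t F where f: "f = (t, F)" "F facet_of tet T t" using assms(1) by (auto simp: faces_def)
  have "F facet_of (convex hull (range (snd w)))" using f assms(3) labelledD(5)[OF assms(2)] by simp
  then obtain i where "F = convex hull (range (snd w) - {snd w i})"
    unfolding facet_of_convex_hull_affine_independent[OF labelledD(4)[OF assms(2)]] by auto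
  moreover have "range (snd w) - {snd w i} = snd w ` (- {i})" using labelledD(2)[OF assms(2)] by (auto dest: injD)
  ultimately show ?thesis using that[of i] f assms(3) by (simp add: opposite_face_def)
qed

lemma gluing_faceD:
  assumes "f \<in> faces T"
  shows "partner T f \<in> faces T" "partner T f \<noteq> f" "partner T (partner T f) = f"
    "affine_iso (snd f) (snd (partner T f)) (glue T f)"
    "\<And>x. x \<in> snd f \<Longrightarrow> glue T (partner T f) (glue T f x) = x" "orientation_reversing T f"
  using valid assms unfolding valid_gluing_def by blast+

lemma glue_affine:
  assumes "f \<in> faces T"
  obtains L b where "linear L" "\<And>x. x \<in> snd f \<Longrightarrow> glue T f x = L x + b"
  using gluing_faceD(4)[OF assms] unfolding affine_iso_def by blast

text \<open>An affine map commutes with convex hulls, so the images of the three corners span the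
  partner face. The extreme points of that face are among them, and counting to three gives
  equality.\<close>

lemma glue_corners:
  assumes w: "w \<in> labelled T" and w': "w' \<in> labelled T"
    and p: "partner T (opposite_face w i) = opposite_face w' i'"
  shows "glue T (opposite_face w i) ` snd w ` (- {i}) = snd w' ` (- {i'})"
proof -
  let ?f = "opposite_face w i" and ?A = "snd w ` (- {i})" and ?B = "snd w' ` (- {i'})"
  note f = opposite_face_in[OF w, of i]
  obtain L b where L: "linear L" "\<And>x. x \<in> snd ?f \<Longrightarrow> glue T ?f x = L x + b" using glue_affine[OF f] by blast
  have A: "snd ?f = convex hull ?A" "snd (partner T ?f) = convex hull ?B" using p by (auto simp: opposite_face_def)
  have im: "glue T ?f ` S = (\<lambda>x. b + x) ` L ` S" if "S \<subseteq> snd ?f" for S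
    using L(2) that by (force simp: image_image add.commute)
  have "glue T ?f ` (convex hull ?A) = convex hull ?B"
    using gluing_faceD(4)[OF f] A unfolding affine_iso_def bij_betw_def by simp
  moreover have "glue T ?f ` (convex hull ?A) = convex hull (glue T ?f ` ?A)"
    using im[of "convex hull ?A"] im[of ?A] A(1) hull_subset[of ?A convex]
      convex_hull_linear_image[OF L(1), of ?A] convex_hull_translation[of b "L ` ?A"] by simp
  ultimately have h: "convex hull ?B = convex hull (glue T ?f ` ?A)" by simp
  have ind: "\<not> affine_dependent ?B"
    using labelledD(4)[OF w'] affine_dependent_subset[of ?B "range (snd w')"] by auto
  have "?B \<subseteq> glue T ?f ` ?A"
  proof
    fix x assume "x \<in> ?B"
    then have "x extreme_point_of (convex hull ?B)"
      using extreme_point_of_convex_hull_affine_independent[OF ind] by blast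
    then show "x \<in> glue T ?f ` ?A" unfolding h by (rule extreme_point_of_convex_hull)
  qed
  moreover have "card (glue T ?f ` ?A) \<le> card ?B"
  proof -
    have c: "card (snd v ` (- {j})) = 3" if "v \<in> labelled T" for v :: "'i \<times> (corner \<Rightarrow> real^3)" and j
      using card_image[OF inj_on_subset[OF labelledD(2)[OF that], of "- {j}"]]
      by (simp add: card_corner Compl_eq_Diff_UNIV)
    show ?thesis using card_image_le[of ?A "glue T ?f"] c[OF w] c[OF w'] by simp
  qed
  ultimately show ?thesis by (metis card_seteq finite finite_imageI)
qed

lemma adjacent_exists:
  assumes w: "w \<in> labelled T"
  shows "\<exists>w'. adjacent T i w w'"
proof -
  let ?f = "opposite_face w i"
  note f = opposite_face_in[OF w, of i]
  have t': "fst (partner T ?f) \<in> tets T" using gluing_faceD(1)[OF f] by (auto simp: faces_def)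
  obtain c where c: "(fst (partner T ?f), c) \<in> labelled T" using labelled_exists[OF t'] by blast
  let ?v = "(fst (partner T ?f), c)"
  obtain j where j: "partner T ?f = opposite_face ?v j"
    using faces_opposite[OF gluing_faceD(1)[OF f] c] by auto
  have g: "glue T ?f ` snd w ` (- {i}) = c ` (- {j})" using glue_corners[OF w c j] by simp
  \<comment> \<open>The labels are carried over by \<open>glue\<close>; the corner
    \<open>c j\<close> off the partner face receives the remaining label \<open>i\<close>.\<close>
  define c' where "c' = (\<lambda>k. if k = i then c j else glue T ?f (snd w k))"
  have cc: "c' ` (- {i}) = c ` (- {j})" using g by (auto simp: c'_def image_image)
  have ran: "range c' = range c"
  proof -
    have "range c' = insert (c' i) (c' ` (- {i}))" "range c = insert (c j) (c ` (- {j}))" by auto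
    then show ?thesis using cc by (simp add: c'_def)
  qed
  have "inj c'"
  proof (rule eq_card_imp_inj_on)
    have "card (range c) = card (UNIV :: corner set)" using labelledD(2)[OF c] by (simp add: card_image)
    then show "card (range c') = card (UNIV :: corner set)" using ran by simp
  qed simp
  then have "(fst (partner T ?f), c') \<in> labelled T"
    using labelledD(3)[OF c] ran by (intro labelledI t') (simp add: bij_betw_def)
  moreover have "partner T ?f = opposite_face (fst (partner T ?f), c') i"
    using j cc by (simp add: opposite_face_def prod_eq_iff)
  moreover have "\<forall>k. k \<noteq> i \<longrightarrow> c' k = glue T ?f (snd w k)" by (simp add: c'_def)
  ultimately show ?thesis unfolding adjacent_def by (metis snd_conv)
qed

lemma adjacent_unique:
  assumes "adjacent T i w v" "adjacent T i w u"
  shows "v = u"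
proof -
  have v: "v \<in> labelled T" "u \<in> labelled T" and op: "opposite_face v i = opposite_face u i"
    and eq: "\<And>j. j \<noteq> i \<Longrightarrow> snd v j = snd u j"
    using assms unfolding adjacent_def by auto
  have t: "fst v = fst u" using op by (simp add: opposite_face_def)
  have r: "range (snd v) = range (snd u)" using labelledD(3)[OF v(1)] labelledD(3)[OF v(2)] t by simp
  have "snd v i = snd u i"
  proof -
    obtain k where k: "snd v i = snd u k" using r by blast
    show ?thesis
    proof (rule ccontr)
      assume "snd v i \<noteq> snd u i"
      then have "k \<noteq> i" using k by auto
      then have "snd v i = snd v k" using k eq by simp
      then show False using labelledD(2)[OF v(1)] \<open>k \<noteq> i\<close> by (auto dest: injD)
    qed
  qed
  then have "snd v = snd u" using eq by (metis ext)
  then show ?thesis using t by (simp add: prod_eq_iff)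
qed

lemma adjacent_cross: "w \<in> labelled T \<Longrightarrow> adjacent T i w (cross T i w)"
  unfolding cross_def using adjacent_exists adjacent_unique by (metis (mono_tags, lifting) theI')

lemma cross_eqI: "adjacent T i w w' \<Longrightarrow> cross T i w = w'"
  unfolding cross_def using adjacent_unique by blast

lemma cross_in: "w \<in> labelled T \<Longrightarrow> cross T i w \<in> labelled T"
  using adjacent_cross unfolding adjacent_def by blast

lemma corner_in_opposite_face: "j \<noteq> i \<Longrightarrow> snd w j \<in> snd (opposite_face w i)"
  by (auto simp: opposite_face_def intro!: hull_inc)

lemma adjacent_sym:
  assumes w: "w \<in> labelled T" and a: "adjacent T i w w'"
  shows "adjacent T i w' w"
proof -
  note f = opposite_face_in[OF w, of i]
  have p: "partner T (opposite_face w i) = opposite_face w' i" using a by (simp add: adjacent_def)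
  have "snd w j = glue T (opposite_face w' i) (snd w' j)" if "j \<noteq> i" for j
    using a gluing_faceD(5)[OF f corner_in_opposite_face[OF that]] that p unfolding adjacent_def by metis
  then show ?thesis using gluing_faceD(3)[OF f] w p unfolding adjacent_def by simp
qed

lemma cross_cross: "w \<in> labelled T \<Longrightarrow> cross T i (cross T i w) = w"
  using adjacent_sym adjacent_cross cross_eqI by metis

lemma opposite_face_change_labels:
  assumes "bij g" shows "opposite_face (change_labels w g) i = opposite_face w (g i)"
proof -
  have "(snd w \<circ> g) ` (- {i}) = snd w ` (- {g i})"
    using bij_image_Compl_eq[OF assms, of "{i}"] by (simp flip: image_image[of "snd w" g])
  then show ?thesis by (simp add: opposite_face_def change_labels_def)
qed

lemma cross_change_labels:
  assumes w: "w \<in> labelled T" and g: "bij g"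
  shows "cross T i (change_labels w g) = change_labels (cross T (g i) w) g"
proof (rule cross_eqI)
  have "adjacent T (g i) w (cross T (g i) w)" using adjacent_cross[OF w] .
  moreover have "g j \<noteq> g i" if "j \<noteq> i" for j using g that by (simp add: bij_is_inj inj_eq)
  ultimately show "adjacent T i (change_labels w g) (change_labels (cross T (g i) w) g)"
    using change_labels_in[OF cross_in[OF w] g]
    by (auto simp: adjacent_def opposite_face_change_labels[OF g]) (auto simp: change_labels_def)
qed

text \<open>Otherwise the face opposite to \<open>i\<close> would be paired with itself, since
  \<open>g\<close> keeps \<open>i\<close>.\<close>

lemma cross_ne_change_labels:
  assumes w: "w \<in> labelled T" and g: "bij g" "g i = i"
  shows "cross T i w \<noteq> change_labels w g"
proof
  assume "cross T i w = change_labels w g"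
  then have "partner T (opposite_face w i) = opposite_face (change_labels w g) i"
    using adjacent_cross[OF w, of i] by (simp add: adjacent_def)
  then show False
    using gluing_faceD(2)[OF opposite_face_in[OF w, of i]] opposite_face_change_labels[OF g(1), of w i] g(2) by simp
qed

lemma glue_bpoint:
  assumes w: "w \<in> labelled T" and x: "x \<in> bary_simplex" "x $ i = 0"
  shows "bpoint (snd w) x \<in> snd (opposite_face w i)"
    and "glue T (opposite_face w i) (bpoint (snd w) x) = bpoint (snd (cross T i w)) x"
proof -
  note f = opposite_face_in[OF w, of i]
  show b: "bpoint (snd w) x \<in> snd (opposite_face w i)"
    using bpoint_in_convex_hull_iff[OF labelledD(2,4)[OF w] x(1), of "- {i}"] x(2)
    by (simp add: opposite_face_def zeros_def)
  obtain L b where L: "linear L" "\<And>x. x \<in> snd (opposite_face w i) \<Longrightarrow> glue T (opposite_face w i) x = L x + b"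
    using glue_affine[OF f] by blast
  have "glue T (opposite_face w i) (bpoint (snd w) x) = L (bpoint (snd w) x) + b" using L(2) b by blast
  \<comment> \<open>The coordinates add up to 1, so the translation part can be distributed over the
    corners: affine maps keep barycentric coordinates.\<close>
  also have "\<dots> = (\<Sum>j\<in>UNIV. x $ j *\<^sub>R L (snd w j)) + (\<Sum>j\<in>UNIV. x $ j) *\<^sub>R b"
    using x(1) by (simp add: bpoint_def linear_sum[OF L(1)] linear_cmul[OF L(1)] bary_simplex_def)
  also have "\<dots> = (\<Sum>j\<in>UNIV. x $ j *\<^sub>R (L (snd w j) + b))"
    by (simp add: scaleR_add_right sum.distrib scaleR_sum_left)
  also have "\<dots> = (\<Sum>j\<in>UNIV. x $ j *\<^sub>R snd (cross T i w) j)"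
  proof (rule sum.cong[OF refl])
    fix j show "x $ j *\<^sub>R (L (snd w j) + b) = x $ j *\<^sub>R snd (cross T i w) j"
    proof (cases "j = i")
      case False
      then have "snd (cross T i w) j = L (snd w j) + b"
        using adjacent_cross[OF w, of i] L(2)[OF corner_in_opposite_face[OF False]] by (simp add: adjacent_def)
      then show ?thesis by simp
    qed (use x(2) in simp)
  qed
  finally show "glue T (opposite_face w i) (bpoint (snd w) x) = bpoint (snd (cross T i w)) x"
    by (simp add: bpoint_def)
qed

lemma bpoint_in_tet: "w \<in> labelled T \<Longrightarrow> x \<in> bary_simplex \<Longrightarrow> bpoint (snd w) x \<in> tet T (fst w)"
  using bpoint_in_convex_hull_iff[OF labelledD(2,4), of w x UNIV] labelledD(5) by simp

lemma tet_bpoint: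
  assumes "w \<in> labelled T" shows "tet T (fst w) = bpoint (snd w) ` bary_simplex"
  using convex_hull_bpoint[OF labelledD(2)[OF assms], of UNIV] labelledD(5)[OF assms] by simp

lemma glue_rel_step:
  assumes w: "w \<in> labelled T" and x: "x \<in> bary_simplex"
    and r: "((fst w, bpoint (snd w) x), p) \<in> glue_rel T"
  obtains i where "x $ i = 0" "p = (fst (cross T i w), bpoint (snd (cross T i w)) x)"
proof -
  obtain f where f: "f \<in> faces T" "fst w = fst f" "bpoint (snd w) x \<in> snd f"
    "p = (fst (partner T f), glue T f (bpoint (snd w) x))"
    using r unfolding glue_rel_def by auto
  obtain i where i: "f = opposite_face w i" using faces_opposite[OF f(1) w f(2)] by blast
  have xi: "x $ i = 0"
    using f(3) bpoint_in_convex_hull_iff[OF labelledD(2,4)[OF w] x, of "- {i}"]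
    unfolding i by (simp add: opposite_face_def zeros_def)
  have "fst (partner T f) = fst (cross T i w)"
    using adjacent_cross[OF w, of i] unfolding i adjacent_def by (simp add: opposite_face_def)
  then show ?thesis using that[OF xi] f(4) glue_bpoint(2)[OF w x xi] i by simp
qed

lemma glue_rel_sym: "(p, p') \<in> glue_rel T \<Longrightarrow> (p', p) \<in> glue_rel T"
proof -
  assume "(p, p') \<in> glue_rel T"
  then obtain f x where f: "f \<in> faces T" "x \<in> snd f" "p = (fst f, x)" "p' = (fst (partner T f), glue T f x)"
    unfolding glue_rel_def by auto
  note g = gluing_faceD[OF f(1)]
  have "glue T f x \<in> snd (partner T f)" using g(4) f(2) unfolding affine_iso_def by (meson bij_betwE)
  moreover have "p = (fst (partner T (partner T f)), glue T (partner T f) (glue T f x))"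
    using g(3,5) f by simp
  ultimately show ?thesis using g(1) f(4) unfolding glue_rel_def by blast
qed

text \<open>Barycentric coordinates never change along a chain of identifications. So the faces used
  at each step carry labels from the same set \<open>zeros x\<close>, and the chain is a chain of
  crossings.\<close>

lemma glue_rel_orb:
  assumes w: "w \<in> labelled T" and x: "x \<in> bary_simplex"
    and r: "((fst w, bpoint (snd w) x), p) \<in> (glue_rel T \<union> (glue_rel T)\<inverse>)\<^sup>*"
  shows "\<exists>w'\<in>orb (cross T) (zeros x) w. w' \<in> labelled T \<and> p = (fst w', bpoint (snd w') x)"
  using r
proof (induction rule: rtrancl_induct)
  case base
  show ?case by (intro bexI[OF _ orb_base]) (use w in simp)
next
  case (step y z)
  then obtain w' where w': "w' \<in> orb (cross T) (zeros x) w" "w' \<in> labelled T" "y = (fst w', bpoint (snd w') x)"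
    by blast
  have "(y, z) \<in> glue_rel T" using step.hyps(2) glue_rel_sym by blast
  then obtain i where "x $ i = 0" "z = (fst (cross T i w'), bpoint (snd (cross T i w')) x)"
    using glue_rel_step[OF w'(2) x] w'(3) by blast
  then show ?case using orb_step[OF w'(1), of i] cross_in[OF w'(2)] by (auto simp: zeros_def)
qed

end

section \<open>The labelled complex of a triangulation\<close>

definition simplex_det :: "real^3 \<Rightarrow> real^3 \<Rightarrow> real^3 \<Rightarrow> real^3 \<Rightarrow> real" where
  "simplex_det a u v w = det (vector [u - a, v - a, w - a] :: real^3^3)"

lemma simplex_det_boundary: "det (vector [u - a, v - u, w - u] :: real^3^3) = simplex_det a u v w"
  unfolding simplex_det_def by (simp add: det_3 algebra_simps)

lemma simplex_det_swap:
  "simplex_det u a v w = - simplex_det a u v w"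
  "simplex_det v u a w = - simplex_det a u v w"
  "simplex_det w u v a = - simplex_det a u v w"
  "simplex_det a v u w = - simplex_det a u v w"
  "simplex_det a w v u = - simplex_det a u v w"
  "simplex_det a u w v = - simplex_det a u v w"
  unfolding simplex_det_def by (simp_all add: det_3 algebra_simps)

lemma simplex_det_nonzero:
  fixes c :: "corner \<Rightarrow> real^3"
  assumes c: "inj c" "\<not> affine_dependent (range c)"
  shows "simplex_det (c C0) (c C1) (c C2) (c C3) \<noteq> 0"
proof
  assume "simplex_det (c C0) (c C1) (c C2) (c C3) = 0"
  then have "\<not> invertible (vector [c C1 - c C0, c C2 - c C0, c C3 - c C0] :: real^3^3)"
    unfolding simplex_det_def by (simp add: invertible_det_nz)
  then obtain k i where k: "(\<Sum>m\<in>UNIV. k m *s row m (vector [c C1 - c C0, c C2 - c C0, c C3 - c C0] :: real^3^3)) = 0"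
    "k i \<noteq> 0"
    unfolding invertible_right_inverse matrix_right_invertible_independent_rows by blast
  have "k 1 *\<^sub>R (c C1 - c C0) + k 2 *\<^sub>R (c C2 - c C0) + k 3 *\<^sub>R (c C3 - c C0) = 0"
    using k(1) by (simp add: sum_3 row_def vec_lambda_eta scalar_mult_eq_scaleR)
  then have zero: "(- k 1 - k 2 - k 3) *\<^sub>R c C0 + k 1 *\<^sub>R c C1 + k 2 *\<^sub>R c C2 + k 3 *\<^sub>R c C3 = 0"
    by (simp add: algebra_simps)
  \<comment> \<open>The coefficient at \<open>C0\<close> makes the sum zero: a linear relation
    between the edge vectors at \<open>c C0\<close> becomes an affine one between the
    corners.\<close>
  define z where "z = case_corner (- k 1 - k 2 - k 3) (k 1) (k 2) (k 3)"
  define u where "u = (\<lambda>v. z (pinv c v))"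
  have uc: "u (c j) = z j" for j using c(1) by (simp add: u_def)
  have "sum u (range c) = 0"
    using sum.reindex[OF c(1), of u] by (simp add: uc UNIV_corner z_def)
  moreover have "(\<Sum>v\<in>range c. u v *\<^sub>R v) = 0"
    using sum.reindex[OF c(1), of "\<lambda>v. u v *\<^sub>R v"] zero
    by (simp add: uc) (simp add: UNIV_corner z_def add.assoc)
  moreover have "\<exists>v\<in>range c. u v \<noteq> 0"
  proof -
    have "i = 1 \<or> i = 2 \<or> i = 3" using exhaust_3 by blast
    then have "z C1 \<noteq> 0 \<or> z C2 \<noteq> 0 \<or> z C3 \<noteq> 0" using k(2) by (auto simp: z_def)
    then show ?thesis using uc by (metis rangeI)
  qed
  ultimately have "\<exists>U. sum U (range c) = 0 \<and> (\<exists>v\<in>range c. U v \<noteq> 0) \<and> (\<Sum>v\<in>range c. U v *\<^sub>R v) = 0"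
    by (intro exI[of _ u]) blast
  then have "affine_dependent (range c)"
    by (subst affine_dependent_explicit_finite) simp_all
  then show False using c(2) by blast
qed

definition orient :: "'i gluing \<Rightarrow> 'i \<times> (corner \<Rightarrow> real^3) \<Rightarrow> real" where
  "orient T w = ori T (fst w) * sgn (simplex_det (snd w C0) (snd w C1) (snd w C2) (snd w C3))"

lemma orient_transpose:
  assumes "i \<noteq> j"
  shows "orient T (change_labels w (Transposition.transpose i j)) = - orient T w"
  using assms simplex_det_swap[where a = "snd w C0" and u = "snd w C1" and v = "snd w C2" and w = "snd w C3"]
  by (cases i; cases j) (simp_all add: orient_def change_labels_def Transposition.transpose_def sgn_minus)

lemma other_corners:
  assumes "k \<noteq> l"
  obtains i j where "distinct [i, j, k, l]" "(UNIV :: corner set) = {i, j, k, l}"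
proof -
  have "\<exists>i j. distinct [i, j, k, l] \<and> (UNIV :: corner set) = {i, j, k, l}"
  proof -
    have "card (- {k, l}) = 2" using assms by (simp add: card_corner Compl_eq_Diff_UNIV card_Diff_subset)
    then obtain i j where "- {k, l} = {i, j}" "i \<noteq> j" unfolding card_2_iff by blast
    then have "i \<notin> {k, l}" "j \<notin> {k, l}" "UNIV = {i, j} \<union> {k, l}" "i \<noteq> j" by blast+
    then show ?thesis using assms by (intro exI[of _ i] exI[of _ j]) (simp add: insert_commute)
  qed
  then show ?thesis using that by blast
qed

text \<open>Lists what transport around the edge between the corners \<open>i\<close> and
  \<open>j\<close> could do to labels: it keeps the pair of labels off the edge.\<close>

lemma pair_preserving_perm:
  fixes g :: "corner \<Rightarrow> corner"
  assumes d: "distinct [i, j, k, l]" "(UNIV :: corner set) = {i, j, k, l}"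
    and g: "bij g" "\<And>m. g m \<in> {k, l} \<longleftrightarrow> m \<in> {k, l}"
  shows "g \<in> {id, Transposition.transpose k l, Transposition.transpose i j,
    Transposition.transpose i j \<circ> Transposition.transpose k l}"
proof -
  have ex: "f = h" if "f i = h i" "f j = h j" "f k = h k" "f l = h l" for f h :: "corner \<Rightarrow> corner"
  proof
    fix m have "m \<in> {i, j, k, l}" using d(2) by blast
    then show "f m = h m" using that by auto
  qed
  have "g k \<in> {k, l}" "g l \<in> {k, l}" "g k \<noteq> g l" "g i \<noteq> g j" "g i \<notin> {k, l}" "g j \<notin> {k, l}"
    using g d(1) by (auto simp: bij_is_inj inj_eq)
  moreover have "g i \<in> {i, j, k, l}" "g j \<in> {i, j, k, l}" using d(2) by blast+
  ultimately consider "g k = k" "g l = l" "g i = i" "g j = j" | "g k = l" "g l = k" "g i = i" "g j = j"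
    | "g k = k" "g l = l" "g i = j" "g j = i" | "g k = l" "g l = k" "g i = j" "g j = i" by auto
  then show ?thesis
  proof cases
    case 1 then have "g = id" by (intro ex) auto
    then show ?thesis by blast
  next
    case 2 then have "g = Transposition.transpose k l" using d(1) by (intro ex) auto
    then show ?thesis by blast
  next
    case 3 then have "g = Transposition.transpose i j" using d(1) by (intro ex) auto
    then show ?thesis by blast
  next
    case 4 then have "g = Transposition.transpose i j \<circ> Transposition.transpose k l"
      using d(1) by (intro ex) auto
    then show ?thesis by blast
  qed
qed

lemma zeros_axis: "zeros (axis i (1::real)) = - {i}"
  by (auto simp: zeros_def axis_def)

lemma zeros_nonvertex:
  fixes x :: "real ^ corner"
  assumes x: "x \<in> bary_simplex" "\<forall>k. x \<noteq> axis k 1"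
  obtains "zeros x = {}" | i where "zeros x = {i}" | k l where "k \<noteq> l" "zeros x = {k, l}"
proof -
  have s: "(\<Sum>i\<in>UNIV. x $ i) = 1" using x(1) by (simp add: bary_simplex_def)
  have sum: "(\<Sum>i\<in>- zeros x. x $ i) = 1"
    unfolding s[symmetric] by (rule sum.mono_neutral_left) (auto simp: zeros_def)
  have c0: "card (- zeros x) \<noteq> 0" using sum by auto
  have c1: "card (- zeros x) \<noteq> 1"
  proof
    assume "card (- zeros x) = 1"
    then obtain k where k: "- zeros x = {k}" by (auto simp: card_1_singleton_iff)
    then have "x $ k = 1" using sum by simp
    moreover have "x $ i = 0" if "i \<noteq> k" for i using k that by (auto simp: zeros_def)
    ultimately have "x = axis k 1" by (auto simp: vec_eq_iff axis_def)
    then show False using x(2) by blast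
  qed
  have "card (- zeros x) + card (zeros x) = 4"
    using card_Un_disjoint[of "- zeros x" "zeros x"] by (simp add: card_corner Compl_partition2)
  then have "card (zeros x) = 0 \<or> card (zeros x) = 1 \<or> card (zeros x) = 2" using c0 c1 by linarith
  then show ?thesis
  proof (elim disjE)
    assume "card (zeros x) = 0"
    then have "zeros x = {}" by simp
    then show ?thesis by (rule that(1))
  next
    assume "card (zeros x) = 1"
    then obtain i where "zeros x = {i}" by (rule card_1_singletonE)
    then show ?thesis by (rule that(2))
  next
    assume "card (zeros x) = 2"
    then obtain k l where "zeros x = {k, l}" "k \<noteq> l" unfolding card_2_iff by blast
    then show ?thesis using that(3) by blast
  qed
qed

context gluing_data
begin

lemma orientation_reversingD:
  assumes "orientation_reversing T f" "a \<in> tet T (fst f) - snd f"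
    "a' \<in> tet T (fst (partner T f)) - snd (partner T f)" "u \<in> snd f" "v \<in> snd f" "w \<in> snd f"
  shows "boundary_orientation T (fst (partner T f)) a' (glue T f u) (glue T f v) (glue T f w)
    = - boundary_orientation T (fst f) a u v w"
  using assms unfolding orientation_reversing_def by blast

lemma orient_nonzero: "w \<in> labelled T \<Longrightarrow> orient T w \<noteq> 0"
proof -
  assume w: "w \<in> labelled T"
  have "ori T (fst w) \<in> {1, -1}" using valid labelledD(1)[OF w] unfolding valid_gluing_def by blast
  then have "ori T (fst w) \<noteq> 0" by auto
  then show ?thesis
    using simplex_det_nonzero[OF labelledD(2,4)[OF w]] by (simp add: orient_def sgn_zero_iff)
qed

text \<open>Crossing keeps the labels on the common face, whose boundary orientation
  \<open>glue\<close> reverses; and the boundary orientation of a face is the orientation of the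
  simplex with the corner off the face put first.\<close>

lemma orient_cross:
  assumes w: "w \<in> labelled T" shows "orient T (cross T i w) = - orient T w"
proof -
  let ?w' = "cross T i w" and ?f = "opposite_face w i"
  have a: "adjacent T i w ?w'" using adjacent_cross[OF w] .
  then have w': "?w' \<in> labelled T" and p: "partner T ?f = opposite_face ?w' i" by (auto simp: adjacent_def)
  have off: "snd v i \<in> tet T (fst v) - snd (opposite_face v i)" if "v \<in> labelled T" for v
  proof -
    have "snd v i \<notin> convex hull (snd v ` (- {i}))"
      using bpoint_in_convex_hull_iff[OF labelledD(2,4)[OF that] axis_in_bary_simplex, of i "- {i}"]
      by (simp add: bpoint_axis zeros_axis)
    then show ?thesis
      using labelledD(5)[OF that] hull_subset[of "range (snd v)" convex] by (auto simp: opposite_face_def)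
  qed
  have rev: "ori T (fst ?w') * sgn (simplex_det (snd ?w' i) (snd ?w' j) (snd ?w' k) (snd ?w' l))
      = - (ori T (fst w) * sgn (simplex_det (snd w i) (snd w j) (snd w k) (snd w l)))"
    if "j \<noteq> i" "k \<noteq> i" "l \<noteq> i" for j k l
  proof -
    have f: "fst ?f = fst w" "fst (partner T ?f) = fst ?w'" unfolding p by (auto simp: opposite_face_def)
    have "snd w i \<in> tet T (fst ?f) - snd ?f" "snd ?w' i \<in> tet T (fst (partner T ?f)) - snd (partner T ?f)"
      using off[OF w] off[OF w'] f p by simp_all
    then have "boundary_orientation T (fst (partner T ?f)) (snd ?w' i) (glue T ?f (snd w j)) (glue T ?f (snd w k))
        (glue T ?f (snd w l)) = - boundary_orientation T (fst ?f) (snd w i) (snd w j) (snd w k) (snd w l)"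
      by (rule orientation_reversingD[OF gluing_faceD(6)[OF opposite_face_in[OF w, of i]]])
        (intro corner_in_opposite_face that)+
    moreover have "glue T ?f (snd w m) = snd ?w' m" if "m \<noteq> i" for m
      using a that by (simp add: adjacent_def)
    ultimately show ?thesis using that by (simp add: boundary_orientation_def simplex_det_boundary f)
  qed
  \<comment> \<open>The corner \<open>i\<close> has to be moved to the front. The other corners are
    ordered so that this takes at most one swap, the same in both simplices.\<close>
  show ?thesis
  proof (cases i)
    case C0 then show ?thesis using rev[of C1 C2 C3] by (simp add: orient_def)
  next
    case C1 then show ?thesis using rev[of C0 C2 C3]
        simplex_det_swap(1)[of "snd w C1" "snd w C0"] simplex_det_swap(1)[of "snd ?w' C1" "snd ?w' C0"]
      by (simp add: orient_def sgn_minus)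
  next
    case C2 then show ?thesis using rev[of C1 C0 C3]
        simplex_det_swap(2)[of "snd w C2" "snd w C1" "snd w C0"]
        simplex_det_swap(2)[of "snd ?w' C2" "snd ?w' C1" "snd ?w' C0"]
      by (simp add: orient_def sgn_minus)
  next
    case C3 then show ?thesis using rev[of C1 C2 C0]
        simplex_det_swap(3)[of "snd w C3" "snd w C1" "snd w C2" "snd w C0"]
        simplex_det_swap(3)[of "snd ?w' C3" "snd ?w' C1" "snd ?w' C2" "snd ?w' C0"]
      by (simp add: orient_def sgn_minus)
  qed
qed

lemma tet_edges_labelled:
  assumes w: "w \<in> labelled T"
  shows "(fst w, E) \<in> tet_edges T \<longleftrightarrow> (\<exists>i j. i \<noteq> j \<and> E = convex hull {snd w i, snd w j})"
proof
  have ind: "\<not> affine_dependent S" if "S \<subseteq> range (snd w)" for S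
    using affine_dependent_subset[OF _ that] labelledD(4)[OF w] by blast
  have dim: "aff_dim (convex hull S) = int (card S) - 1" if "S \<subseteq> range (snd w)" for S
    using aff_dim_affine_independent[OF ind[OF that]] by (simp add: aff_dim_convex_hull)
  {
    assume "(fst w, E) \<in> tet_edges T"
    then have E: "E face_of (convex hull (range (snd w)))" "aff_dim E = 1"
      using labelledD(5)[OF w] by (auto simp: tet_edges_def edge_of_def)
    then obtain S where S: "S \<subseteq> range (snd w)" "E = convex hull S"
      using face_of_convex_hull_affine_independent[OF labelledD(4)[OF w]] by blast
    then have "card S = 2" using dim[OF S(1)] E(2) by simp
    then obtain u v where "S = {u, v}" "u \<noteq> v" unfolding card_2_iff by blast
    then obtain i j where "u = snd w i" "v = snd w j" using S(1) by auto
    then show "\<exists>i j. i \<noteq> j \<and> E = convex hull {snd w i, snd w j}"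
      using S(2) \<open>S = {u, v}\<close> \<open>u \<noteq> v\<close> by (intro exI[of _ i] exI[of _ j]) auto
  }
  assume "\<exists>i j. i \<noteq> j \<and> E = convex hull {snd w i, snd w j}"
  then obtain i j where ij: "i \<noteq> j" "E = convex hull {snd w i, snd w j}" by blast
  have sub: "{snd w i, snd w j} \<subseteq> range (snd w)" by blast
  have "E face_of (convex hull (range (snd w)))"
    using face_of_convex_hull_affine_independent[OF labelledD(4)[OF w]] sub ij(2) by blast
  moreover have "snd w i \<noteq> snd w j" using labelledD(2)[OF w] ij(1) by (auto dest: injD)
  then have "aff_dim E = 1" using dim[OF sub] ij(2) by simp
  ultimately show "(fst w, E) \<in> tet_edges T"
    using labelledD(1,5)[OF w] by (simp add: tet_edges_def edge_of_def)
qed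

lemma edge_hull_eq_iff:
  assumes w: "w \<in> labelled T"
  shows "convex hull (snd w ` A) = convex hull (snd w ` B) \<longleftrightarrow> A = B"
proof
  assume eq: "convex hull (snd w ` A) = convex hull (snd w ` B)"
  have ind: "\<not> affine_dependent (snd w ` S)" for S
    using affine_dependent_subset[of "snd w ` S" "range (snd w)"] labelledD(4)[OF w] by blast
  have "snd w ` S = {x. x extreme_point_of (convex hull (snd w ` S))}" for S
    using extreme_point_of_convex_hull_affine_independent[OF ind[of S]] by simp
  then have "snd w ` A = snd w ` B" using eq by metis
  then show "A = B" using labelledD(2)[OF w] by (simp add: inj_image_eq_iff)
qed simp

end

section \<open>Characteristic maps of a triangulation\<close>

locale triangulated = gluing_data T for T :: "'i gluing" +
  fixes M :: "'a::topological_space set" and q :: "'i \<times> (real^3) \<Rightarrow> 'a"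
  assumes tri: "triangulation T q M"
begin

lemma quotient: "quotient_map (tet_space T) (top_of_set M) q"
  using tri unfolding triangulation_def by blast

lemma topspace_tet_space: "topspace (tet_space T) = Sigma (tets T) (tet T)"
  by (simp add: tet_space_def o_def)

lemma q_image: "q ` Sigma (tets T) (tet T) = M"
  using quotient_imp_surjective_map[OF quotient] topspace_tet_space by simp

lemma q_eq_iff:
  "y \<in> Sigma (tets T) (tet T) \<Longrightarrow> z \<in> Sigma (tets T) (tet T) \<Longrightarrow>
    q y = q z \<longleftrightarrow> (y, z) \<in> (glue_rel T \<union> (glue_rel T)\<inverse>)\<^sup>*"
  using tri unfolding triangulation_def topspace_tet_space by blast

lemma labelled_point_in:
  "w \<in> labelled T \<Longrightarrow> x \<in> bary_simplex \<Longrightarrow> (fst w, bpoint (snd w) x) \<in> Sigma (tets T) (tet T)"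
  using labelledD(1) bpoint_in_tet by auto

lemma char_map_in: "w \<in> labelled T \<Longrightarrow> x \<in> bary_simplex \<Longrightarrow> char_map q w x \<in> M"
  using q_image labelled_point_in unfolding char_map_def by blast

lemma char_map_continuous:
  assumes w: "w \<in> labelled T" shows "continuous_on bary_simplex (char_map q w)"
proof -
  have "continuous_map (top_of_set bary_simplex) (top_of_set (tet T (fst w))) (bpoint (snd w))"
    using bpoint_in_tet[OF w] continuous_on_bpoint by auto
  moreover have "continuous_map (top_of_set (tet T (fst w))) (tet_space T) (\<lambda>y. (fst w, y))"
    unfolding tet_space_def
    using continuous_map_component_injection[OF labelledD(1)[OF w], of "\<lambda>t. top_of_set (tet T t)"] .
  ultimately have "continuous_map (top_of_set bary_simplex) (top_of_set M)
      (q \<circ> ((\<lambda>y. (fst w, y)) \<circ> bpoint (snd w)))"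
    using quotient_imp_continuous_map[OF quotient] by (intro continuous_map_compose)
  moreover have "q \<circ> ((\<lambda>y. (fst w, y)) \<circ> bpoint (snd w)) = char_map q w"
    by (auto simp: char_map_def)
  ultimately show ?thesis by simp
qed

text \<open>\<open>M\<close> is a quotient of the simplices themselves. Openness passes from
  coordinates to a simplex because \<open>bpoint\<close> is injective and closed on the compact
  \<open>bary_simplex\<close>.\<close>

lemma char_map_open:
  assumes U: "U \<subseteq> M"
    and o: "\<And>w. w \<in> labelled T \<Longrightarrow> openin (top_of_set bary_simplex) {x \<in> bary_simplex. char_map q w x \<in> U}"
  shows "openin (top_of_set M) U"
proof -
  let ?P = "{y \<in> topspace (tet_space T). q y \<in> U}"
  have "openin (top_of_set (tet T t)) {y. (t, y) \<in> ?P}" if t: "t \<in> tets T" for t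
  proof -
    obtain c where c: "(t, c) \<in> labelled T" using labelled_exists[OF t] .
    let ?C = "bary_simplex - {x \<in> bary_simplex. char_map q (t, c) x \<in> U}"
    have tet: "tet T t = bpoint c ` bary_simplex" using tet_bpoint[OF c] by simp
    have "closedin (top_of_set bary_simplex) ?C" using o[OF c] by auto
    then have "compact ?C" using compact_bary_simplex closedin_compact by blast
    then have "closed (bpoint c ` ?C)"
      using compact_continuous_image[OF continuous_on_bpoint] compact_imp_closed by blast
    then have cl: "closedin (top_of_set (tet T t)) (bpoint c ` ?C)"
      unfolding tet by (intro closed_subset) auto
    have "q (t, bpoint c x) \<in> U \<longleftrightarrow> bpoint c x \<notin> bpoint c ` ?C" if "x \<in> bary_simplex" for x
      using that bpoint_inj[of c] labelledD(2,4)[OF c] by (auto simp: char_map_def)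
    then have "q (t, y) \<in> U \<longleftrightarrow> y \<notin> bpoint c ` ?C" if "y \<in> tet T t" for y
      using that unfolding tet by (elim imageE) simp
    then have "{y. (t, y) \<in> ?P} = tet T t - bpoint c ` ?C"
      using t unfolding topspace_tet_space by auto
    then show ?thesis using openin_diff[OF openin_subtopology_self cl] by simp
  qed
  then have "openin (tet_space T) ?P"
    unfolding tet_space_def openin_sum_topology by (auto simp: o_def)
  then show ?thesis using quotient U unfolding quotient_map_def by simp
qed

lemma char_map_cross:
  assumes w: "w \<in> labelled T" and x: "x \<in> bary_simplex" "x $ i = 0"
  shows "char_map q (cross T i w) x = char_map q w x"
proof -
  let ?f = "opposite_face w i"
  have "fst (partner T ?f) = fst (cross T i w)" "fst ?f = fst w"
    using adjacent_cross[OF w, of i] unfolding adjacent_def by (simp_all add: opposite_face_def)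
  then have "((fst w, bpoint (snd w) x), (fst (cross T i w), bpoint (snd (cross T i w)) x)) \<in> glue_rel T"
    using glue_bpoint[OF w x] opposite_face_in[OF w, of i] unfolding glue_rel_def
    by (intro CollectI exI[of _ ?f] exI[of _ "bpoint (snd w) x"]) simp
  then show ?thesis
    using q_eq_iff[OF labelled_point_in[OF w x(1)] labelled_point_in[OF cross_in[OF w] x(1)]]
    unfolding char_map_def by (metis UnI1 r_into_rtrancl)
qed

text \<open>The chain of identifications leads from \<open>w\<close> to a labelled simplex
  \<open>v\<close> with the same coordinates; \<open>v\<close> and \<open>w'\<close> are two
  labellings of one simplex and describe the same point of it.\<close>

lemma char_map_eq:
  assumes w: "w \<in> labelled T" and w': "w' \<in> labelled T" and x: "x \<in> bary_simplex" "x' \<in> bary_simplex"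
    and eq: "char_map q w x = char_map q w' x'"
  shows "\<exists>g. bij g \<and> change_labels w' g \<in> orb (cross T) (zeros x) w \<and> x = relabel x' g"
proof -
  have "((fst w, bpoint (snd w) x), (fst w', bpoint (snd w') x')) \<in> (glue_rel T \<union> (glue_rel T)\<inverse>)\<^sup>*"
    using q_eq_iff[OF labelled_point_in[OF w x(1)] labelled_point_in[OF w' x(2)]] eq
    unfolding char_map_def by blast
  then obtain v where v: "v \<in> orb (cross T) (zeros x) w" "v \<in> labelled T"
    "fst w' = fst v" "bpoint (snd w') x' = bpoint (snd v) x"
    using glue_rel_orb[OF w x(1)] by force
  obtain g where g: "bij g" "v = change_labels w' g" using same_simplex_change_labels[OF w' v(2,3)] .
  have "bpoint (snd v) (relabel x' g) = bpoint (snd w') x'"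
    using bpoint_comp[OF g(1)] g(2) by (simp add: change_labels_def)
  then have "relabel x' g = x"
    using bpoint_inj[OF labelledD(2,4)[OF v(2)] relabel_in_bary_simplex[OF g(1) x(2)] x(1)] v(4) by simp
  then show ?thesis using g v(1) by blast
qed

sublocale labelled_complex M "labelled T" "cross T" change_labels "char_map q"
proof
  show "change_labels w g = w \<Longrightarrow> w \<in> labelled T \<Longrightarrow> g = id" for w g
    using labelledD(2)[of w] by (auto simp: change_labels_def prod_eq_iff fun_eq_iff dest: injD)
  show "\<exists>w\<in>labelled T. \<exists>x\<in>bary_simplex. z = char_map q w x" if z: "z \<in> M" for z
  proof -
    obtain t y where t: "t \<in> tets T" "y \<in> tet T t" "z = q (t, y)"
      using z unfolding q_image[symmetric] by auto
    obtain c where c: "(t, c) \<in> labelled T" using labelled_exists[OF t(1)] .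
    then obtain x where "x \<in> bary_simplex" "y = bpoint c x" using tet_bpoint[OF c] t(2) by auto
    then show ?thesis using c t(3) by (force simp: char_map_def)
  qed
  show "char_map q (change_labels w g) (relabel x g) = char_map q w x"
    if "bij g" for w g x
    using bpoint_comp[OF that] by (simp add: char_map_def change_labels_def)
  show "change_labels (change_labels w g) h = change_labels w (g \<circ> h)" "change_labels w id = w" for w g h
    by (simp_all add: change_labels_def comp_assoc)
qed (auto simp: finite_labelled cross_in cross_cross change_labels_in cross_change_labels
    char_map_continuous char_map_in char_map_cross intro: char_map_eq char_map_open)

end

section \<open>Even edges and the theorem\<close>

context triangulated
begin

lemma good_interior:
  assumes "w \<in> labelled T" "zeros x = {}" shows "good w x"
  unfolding good_def assms(2) orb_empty using act_free[OF assms(1)] by blast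

text \<open>Only \<open>w\<close> and its neighbour across the face lie around such a point, and
  \<open>g\<close> fixes \<open>i\<close>; so the neighbour is ruled out because no face is paired
  with itself.\<close>

lemma good_face:
  assumes w: "w \<in> labelled T" and x: "zeros x = {i}" shows "good w x"
  unfolding good_def
proof (intro allI impI)
  fix g assume g: "bij g" "change_labels w g \<in> orb (cross T) (zeros x) w" "relabel x g = x"
  have "v \<in> {w, cross T i w}" if "v \<in> orb (cross T) {i} w" for v
    using that by induction (use cross_cross[OF w] in auto)
  then have "change_labels w g = w \<or> change_labels w g = cross T i w" using g(2) x by auto
  moreover have "g -` {i} = {i}" using zeros_relabel[of x g] g(3) x by simp
  then have "g i = i" by blast
  ultimately show "g = id" using act_free[OF w] cross_ne_change_labels[OF w g(1)] by metis
qed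

text \<open>As crossings are involutions, crossing \<open>k\<close> or \<open>l\<close> from a step
  of the walk leads one step forwards or backwards, so the orbit contains nothing else.\<close>

lemma alternating_range:
  assumes w: "w \<in> labelled T" and W: "alternating (labelled T) (cross T k) (cross T l) W" "W 0 = w"
  shows "range W = orb (cross T) {k, l} w"
proof
  have next_W: "W (j + 1) = (if even j then cross T k else cross T l) (W j)" for j using alternatingD[OF W(1)] by blast
  have prev_W: "W (j - 1) = (if even j then cross T l else cross T k) (W j)" for j
    using alternating_prev[OF W(1)] cross_cross by blast
  have "W j \<in> orb (cross T) {k, l} w" for j
  proof (induction j rule: int_induct[where k = 0])
    case base show ?case using W(2) orb_base by metis
  next
    case (step1 i) then show ?case unfolding next_W by (auto intro: orb_step)
  next
    case (step2 i) then show ?case unfolding prev_W by (auto intro: orb_step)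
  qed
  then show "range W \<subseteq> orb (cross T) {k, l} w" by blast
  show "orb (cross T) {k, l} w \<subseteq> range W"
  proof
    fix v assume "v \<in> orb (cross T) {k, l} w"
    then show "v \<in> range W"
    proof induction
      case orb_base show ?case using W(2) by blast
    next
      case (orb_step v m)
      then obtain j where v: "v = W j" by blast
      have "cross T m v = W (j + 1) \<or> cross T m v = W (j - 1)"
        using orb_step(2) next_W[of j] prev_W[of j] unfolding v by (auto split: if_splits)
      then show ?case by blast
    qed
  qed
qed

lemma edge_image_hull:
  assumes v: "v \<in> labelled T" and U: "(UNIV :: corner set) = {i, j, k, l}" "distinct [i, j, k, l]"
  shows "edge_image q (fst v, convex hull {snd v i, snd v j}) =
    char_map q v ` {y \<in> bary_simplex. {k, l} \<subseteq> zeros y}"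
proof -
  have "- {i, j} = {k, l}" using U by auto
  then have "convex hull {snd v i, snd v j} = bpoint (snd v) ` {y \<in> bary_simplex. {k, l} \<subseteq> zeros y}"
    using convex_hull_bpoint[OF labelledD(2)[OF v], of "{i, j}"] by simp
  then show ?thesis by (force simp: edge_image_def char_map_def)
qed

text \<open>Prepares for \<open>even_walk_no_return\<close>; the geometric part is a count, namely
  that the degree of the edge is the number of simplex edges passed by the walk.\<close>

lemma good_edge:
  assumes even: "\<forall>e\<in>triangulation_edges T q. even (edge_degree T q e)"
    and w: "w \<in> labelled T" and kl: "k \<noteq> l" and x: "zeros x = {k, l}"
  shows "good w x"
proof -
  obtain i j where U: "distinct [i, j, k, l]" "(UNIV :: corner set) = {i, j, k, l}"
    using other_corners[OF kl] .
  have ij: "- {k, l} = {i, j}" "- {i, j} = {k, l}" using U by auto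
  \<comment> \<open>The coordinates of \<open>k\<close> and \<open>l\<close> vanish, so the edge
    joins the corners \<open>i\<close> and \<open>j\<close>: \<open>\<tau>\<close> swaps the corners
    off the edge and \<open>\<sigma>\<close> reverses the edge.\<close>
  define \<tau> where "\<tau> = Transposition.transpose k l"
  define \<sigma> where "\<sigma> = Transposition.transpose i j"
  have bij: "bij \<tau>" "bij \<sigma>" by (simp_all add: \<tau>_def \<sigma>_def)
  have \<tau>: "\<tau> k = l" "\<tau> l = k" "\<tau> i = i" "\<tau> j = j" using U(1) by (auto simp: \<tau>_def)
  have \<sigma>: "\<sigma> k = k" "\<sigma> l = l" "\<sigma> i = j" "\<sigma> j = i" using U(1) by (auto simp: \<sigma>_def)
  define s where "s = (\<lambda>v :: 'i \<times> (corner \<Rightarrow> real^3). change_labels v \<tau>)"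
  define r where "r = (\<lambda>v :: 'i \<times> (corner \<Rightarrow> real^3). change_labels v \<sigma>)"
  define ed where "ed = (\<lambda>v :: 'i \<times> (corner \<Rightarrow> real^3). (fst v, convex hull (snd v ` {i, j})))"
  obtain W where W: "alternating (labelled T) (cross T k) (cross T l) W" "W 0 = w"
    using alternating_exists[of w "labelled T" "cross T k" "cross T l"] w cross_in cross_cross by metis
  have rW: "range W = orb (cross T) {k, l} w" by (rule alternating_range[OF w W])
  have WL: "W n \<in> labelled T" for n using alternatingD(1)[OF W(1)] .
  have perm: "g \<in> {id, \<tau>, \<sigma>, \<sigma> \<circ> \<tau>}" if "bij g" "\<And>m. g m \<in> {k, l} \<longleftrightarrow> m \<in> {k, l}" for g
    using pair_preserving_perm[OF U that] unfolding \<tau>_def \<sigma>_def .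
  have apply_perm: "change_labels v g \<in> {v, s v, r v, s (r v)}" if "g \<in> {id, \<tau>, \<sigma>, \<sigma> \<circ> \<tau>}" for v g
    using that by (auto simp: s_def r_def act_id act_act)
  have ed_iff: "ed v = ed v' \<longleftrightarrow> v' \<in> {v, s v, r v, s (r v)}"
    if v: "v \<in> labelled T" "v' \<in> labelled T" for v v'
  proof
    assume eq: "ed v = ed v'"
    then obtain g where g: "bij g" "v' = change_labels v g"
      using same_simplex_change_labels[OF v] unfolding ed_def by auto
    have "snd v' ` {i, j} = snd v ` g ` {i, j}" unfolding g(2) by (auto simp: change_labels_def)
    then have "convex hull (snd v ` {i, j}) = convex hull (snd v ` g ` {i, j})"
      using eq by (simp only: ed_def prod.inject)
    then have "{i, j} = g ` {i, j}" unfolding edge_hull_eq_iff[OF v(1)] .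
    then have "g ` (- {i, j}) = - {i, j}" using bij_image_Compl_eq[OF g(1), of "{i, j}"] by metis
    then have "g ` {k, l} = {k, l}" unfolding ij .
    then have "g m \<in> {k, l} \<longleftrightarrow> m \<in> {k, l}" for m
      using inj_image_mem_iff[OF bij_is_inj[OF g(1)], of m "{k, l}"] by simp
    then show "v' \<in> {v, s v, r v, s (r v)}" using apply_perm[OF perm[OF g(1)]] g(2) by blast
  next
    assume "v' \<in> {v, s v, r v, s (r v)}"
    then show "ed v = ed v'" by (auto simp: ed_def s_def r_def change_labels_def \<tau> \<sigma> insert_commute)
  qed
  have edge_im: "edge_image q (ed v) = char_map q v ` {y \<in> bary_simplex. {k, l} \<subseteq> zeros y}"
    if "v \<in> labelled T" for v
    using edge_image_hull[OF that U(2,1)] by (simp add: ed_def)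
  have "{d \<in> tet_edges T. edge_image q d = edge_image q (ed w)} = ed ` range W"
  proof
    show "ed ` range W \<subseteq> {d \<in> tet_edges T. edge_image q d = edge_image q (ed w)}"
    proof
      fix d assume "d \<in> ed ` range W"
      then obtain n where n: "d = ed (W n)" by blast
      have "(fst (W n), convex hull {snd (W n) i, snd (W n) j}) \<in> tet_edges T"
        unfolding tet_edges_labelled[OF WL] using U(1) by (intro exI[of _ i] exI[of _ j]) simp
      moreover have "char_map q (W n) y = char_map q w y" if y: "y \<in> bary_simplex" "{k, l} \<subseteq> zeros y" for y
      proof (rule Q_orbit[OF _ w y(1)])
        have "W n \<in> orb (cross T) {k, l} w" using rW by blast
        then show "W n \<in> orb (cross T) (zeros y) w" using y(2) by (rule orb_mono)
      qed
      then have "edge_image q (ed (W n)) = edge_image q (ed w)"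
        unfolding edge_im[OF WL] edge_im[OF w] by (intro image_cong) auto
      ultimately show "d \<in> {d \<in> tet_edges T. edge_image q d = edge_image q (ed w)}"
        unfolding n by (simp add: ed_def)
    qed
    show "{d \<in> tet_edges T. edge_image q d = edge_image q (ed w)} \<subseteq> ed ` range W"
    proof
      fix d assume a: "d \<in> {d \<in> tet_edges T. edge_image q d = edge_image q (ed w)}"
      obtain t E where tE: "d = (t, E)" by (cases d)
      have d: "(t, E) \<in> tet_edges T" "edge_image q (t, E) = edge_image q (ed w)" using a unfolding tE by auto
      \<comment> \<open>The midpoint of the edge lies on the faces opposite to \<open>k\<close> and
        \<open>l\<close> and on no others. A simplex edge with the same image contains a point
        identified with it, and the chain of identifications then stays within the walk.\<close>
      define m :: "real ^ corner" where "m = (\<chi> n. if n \<in> {i, j} then 1 / 2 else 0)"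
      have "(\<Sum>n\<in>UNIV. m $ n) = (\<Sum>n\<in>{i, j}. m $ n)"
        unfolding m_def by (rule sum.mono_neutral_right) auto
      then have m1: "m \<in> bary_simplex" using U(1) by (simp add: bary_simplex_def m_def)
      have "zeros m = - {i, j}" by (auto simp: zeros_def m_def)
      then have m: "m \<in> bary_simplex" "zeros m = {k, l}" using m1 unfolding ij by auto
      have "char_map q w m \<in> edge_image q (t, E)" unfolding d(2) edge_im[OF w] using m by blast
      then obtain y where y: "y \<in> E" "char_map q w m = q (t, y)" by (auto simp: edge_image_def)
      have t: "t \<in> tets T" "E \<subseteq> tet T t"
        using d(1) edge_of_imp_subset by (auto simp: tet_edges_def)
      have chain: "((fst w, bpoint (snd w) m), (t, y)) \<in> (glue_rel T \<union> (glue_rel T)\<inverse>)\<^sup>*"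
        using q_eq_iff[OF labelled_point_in[OF w m(1)], of "(t, y)"] t y by (auto simp: char_map_def)
      then obtain v where v: "v \<in> orb (cross T) {k, l} w" "v \<in> labelled T" "t = fst v" "y = bpoint (snd v) m"
        using glue_rel_orb[OF w m(1) chain] unfolding m(2) prod.inject by blast
      obtain i' j' where ij': "i' \<noteq> j'" "E = convex hull {snd v i', snd v j'}"
        using tet_edges_labelled[OF v(2)] d(1) v(3) by auto
      \<comment> \<open>Seen from \<open>v\<close> the point is again the midpoint between the
        corners \<open>i\<close> and \<open>j\<close>, so an edge that contains it must be the edge
        between them.\<close>
      have "- {i', j'} \<subseteq> {k, l}"
        using bpoint_in_convex_hull_iff[OF labelledD(2,4)[OF v(2)] m(1), of "{i', j'}"] y(1) v(4) ij'(2) m(2)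
        by simp
      then have "{i, j} \<subseteq> {i', j'}" using ij by blast
      then have "{i', j'} = {i, j}" using U(1) by auto
      then have "snd v ` {i, j} = {snd v i', snd v j'}" by (metis image_empty image_insert)
      then have "(t, E) = ed v" using ij'(2) v(3) by (simp only: ed_def)
      then show "d \<in> ed ` range W" using v(1) rW tE by blast
    qed
  qed
  then have deg: "edge_degree T q (edge_image q (ed w)) = card (ed ` range W)" by (simp add: edge_degree_def)
  have "ed w \<in> ed ` range W" using W(2) by (metis imageI rangeI)
  then have "ed w \<in> tet_edges T"
    using \<open>{d \<in> tet_edges T. edge_image q d = edge_image q (ed w)} = ed ` range W\<close> by blast
  then have ev: "even (card (ed ` range W))" using even deg unfolding triangulation_edges_def by force
  have sgn_flip: "(0 < a) \<noteq> (0 < b)" if "a = - b" "b \<noteq> 0" for a b :: real using that by auto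
  have sr: "s (r v) \<noteq> v" if "v \<in> labelled T" for v
  proof
    assume "s (r v) = v"
    then have "\<sigma> \<circ> \<tau> = id" using act_free[OF that] by (simp add: s_def r_def act_act)
    then have "(\<sigma> \<circ> \<tau>) i = i" by simp
    then show False using \<tau> \<sigma> U(1) by simp
  qed
  have ss: "s (s v) = v" for v
    by (simp add: s_def act_act \<tau>_def act_id)
  have ne: "cross T k v \<noteq> r v" "cross T l v \<noteq> r v" if "v \<in> labelled T" for v
    unfolding r_def using cross_ne_change_labels[OF that bij(2)] \<sigma> by auto
  have sg: "(0 < orient T (cross T m v)) \<noteq> (0 < orient T v)"
    "(0 < orient T (s v)) \<noteq> (0 < orient T v)" "(0 < orient T (r v)) \<noteq> (0 < orient T v)"
    if v: "v \<in> labelled T" for m v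
  proof -
    show "(0 < orient T (cross T m v)) \<noteq> (0 < orient T v)"
      by (rule sgn_flip[OF orient_cross[OF v] orient_nonzero[OF v]])
    show "(0 < orient T (s v)) \<noteq> (0 < orient T v)"
      unfolding s_def \<tau>_def by (rule sgn_flip[OF orient_transpose[OF kl] orient_nonzero[OF v]])
    have "i \<noteq> j" using U(1) by simp
    then show "(0 < orient T (r v)) \<noteq> (0 < orient T v)"
      unfolding r_def \<sigma>_def by (rule sgn_flip[OF orient_transpose orient_nonzero[OF v]])
  qed
  have comm: "s (cross T k v) = cross T l (s v)" "s (cross T l v) = cross T k (s v)"
      "r (cross T k v) = cross T k (r v)" "r (cross T l v) = cross T l (r v)" if "v \<in> labelled T" for v
    unfolding s_def r_def
    using cross_change_labels[OF that bij(1)] cross_change_labels[OF that bij(2)] \<tau> \<sigma> by simp_all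
  have s_in: "s v \<in> labelled T" and r_in: "r v \<in> labelled T" if "v \<in> labelled T" for v
    unfolding s_def r_def using change_labels_in[OF that] bij by blast+
  note no_return = even_walk_no_return[where s = s and r = r and ed = ed and sg = "\<lambda>v. 0 < orient T v",
      OF W(1) cross_cross cross_cross s_in r_in ss comm sg(1) sg(1) sg(2) sg(3) sr ne ed_iff ev]
  have "s (W n) \<noteq> W n'" "r (W n) \<noteq> W n'" "s (r (W n)) \<noteq> W n'" for n n'
    using no_return by blast+
  then have no: "change_labels w \<tau> \<notin> range W" "change_labels w \<sigma> \<notin> range W"
    "change_labels w (\<sigma> \<circ> \<tau>) \<notin> range W"
    using W(2) by (auto simp: s_def r_def act_act)
  show ?thesis
    unfolding good_def
  proof (intro allI impI)
    fix g assume g: "bij g" "change_labels w g \<in> orb (cross T) (zeros x) w" "relabel x g = x"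
    \<comment> \<open>Since \<open>g\<close> fixes the coordinates it preserves their zeros, which
      leaves the four permutations of \<open>perm\<close>.\<close>
    have "g -` {k, l} = {k, l}" using zeros_relabel[of x g] g(3) x by simp
    then have "g \<in> {id, \<tau>, \<sigma>, \<sigma> \<circ> \<tau>}" by (intro perm[OF g(1)]) blast
    then show "g = id" using g(2) no x rW by auto
  qed
qed

lemma all_good:
  assumes "closed_3_manifold M" "\<forall>e\<in>triangulation_edges T q. even (edge_degree T q e)"
    and w: "w \<in> labelled T" and x: "x \<in> bary_simplex"
  shows "good w x"
proof -
  have nonvertex: "good w x" if "w \<in> labelled T" "x \<in> bary_simplex" "\<forall>k. x \<noteq> axis k 1" for w x
    using that(2,3)
  proof (cases rule: zeros_nonvertex)
    case 1 then show ?thesis using good_interior that(1) by blast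
  next
    case 2 then show ?thesis using good_face that(1) by blast
  next
    case 3 then show ?thesis using good_edge assms(2) that(1) by blast
  qed
  show ?thesis
  proof (cases "\<exists>k. x = axis k 1")
    case True
    then obtain k where k: "x = axis k 1" ..
    have "3 \<le> CARD(corner)" by (simp add: card_corner)
    then show ?thesis unfolding k using assms(1) nonvertex w by (intro vertex_good)
  qed (use nonvertex w x in blast)
qed

text \<open>Pigeonhole: the simplex has four corners, and there are at most three vertices to
  receive them.\<close>

lemma two_corners_identified:
  assumes w: "w \<in> labelled T" and V: "finite (triangulation_vertices T q)" "card (triangulation_vertices T q) < 4"
  obtains i j where "i \<noteq> j" "char_map q w (axis i 1) = char_map q w (axis j 1)"
proof -
  let ?v = "\<lambda>i. char_map q w (axis i 1)"
  have "range ?v \<subseteq> triangulation_vertices T q"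
  proof clarify
    fix i
    have "snd w i extreme_point_of tet T (fst w)"
      using labelledD(3)[OF w] unfolding simplex_corners_def by blast
    then show "?v i \<in> triangulation_vertices T q"
      using labelledD(1)[OF w] unfolding triangulation_vertices_def char_map_def bpoint_axis by blast
  qed
  then have "card (range ?v) \<le> card (triangulation_vertices T q)" by (rule card_mono[OF V(1)])
  then have "card (range ?v) < CARD(corner)" using V(2) by (simp add: card_corner)
  then have "\<not> inj ?v" using card_image[of ?v UNIV] by auto
  then show ?thesis using that by (auto simp: inj_def)
qed

end

text \<open>The target is commutative, so additivity of \<open>\<theta>\<close> after
  \<open>\<rho>\<close> suffices and the reversed order in \<open>monodromy_exists\<close> does no
  harm.\<close>

lemma epi_from_loops:
  fixes S :: "'a::topological_space set" and \<rho> :: "(real \<Rightarrow> 'a) \<Rightarrow> 'g"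
  assumes hom: "\<And>p q. p \<in> loops_at S x \<Longrightarrow> homotopic_paths S p q \<Longrightarrow> \<rho> p = \<rho> q"
    and join: "\<And>p q. p \<in> loops_at S x \<Longrightarrow> q \<in> loops_at S x \<Longrightarrow>
      \<theta> (\<rho> (p +++ q)) = (\<theta> (\<rho> p) + \<theta> (\<rho> q)) mod int n"
    and n: "n > 0" and onto: "\<theta> ` \<rho> ` loops_at S x = {0..<int n}"
  shows "epi (fundamental_group S x) (integer_mod_group n) \<noteq> {}"
proof -
  define f where "f = (\<lambda>A. \<theta> (\<rho> (SOME p. p \<in> loops_at S x \<and> path_class S p = A)))"
  have f: "f (path_class S p) = \<theta> (\<rho> p)" if p: "p \<in> loops_at S x" for p
  proof -
    define p' where "p' = (SOME p'. p' \<in> loops_at S x \<and> path_class S p' = path_class S p)"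
    have p': "p' \<in> loops_at S x" "path_class S p' = path_class S p"
      using someI[of "\<lambda>p'. p' \<in> loops_at S x \<and> path_class S p' = path_class S p" p] p
      unfolding p'_def by auto
    have "homotopic_paths S p' p" using path_class_eq_iff[OF p'(1)] p'(2) by blast
    then show ?thesis using hom[OF p'(1)] by (simp add: f_def p'_def)
  qed
  have carr: "carrier (fundamental_group S x) = path_class S ` loops_at S x"
    by (simp add: fundamental_group_def)
  have im: "f ` carrier (fundamental_group S x) = carrier (integer_mod_group n)"
  proof -
    have "f ` carrier (fundamental_group S x) = \<theta> ` \<rho> ` loops_at S x"
      unfolding carr image_image using f by (rule image_cong[OF refl])
    then show ?thesis using onto n by (simp add: carrier_integer_mod_group)
  qed
  moreover have "f \<in> hom (fundamental_group S x) (integer_mod_group n)"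
  proof (rule homI)
    show "f A \<in> carrier (integer_mod_group n)" if "A \<in> carrier (fundamental_group S x)" for A
      using im that by blast
    fix A B assume "A \<in> carrier (fundamental_group S x)" "B \<in> carrier (fundamental_group S x)"
    then obtain p q where p: "p \<in> loops_at S x" "A = path_class S p" and q: "q \<in> loops_at S x" "B = path_class S q"
      unfolding carr by blast
    show "f (A \<otimes>\<^bsub>fundamental_group S x\<^esub> B) = f A \<otimes>\<^bsub>integer_mod_group n\<^esub> f B"
      using mult_path_class[OF p(1) q(1)] f[OF loops_at_join[OF p(1) q(1)]] f[OF p(1)] f[OF q(1)]
        join[OF p(1) q(1)] by (simp add: p(2) q(2))
  qed
  ultimately show ?thesis unfolding epi_def by blast
qed

theorem mainTheorem8:
  fixes M :: "'a::topological_space set"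
    and T :: "'i gluing"
    and q :: "'i \<times> (real^3) \<Rightarrow> 'a"
    and x :: 'a
  assumes "closed_3_manifold M" and "connected M" and "orientable 3 M"
    and "even_triangulation T q M"
    and "card (triangulation_vertices T q) = 3"
    and "x \<in> M"
  shows "epi (fundamental_group M x) (integer_mod_group 2) \<noteq> {} \<or>
         epi (fundamental_group M x) (integer_mod_group 3) \<noteq> {}"
proof -
  have tri: "triangulation T q M" and even: "\<forall>e\<in>triangulation_edges T q. even (edge_degree T q e)"
    using assms(4) unfolding even_triangulation_def by auto
  interpret triangulated T M q
    by unfold_locales (use tri in \<open>auto simp: triangulation_def\<close>)
  obtain w y where w: "w \<in> labelled T" "y \<in> bary_simplex" "x = char_map q w y"
    using Q_surj[OF assms(6)] by blast
  \<comment> \<open>\<open>card\<close> of an infinite set is 0, so the value 3 gives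
    finiteness.\<close>
  have "finite (triangulation_vertices T q)" using assms(5) by (metis card.infinite zero_neq_numeral)
  then obtain i j where ij: "i \<noteq> j" "char_map q w (axis i 1) = char_map q w (axis j 1)"
    using two_corners_identified[OF w(1)] assms(5) by auto
  show ?thesis
  proof (rule monodromy_exists[OF all_good[OF assms(1) even] w(1,2), folded w(3)])
    fix \<rho> :: "(real \<Rightarrow> 'a) \<Rightarrow> corner \<Rightarrow> corner"
    assume \<rho>: "\<And>p. p \<in> loops_at M x \<Longrightarrow> bij (\<rho> p)"
      "\<And>p q. p \<in> loops_at M x \<Longrightarrow> homotopic_paths M p q \<Longrightarrow> \<rho> p = \<rho> q"
      "\<And>p q. p \<in> loops_at M x \<Longrightarrow> q \<in> loops_at M x \<Longrightarrow> \<rho> (p +++ q) = \<rho> q \<circ> \<rho> p"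
      "\<And>i j. i \<noteq> j \<Longrightarrow> char_map q w (axis i 1) = char_map q w (axis j 1) \<Longrightarrow>
        \<exists>p\<in>loops_at M x. \<rho> p \<noteq> id"
    obtain p where p: "p \<in> loops_at M x" "\<rho> p \<noteq> id" using \<rho>(4)[OF ij] by blast
    obtain n :: nat and \<theta> :: "(corner \<Rightarrow> corner) \<Rightarrow> int" where n: "n = 2 \<or> n = 3"
      and \<theta>: "\<And>g h. g \<in> \<rho> ` loops_at M x \<Longrightarrow> h \<in> \<rho> ` loops_at M x \<Longrightarrow> \<theta> (g \<circ> h) = (\<theta> g + \<theta> h) mod int n"
        "\<theta> ` \<rho> ` loops_at M x = {0..<int n}"
    proof (rule corner_group_quotient[of "\<rho> ` loops_at M x" "\<rho> p"])
      show "bij g" if "g \<in> \<rho> ` loops_at M x" for g using that \<rho>(1) by blast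
      show "g \<circ> h \<in> \<rho> ` loops_at M x" if gh: "g \<in> \<rho> ` loops_at M x" "h \<in> \<rho> ` loops_at M x" for g h
      proof -
        obtain p r where pr: "p \<in> loops_at M x" "g = \<rho> p" "r \<in> loops_at M x" "h = \<rho> r" using gh by blast
        \<comment> \<open>Because the order is reversed, the loop of \<open>h\<close> is run
          first.\<close>
        have "g \<circ> h = \<rho> (r +++ p)" using \<rho>(3)[OF pr(3,1)] pr(2,4) by simp
        then show ?thesis using loops_at_join[OF pr(3,1)] by (rule image_eqI)
      qed
    qed (use p in auto)
    have "epi (fundamental_group M x) (integer_mod_group n) \<noteq> {}"
    proof (rule epi_from_loops[OF \<rho>(2) _ _ \<theta>(2)])
      show "\<theta> (\<rho> (p +++ r)) = (\<theta> (\<rho> p) + \<theta> (\<rho> r)) mod int n"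
        if "p \<in> loops_at M x" "r \<in> loops_at M x" for p r
        using \<theta>(1)[of "\<rho> r" "\<rho> p"] \<rho>(3)[OF that] that by (simp add: add.commute)
    qed (use n in auto)
    then show ?thesis using n by blast
  qed
qed

end
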